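(* Let $0<c<1$, $0<r<1$, $\alpha\ge 0$, $\beta>0$, and put $\gamma=\frac{1+r^2}{1-r^2}$. Let $N\to\infty$ and $T=T(N)\to\infty$ with $N/T\to c$. Let $W_{N,T}$ be an $N\times T$ random matrix with i.i.d. real Gaussian entries of mean $0$ and variance $1$, let $\Sigma^s_N=\alpha I_N+\beta V_N$ with $V_N$ an $N\times N$ Wigner matrix, where almost surely $\Sigma^s_N$ is non-negative definite for all sufficiently large $N$, let $\Sigma^t_T$ be the $T\times T$ matrix with entries $\Sigma^t_T[a,b]=r^{|a-b|}$, and let $$C_N=\frac1T\left(\Sigma^s_N\right)^{1/2}W_{N,T}\,\Sigma^t_T\,W_{N,T}^{\mathrm T}\left(\Sigma^s_N\right)^{1/2}.$$ Assume that, almost surely and with respect to the normalized trace, $\frac1T W_{N,T}\Sigma^t_TW_{N,T}^{\mathrm T}$ and $\Sigma^s_N$ are asymptotically free, that $\frac1T W_{N,T}^{\mathrm T}W_{N,T}$ and $\Sigma^t_T$ are asymptotically free, and that $\Sigma^s_N$, $\Sigma^t_T$ and $C_N$ converge in distribution to $\Sigma^s$, $\Sigma^t$ and $C$ respectively. Let $\mu_C$ be the limiting spectral distribution of $C_N$ (the law of $C$) and $\mathcal G_C(z)=\int_{\mathbb R}\frac{1}{z-t}\,d\mu_C(t)$ its Cauchy transform. Then for all $z\in\mathbb C$ with $\operatorname{Im} z>0$, $$\sum_{i=0}^{8}p_i\,\mathcal G_C(z)^i=0,$$ where $$\begin{aligned} p_8&=\beta^4z^4,\\ p_7&=-4\beta^4z^3,\\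 p_6&=6\beta^4z^2-\frac{2\beta^4z^2}{c^2}+\frac{2\alpha\beta^2\gamma z^3}{c},\\ p_5&=-4\beta^4z+\frac{4\beta^4z}{c^2}-\frac{6\alpha\beta^2\gamma z^2}{c}+\frac{2\beta^2z^3}{c^2}-\frac{4\beta^2\gamma^2z^3}{c^2},\\ p_4&=\beta^4+\frac{\beta^4}{c^4}-\frac{2\beta^4}{c^2}-\frac{2\alpha\beta^2\gamma z}{c^3}+\frac{6\alpha\beta^2\gamma z}{c}+\frac{\alpha^2z^2}{c^2}-\frac{6\beta^2z^2}{c^2}+\frac{12\beta^2\gamma^2z^2}{c^2},\\ p_3&=\frac{2\alpha\beta^2\gamma}{c^3}-\frac{2\alpha\beta^2\gamma}{c}-\frac{2\beta^2z}{c^4}-\frac{2\alpha^2z}{c^2}+\frac{6\beta^2z}{c^2}-\frac{12\beta^2\gamma^2z}{c^2}-\frac{2\alpha\gamma z^2}{c^3},\\ p_2&=-\frac{\alpha^2}{c^4}+\frac{2\beta^2}{c^4}+\frac{\alpha^2}{c^2}-\frac{2\beta^2}{c^2}+\frac{4\beta^2\gamma^2}{c^2}+\frac{4\alpha\gamma z}{c^3}+\frac{z^2}{c^4},\\ p_1&=-\frac{2\alpha\gamma}{c^3}-\frac{2z}{c^4},\\ p_0&=\frac1{c^4}. \end{aligned}$$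
   Context: The normalized trace of an $n\times n$ matrix $M$ is $\mathrm{tr}(M)=\frac1n\mathrm{Tr}(M)$. The Wigner matrix $V_N$ is a Hermitian random matrix $N^{-1/2}(x_{ij})_{i,j\le N}$ whose entries $x_{ij}$, $i\le j$, are i.i.d. with mean zero and unit variance, so that its limiting spectral distribution is the semicircle law on $[-2,2]$ with density $\frac1{2\pi}\sqrt{4-x^2}$. A sequence of Hermitian matrices $A_N$ converges in distribution (almost surely) to a self-adjoint non-commutative random variable $a$ with compactly supported law $\mu_a$ if, almost surely, $\mathrm{tr}(A_N^k)\to\int t^k\,d\mu_a(t)$ for all $k\ge1$; here the law of $\Sigma^s$ is the semicircle law centred at $\alpha$ with density $\frac1{2\pi\beta^2}\sqrt{4\beta^2-(x-\alpha)^2}$ on $[\alpha-2\beta,\alpha+2\beta]$. Two sequences $A_N,B_N$ are asymptotically free (almost surely) with respect to the normalized trace if, almost surely, all mixed moments $\mathrm{tr}(A_N^{k_1}B_N^{l_1}\cdots A_N^{k_m}B_N^{l_m})$ converge to the corresponding mixed moments of a pair $a,b$ of freely independent elements of a non-commutative probability space. *)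

theory Defs
  imports
    "HOL-Probability.Probability"
    "Jordan_Normal_Form.Matrix"
    "Jordan_Normal_Form.Schur_Decomposition"
begin

section \<open>Deterministic matrices\<close>

definition norm_trace :: "complex mat \<Rightarrow> complex" where
  "norm_trace A = (\<Sum>i<dim_row A. A $$ (i, i)) / of_nat (dim_row A)"

definition nonneg_definite :: "complex mat \<Rightarrow> bool" where
  "nonneg_definite A \<longleftrightarrow>
     square_mat A \<and> mat_adjoint A = A \<and>
     (\<forall>v \<in> carrier_vec (dim_row A). 0 \<le> Re ((A *\<^sub>v v) \<bullet>c v))"

text \<open>
  The non-negative definite square root.  The value is unspecified if \<open>A\<close> is not non-negative
  definite.
\<close>
definition mat_sqrt :: "complex mat \<Rightarrow> complex mat" where
  "mat_sqrt A = (THE B. B \<in> carrier_mat (dim_row A) (dim_row A) \<and> nonneg_definite B \<and> B * B = A)"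

definition exp_covariance :: "real \<Rightarrow> nat \<Rightarrow> complex mat" where
  "exp_covariance r n =
     Matrix.mat n n (\<lambda>(a, b). complex_of_real (r ^ nat \<bar>int a - int b\<bar>))"

section \<open>Random matrices\<close>

definition gaussian_matrix :: "'w measure \<Rightarrow> nat \<Rightarrow> nat \<Rightarrow> ('w \<Rightarrow> real mat) \<Rightarrow> bool" where
  "gaussian_matrix M n t W \<longleftrightarrow>
     (\<forall>\<omega> \<in> space M. W \<omega> \<in> carrier_mat n t) \<and>
     prob_space.indep_vars M (\<lambda>_. borel) (\<lambda>(i, j) \<omega>. W \<omega> $$ (i, j)) ({..<n} \<times> {..<t}) \<and>
     (\<forall>i<n. \<forall>j<t. distributed M lborel (\<lambda>\<omega>. W \<omega> $$ (i, j)) std_normal_density)"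

text \<open>
  The i.i.d. family \<open>x i j\<close>, \<open>i \<le> j\<close>, contains the diagonal entries, which are real by
  Hermitian symmetry; so all entries are in fact almost surely real.
\<close>
definition wigner_matrix :: "'w measure \<Rightarrow> nat \<Rightarrow> ('w \<Rightarrow> complex mat) \<Rightarrow> bool" where
  "wigner_matrix M n V \<longleftrightarrow>
     (\<exists>x :: nat \<Rightarrow> nat \<Rightarrow> 'w \<Rightarrow> complex.
        prob_space.indep_vars M (\<lambda>_. borel) (\<lambda>(i, j). x i j) {(i, j). i \<le> j \<and> j < n} \<and>
        (\<forall>i j. i \<le> j \<and> j < n \<longrightarrow>
           distr M borel (x i j) = distr M borel (x 0 0) \<and>
           integrable M (x i j) \<and> (\<integral>\<omega>. x i j \<omega> \<partial>M) = 0 \<and>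
           integrable M (\<lambda>\<omega>. (cmod (x i j \<omega>))\<^sup>2) \<and> (\<integral>\<omega>. (cmod (x i j \<omega>))\<^sup>2 \<partial>M) = 1) \<and>
        (\<forall>\<omega> \<in> space M. \<forall>i<n. \<forall>j<n. x j i \<omega> = cnj (x i j \<omega>)) \<and>
        (\<forall>\<omega> \<in> space M. V \<omega> = Matrix.mat n n (\<lambda>(i, j). x i j \<omega> / complex_of_real (sqrt (real n)))))"

section \<open>Non-commutative probability spaces and freeness\<close>

locale nc_prob_space = vector_space smul
  for smul :: "complex \<Rightarrow> 'a::ring_1 \<Rightarrow> 'a" +
  fixes \<phi> :: "'a \<Rightarrow> complex"
  assumes scale_mult_left: "smul c x * y = smul c (x * y)"
    and scale_mult_right: "x * smul c y = smul c (x * y)"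
    and linear_state: "Vector_Spaces.linear smul (*) \<phi>"
    and state_one: "\<phi> 1 = 1"
begin

definition unital_subalgebra :: "'a set \<Rightarrow> bool" where
  "unital_subalgebra B \<longleftrightarrow> subspace B \<and> 1 \<in> B \<and> (\<forall>x\<in>B. \<forall>y\<in>B. x * y \<in> B)"

definition free_family :: "'i set \<Rightarrow> ('i \<Rightarrow> 'a set) \<Rightarrow> bool" where
  "free_family I B \<longleftrightarrow>
     (\<forall>xs :: ('i \<times> 'a) list.
        xs \<noteq> [] \<and>
        (\<forall>(i, x) \<in> set xs. i \<in> I \<and> x \<in> B i \<and> \<phi> x = 0) \<and>
        successively (\<noteq>) (map fst xs) \<longrightarrow>
        \<phi> (prod_list (map snd xs)) = 0)"

definition freely_independent :: "'a \<Rightarrow> 'a \<Rightarrow> bool" where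
  "freely_independent a b \<longleftrightarrow>
     free_family UNIV (\<lambda>i::bool. unital_subalgebra hull {if i then a else b})"

end

section \<open>Almost sure convergence\<close>

definition compactly_supported_law :: "real measure \<Rightarrow> bool" where
  "compactly_supported_law \<mu> \<longleftrightarrow>
     prob_space \<mu> \<and> sets \<mu> = sets borel \<and> (\<exists>K. compact K \<and> (AE t in \<mu>. t \<in> K))"

definition converges_in_distribution ::
    "'w measure \<Rightarrow> (nat \<Rightarrow> 'w \<Rightarrow> complex mat) \<Rightarrow> real measure \<Rightarrow> bool" where
  "converges_in_distribution M A \<mu> \<longleftrightarrow>
     compactly_supported_law \<mu> \<and>
     (AE \<omega> in M. \<forall>k\<ge>1.
        (\<lambda>N. norm_trace (A N \<omega> ^\<^sub>m k)) \<longlonglongrightarrow> complex_of_real (\<integral>t. t ^ k \<partial>\<mu>))"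

text \<open>
  Exponents may vanish, so the pairs \<open>(k\<^sub>1, l\<^sub>1), \<dots>, (k\<^sub>m, l\<^sub>m)\<close> produce all words in the two letters.
\<close>
definition mat_word :: "complex mat \<Rightarrow> complex mat \<Rightarrow> (nat \<times> nat) list \<Rightarrow> complex mat" where
  "mat_word A B kls = foldr (\<lambda>(k, l) P. A ^\<^sub>m k * B ^\<^sub>m l * P) kls (1\<^sub>m (dim_row A))"

text \<open>
  The almost sure joint limit of \<open>A N\<close>, \<open>B N\<close> is the free pair \<open>a\<close>, \<open>b\<close> of the space given by
  \<open>smul\<close> and \<open>\<phi>\<close>.  Asymptotic freeness asserts that some such limit exists; as a hypothesis it is
  stated for an arbitrary space, including its type.
\<close>
definition asymptotically_free ::
    "'w measure \<Rightarrow> (nat \<Rightarrow> 'w \<Rightarrow> complex mat) \<Rightarrow> (nat \<Rightarrow> 'w \<Rightarrow> complex mat) \<Rightarrow>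
     (complex \<Rightarrow> 'a::ring_1 \<Rightarrow> 'a) \<Rightarrow> ('a \<Rightarrow> complex) \<Rightarrow> 'a \<Rightarrow> 'a \<Rightarrow> bool" where
  "asymptotically_free M A B smul \<phi> a b \<longleftrightarrow>
     nc_prob_space smul \<phi> \<and>
     nc_prob_space.freely_independent smul \<phi> a b \<and>
     (AE \<omega> in M. \<forall>kls.
        (\<lambda>N. norm_trace (mat_word (A N \<omega>) (B N \<omega>) kls))
          \<longlonglongrightarrow> \<phi> (prod_list (map (\<lambda>(k, l). a ^ k * b ^ l) kls)))"

section \<open>Limit laws\<close>

definition semicircle_density :: "real \<Rightarrow> real \<Rightarrow> real \<Rightarrow> real" where
  "semicircle_density \<alpha> \<beta> x =
     (if \<alpha> - 2 * \<beta> \<le> x \<and> x \<le> \<alpha> + 2 * \<beta>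
      then 1 / (2 * pi * \<beta>\<^sup>2) * sqrt (4 * \<beta>\<^sup>2 - (x - \<alpha>)\<^sup>2) else 0)"

definition semicircle_law :: "real \<Rightarrow> real \<Rightarrow> real measure" where
  "semicircle_law \<alpha> \<beta> = density lborel (\<lambda>x. ennreal (semicircle_density \<alpha> \<beta> x))"

definition cauchy_transform :: "real measure \<Rightarrow> complex \<Rightarrow> complex" where
  "cauchy_transform \<mu> z = (\<integral>t. 1 / (z - complex_of_real t) \<partial>\<mu>)"

definition p_coeffs ::
    "complex \<Rightarrow> complex \<Rightarrow> complex \<Rightarrow> complex \<Rightarrow> complex \<Rightarrow> complex list" where
  "p_coeffs c \<alpha> \<beta> \<gamma> z =
    [1 / c^4,
     - (2 * \<alpha> * \<gamma> / c^3) - 2 * z / c^4,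
     - (\<alpha>^2 / c^4) + 2 * \<beta>^2 / c^4 + \<alpha>^2 / c^2 - 2 * \<beta>^2 / c^2 + 4 * \<beta>^2 * \<gamma>^2 / c^2
       + 4 * \<alpha> * \<gamma> * z / c^3 + z^2 / c^4,
     2 * \<alpha> * \<beta>^2 * \<gamma> / c^3 - 2 * \<alpha> * \<beta>^2 * \<gamma> / c - 2 * \<beta>^2 * z / c^4 - 2 * \<alpha>^2 * z / c^2
       + 6 * \<beta>^2 * z / c^2 - 12 * \<beta>^2 * \<gamma>^2 * z / c^2 - 2 * \<alpha> * \<gamma> * z^2 / c^3,
     \<beta>^4 + \<beta>^4 / c^4 - 2 * \<beta>^4 / c^2 - 2 * \<alpha> * \<beta>^2 * \<gamma> * z / c^3 + 6 * \<alpha> * \<beta>^2 * \<gamma> * z / c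
       + \<alpha>^2 * z^2 / c^2 - 6 * \<beta>^2 * z^2 / c^2 + 12 * \<beta>^2 * \<gamma>^2 * z^2 / c^2,
     - (4 * \<beta>^4 * z) + 4 * \<beta>^4 * z / c^2 - 6 * \<alpha> * \<beta>^2 * \<gamma> * z^2 / c + 2 * \<beta>^2 * z^3 / c^2
       - 4 * \<beta>^2 * \<gamma>^2 * z^3 / c^2,
     6 * \<beta>^4 * z^2 - 2 * \<beta>^4 * z^2 / c^2 + 2 * \<alpha> * \<beta>^2 * \<gamma> * z^3 / c,
     - (4 * \<beta>^4 * z^3),
     \<beta>^4 * z^4]"

end

(*
  Proof idea. The Cauchy transform G of C is determined, near infinity, by the moment series of C,
  and the S-transform is multiplicative under free multiplication: if chi_a is the compositional
  inverse of the moment series of a, then chi_ab = chi_a * chi_b * (1 + t) / t. So it suffices to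
  know three moment series.

  The Wishart part has the Marchenko-Pastur moments; they come from Gaussian integration by parts,
  whose loop equations show that all products of normalized traces converge in mean, so that the
  almost sure limits granted by asymptotic freeness must be the limits of the means.  For the
  covariance r^|a-b| the resolvent is, up to a scalar and corner effects, again a matrix
  rho^|a-b|.  The semicircle moments satisfy a linear recursion, that is, an ODE for their
  generating function, which integrates to a quadratic equation.

  The three inverses satisfy quadratic equations, and eliminating the auxiliary unknown y leaves a
  resultant, which is the stated polynomial.  Analytic continuation extends the equation from
  large z to the upper half plane.
*)
theory Submission
  imports
    Defs
    "HOL-Complex_Analysis.Complex_Analysis"
    "Jordan_Normal_Form.Spectral_Radius"
begin

section \<open>Geometric series over a non-commutative ring\<close>

text \<open>Freeness is given for a bare unital algebra with a unital linear functional, so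
  resolvents live in formal power series and freeness is applied coefficientwise. The free pairs are
  not the products that define C: cyclic invariance of the matrix trace removes the square roots of
  the spatial matrix and moves the temporal covariance from T x T to N x N matrices, which changes
  the normalization and brings in the factor N/T -> c. Inverting a moment series needs a nonzero
  mean. For the spatial matrix the mean is \<alpha>, which is only assumed to be at least 0; the
  case \<alpha> = 0 is excluded by positivity, since tr(A (A - 1)^2) is non-negative for
  non-negative definite A, while a centred semicircle would give the limit -2 \<beta>^2. Matrices of
  different sizes may depend on each other in any way, so the means alone must identify an almost
  sure limit. They do, because means of products of two traces have limits too: the variance tends
  to 0, and a subsequence converges almost surely.\<close>

definition fps_geometric :: "'a::ring_1 fps \<Rightarrow> 'a fps" where
  "fps_geometric p = Abs_fps (\<lambda>k. \<Sum>n\<le>k. fps_nth (p ^ n) k)"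

lemma fps_nth_power_eq_0:
  fixes p :: "'a::ring_1 fps"
  assumes "fps_nth p 0 = 0" "k < n"
  shows "fps_nth (p ^ n) k = 0"
  using assms(2)
proof (induction n arbitrary: k)
  case (Suc n)
  have "fps_nth p i * fps_nth (p ^ n) (k - i) = 0" if "i \<le> k" for i
    using that assms(1) Suc by (cases "i = 0") auto
  then show ?case by (simp add: fps_mult_nth)
qed simp

lemma fps_nth_geometric:
  fixes p :: "'a::ring_1 fps"
  assumes "fps_nth p 0 = 0" "k \<le> K"
  shows "fps_nth (fps_geometric p) k = fps_nth (\<Sum>n\<le>K. p ^ n) k"
proof -
  have "(\<Sum>n\<le>K. fps_nth (p ^ n) k) = (\<Sum>n\<le>k. fps_nth (p ^ n) k)"
    using assms by (intro sum.mono_neutral_right) (auto intro: fps_nth_power_eq_0)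
  then show ?thesis by (simp add: fps_geometric_def fps_sum_nth)
qed

text \<open>Even between two factors only finitely many powers reach degree k. This reduces the
  state of a product around a resolvent to a finite sum of states of words.\<close>

lemma fps_nth_mult_geometric:
  fixes p :: "'a::ring_1 fps"
  assumes "fps_nth p 0 = 0"
  shows "fps_nth (L * fps_geometric p * R) k = (\<Sum>n\<le>k. fps_nth (L * p ^ n * R) k)"
proof -
  have *: "fps_nth (L * fps_geometric p) i = fps_nth (L * (\<Sum>n\<le>k. p ^ n)) i" if "i \<le> k" for i
    unfolding fps_mult_nth using that
    by (intro sum.cong arg_cong2[where f = "(*)"] fps_nth_geometric assms) auto
  have "fps_nth (L * fps_geometric p * R) k = fps_nth (L * (\<Sum>n\<le>k. p ^ n) * R) k"
    unfolding fps_mult_nth[of _ R] by (intro sum.cong arg_cong2[where f = "(*)"] *) auto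
  then show ?thesis
    by (simp add: sum_distrib_left sum_distrib_right fps_sum_nth)
qed

lemma fps_geometric_inverse:
  fixes p :: "'a::ring_1 fps"
  assumes "fps_nth p 0 = 0"
  shows "(1 - p) * fps_geometric p = 1" "fps_geometric p * (1 - p) = 1"
proof -
  \<comment> \<open>Truncated sums telescope to 1 - p^(k+1), and the last power starts beyond degree
    k.\<close>
  have tel: "(1 - p) * (\<Sum>n\<le>k. p ^ n) = 1 - p ^ Suc k" for k
    by (induction k) (simp_all add: distrib_left, simp add: left_diff_distrib)
  have tel': "(\<Sum>n\<le>k. p ^ n) * (1 - p) = 1 - p ^ Suc k" for k
    by (induction k)
      (simp_all add: distrib_right, simp add: right_diff_distrib power_commutes mult.assoc)
  show "(1 - p) * fps_geometric p = 1"
  proof (rule fps_ext)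
    fix k
    have "fps_nth ((1 - p) * fps_geometric p) k = fps_nth ((1 - p) * (\<Sum>n\<le>k. p ^ n)) k"
      using fps_nth_mult_geometric[OF assms, of "1 - p" 1 k]
      by (simp add: sum_distrib_left fps_sum_nth)
    then show "fps_nth ((1 - p) * fps_geometric p) k = fps_nth 1 k"
      unfolding tel using fps_nth_power_eq_0[OF assms, of k "Suc k"] by simp
  qed
  show "fps_geometric p * (1 - p) = 1"
  proof (rule fps_ext)
    fix k
    have "fps_nth (fps_geometric p * (1 - p)) k = fps_nth ((\<Sum>n\<le>k. p ^ n) * (1 - p)) k"
      using fps_nth_mult_geometric[OF assms, of 1 "1 - p" k]
      by (simp add: sum_distrib_right fps_sum_nth)
    then show "fps_nth (fps_geometric p * (1 - p)) k = fps_nth 1 k"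
      unfolding tel' using fps_nth_power_eq_0[OF assms, of k "Suc k"] by simp
  qed
qed

section \<open>Free multiplicative convolution\<close>

context nc_prob_space
begin

text \<open>The constant term is 0 and not \<phi> 1 = 1, so that the series can have a compositional
  inverse.\<close>

definition moment_series :: "'a \<Rightarrow> complex fps" where
  "moment_series x = Abs_fps (\<lambda>n. if n = 0 then 0 else \<phi> (x ^ n))"

text \<open>Scalar series become central among the algebra-valued ones
  (\<open>fps_embed_commute\<close>), so that the argument of a resolvent can itself be a power
  series.\<close>

definition fps_embed :: "complex fps \<Rightarrow> 'a fps" where
  "fps_embed F = Abs_fps (\<lambda>n. smul (fps_nth F n) 1)"

definition fps_state :: "'a fps \<Rightarrow> complex fps" where
  "fps_state F = Abs_fps (\<lambda>n. \<phi> (fps_nth F n))"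

lemma state_add: "\<phi> (x + y) = \<phi> x + \<phi> y"
  using linear_state by (simp add: Vector_Spaces.linear_iff)

lemma state_scale: "\<phi> (smul c x) = c * \<phi> x"
  using linear_state by (simp add: Vector_Spaces.linear_iff)

lemma state_0 [simp]: "\<phi> 0 = 0"
  using state_scale[of 0 0] by simp

lemma state_sum: "\<phi> (\<Sum>i\<in>I. f i) = (\<Sum>i\<in>I. \<phi> (f i))"
  by (induction I rule: infinite_finite_induct) (auto simp: state_add)

lemma smul_1_mult [simp]: "smul c 1 * x = smul c x" "x * smul c 1 = smul c x"
  by (simp_all add: scale_mult_left scale_mult_right)

lemma fps_embed_simps [simp]:
  "fps_embed 1 = 1" "fps_embed fps_X = fps_X"
  "fps_embed (F + G) = fps_embed F + fps_embed G"
  by (auto intro!: fps_ext simp: fps_embed_def fps_X_def scale_left_distrib)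

lemma fps_embed_mult: "fps_embed (F * G) = fps_embed F * fps_embed G"
  by (rule fps_ext) (simp add: fps_embed_def fps_mult_nth scale_sum_left scale_mult_left
      mult.commute)

lemma fps_nth_embed [simp]: "fps_nth (fps_embed F) n = smul (fps_nth F n) 1"
  by (simp add: fps_embed_def)

lemma fps_embed_commute: "G * fps_embed F = fps_embed F * G"
proof (rule fps_ext)
  fix n
  have "(\<Sum>i=0..n. smul (fps_nth F (n - i)) (fps_nth G i))
      = (\<Sum>i=0..n. smul (fps_nth F i) (fps_nth G (n - i)))"
    by (rule sum.reindex_bij_witness[of _ "\<lambda>i. n - i" "\<lambda>i. n - i"]) auto
  then show "fps_nth (G * fps_embed F) n = fps_nth (fps_embed F * G) n"
    by (simp add: fps_mult_nth fps_embed_def)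
qed

lemma fps_state_add: "fps_state (F + G) = fps_state F + fps_state G"
  by (rule fps_ext) (simp add: fps_state_def state_add)

lemma fps_state_embed_mult: "fps_state (fps_embed F * G) = F * fps_state G"
  by (rule fps_ext) (simp add: fps_state_def fps_embed_def fps_mult_nth state_sum state_scale)

lemma fps_state_1 [simp]: "fps_state 1 = 1"
  by (rule fps_ext) (simp add: fps_state_def state_one)

lemma power_embed_const:
  "(fps_embed u * fps_const x) ^ n = fps_embed (u ^ n) * fps_const (x ^ n)"
proof (induction n)
  case (Suc n)
  have "(fps_embed u * fps_const x) ^ Suc n
      = fps_embed u * (fps_const x * fps_embed (u ^ n)) * fps_const (x ^ n)"
    by (simp add: Suc mult.assoc)
  also have "\<dots> = fps_embed (u ^ Suc n) * (fps_const x * fps_const (x ^ n))"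
    by (simp only: fps_embed_commute[of "fps_const x"]) (simp add: fps_embed_mult mult.assoc)
  finally show ?case by simp
qed simp

text \<open>Composing the moment series with u amounts to taking the state of (1 - u x)^-1. A
  compositional inverse thus becomes a resolvent of state 1 + X, which is how the S-transform enters
  the algebra.\<close>

lemma fps_state_geometric:
  assumes "fps_nth u 0 = 0"
  shows "fps_state (fps_geometric (fps_embed u * fps_const x)) = 1 + (moment_series x oo u)"
proof (rule fps_ext)
  fix k
  have "fps_nth (fps_state (fps_geometric (fps_embed u * fps_const x))) k
      = (\<Sum>n\<le>k. fps_nth (u ^ n) k * \<phi> (x ^ n))"
    unfolding fps_state_def fps_geometric_def power_embed_const
    by (simp add: state_sum state_scale)
  also have "\<dots> = fps_nth 1 k + (\<Sum>n\<in>{..k} - {0}. fps_nth (u ^ n) k * \<phi> (x ^ n))"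
    by (subst sum.remove[of _ 0]) (auto simp: state_one)
  also have "(\<Sum>n\<in>{..k} - {0}. fps_nth (u ^ n) k * \<phi> (x ^ n)) = fps_nth (moment_series x oo u) k"
    unfolding fps_compose_nth moment_series_def
    by (intro sum.mono_neutral_cong_left) (auto simp: mult.commute)
  finally show "fps_nth (fps_state (fps_geometric (fps_embed u * fps_const x))) k
      = fps_nth (1 + (moment_series x oo u)) k" by simp
qed

lemma unital_subalgebra_power:
  assumes "unital_subalgebra B" "x \<in> B"
  shows "x ^ n \<in> B"
  using assms by (induction n) (auto simp: unital_subalgebra_def)

text \<open>Each coefficient is a polynomial in x, since the coefficients of u are scalars.
  Freeness, a condition on subalgebras, therefore applies to coefficients.\<close>

lemma geometric_nth_in_hull:
  "fps_nth (fps_geometric (fps_embed u * fps_const x)) k \<in> unital_subalgebra hull {x}"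
proof -
  have "fps_nth (fps_geometric (fps_embed u * fps_const x)) k \<in> B"
    if B: "unital_subalgebra B" and x: "x \<in> B" for B
  proof -
    have "subspace B" using B by (simp add: unital_subalgebra_def)
    then show ?thesis
      unfolding fps_geometric_def power_embed_const
      by (auto intro!: subspace_sum subspace_scale unital_subalgebra_power B x)
  qed
  then show ?thesis by (auto simp: hull_def)
qed

lemma hull_subspace: "subspace (unital_subalgebra hull S)"
  by (auto simp: hull_def subspace_def unital_subalgebra_def)

lemma one_in_hull: "1 \<in> unital_subalgebra hull S"
  by (auto simp: hull_def unital_subalgebra_def)

section \<open>Freeness for power series with centered coefficients\<close>

definition alternating_centered :: "('i \<Rightarrow> 'a set) \<Rightarrow> ('i \<times> 'a) list \<Rightarrow> bool" where
  "alternating_centered B xs \<longleftrightarrow>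
     (\<forall>(i, x) \<in> set xs. x \<in> B i \<and> \<phi> x = 0) \<and> successively (\<noteq>) (map fst xs)"

text \<open>
  Contains the alternating centered words whose first letter is in \<open>B i\<close> and, unlike the set of
  these words, is closed under sums; so it can be used coefficientwise for power series.
\<close>
definition starts_with :: "('i \<Rightarrow> 'a set) \<Rightarrow> 'i \<Rightarrow> 'a set" where
  "starts_with B i =
     {y. \<forall>xs. alternating_centered B xs \<and> (xs \<noteq> [] \<longrightarrow> fst (last xs) \<noteq> i)
          \<longrightarrow> \<phi> (prod_list (map snd xs) * y) = 0}"

lemma alternating_centered_snoc:
  assumes "alternating_centered B xs" "xs \<noteq> [] \<longrightarrow> fst (last xs) \<noteq> i" "x \<in> B i" "\<phi> x = 0"
  shows "alternating_centered B (xs @ [(i, x)])"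
  using assms by (auto simp: alternating_centered_def successively_append_iff last_map)

lemma starts_with_state: "y \<in> starts_with B i \<Longrightarrow> \<phi> y = 0"
  unfolding starts_with_def alternating_centered_def by (auto dest: spec[of _ "[]"])

lemma starts_with_centered:
  assumes "free_family UNIV B" "x \<in> B i" "\<phi> x = 0"
  shows "x \<in> starts_with B i"
  unfolding starts_with_def
proof (intro CollectI allI impI, elim conjE)
  fix xs assume "alternating_centered B xs" "xs \<noteq> [] \<longrightarrow> fst (last xs) \<noteq> i"
  from alternating_centered_snoc[OF this assms(2,3)]
  have "\<phi> (prod_list (map snd (xs @ [(i, x)]))) = 0"
    using assms(1) unfolding free_family_def alternating_centered_def by blast
  then show "\<phi> (prod_list (map snd xs) * x) = 0" by simp
qed

lemma starts_with_mult:
  assumes "x \<in> B i" "\<phi> x = 0" "y \<in> starts_with B j" "i \<noteq> j"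
  shows "x * y \<in> starts_with B i"
  unfolding starts_with_def
proof (intro CollectI allI impI, elim conjE)
  fix xs assume "alternating_centered B xs" "xs \<noteq> [] \<longrightarrow> fst (last xs) \<noteq> i"
  from alternating_centered_snoc[OF this assms(1,2)]
  have "\<phi> (prod_list (map snd (xs @ [(i, x)])) * y) = 0"
    using assms(3,4) unfolding starts_with_def by (auto dest!: spec[of _ "xs @ [(i, x)]"])
  then show "\<phi> (prod_list (map snd xs) * (x * y)) = 0" by (simp add: mult.assoc)
qed

lemma starts_with_sum:
  assumes "\<And>k. k \<in> I \<Longrightarrow> f k \<in> starts_with B i"
  shows "(\<Sum>k\<in>I. f k) \<in> starts_with B i"
  using assms unfolding starts_with_def by (auto simp: sum_distrib_left state_sum)

lemma starts_with_fps_mult: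
  assumes "\<And>n. fps_nth F n \<in> B i" "\<And>n. \<phi> (fps_nth F n) = 0"
    and "\<And>n. fps_nth G n \<in> starts_with B j" "i \<noteq> j"
  shows "fps_nth (F * G) n \<in> starts_with B i"
  unfolding fps_mult_nth by (intro starts_with_sum starts_with_mult[where j = j] assms)

text \<open>
  With \<open>A = (1 - u a)\<^sup>-\<^sup>1 = 1 + t + t a'\<close> and \<open>B = (1 - v b)\<^sup>-\<^sup>1 = 1 + t + t b'\<close>, where \<open>a'\<close> and
  \<open>b'\<close> are centered, one has \<open>A (1 - x a b) B = (1 + t) - t a' b'\<close>; hence
  \<open>(1 - x a b)\<^sup>-\<^sup>1\<close> is \<open>(1 + t)\<^sup>-\<^sup>1 B (1 - t (1 + t)\<^sup>-\<^sup>1 a' b')\<^sup>-\<^sup>1 A\<close>, and in its expansion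
  freeness kills all words but the empty one.
\<close>
theorem moment_series_free_mult:
  assumes free: "freely_independent a b"
    and u0: "fps_nth u 0 = 0" and v0: "fps_nth v 0 = 0"
    and u: "moment_series a oo u = fps_X" and v: "moment_series b oo v = fps_X"
    and x: "fps_X * x = u * v * (1 + fps_X)"
  shows "moment_series (a * b) oo x = fps_X"
proof -
  let ?Alg = "\<lambda>i. unital_subalgebra hull {if i then a else b}"
  define T :: "'a fps" where "T = fps_X"
  define p where "p = fps_embed u * fps_const a"
  define q where "q = fps_embed v * fps_const b"
  define A where "A = fps_geometric p"
  define B where "B = fps_geometric q"
  \<comment> \<open>The constant coefficients of A and B are 1, so the shift divides A - (1 + T) and
    B - (1 + T) by T without remainder.\<close>
  define a' where "a' = fps_shift 1 (A - (1 + T))"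
  define b' where "b' = fps_shift 1 (B - (1 + T))"
  have p0: "fps_nth p 0 = 0" and q0: "fps_nth q 0 = 0"
    by (simp_all add: p_def q_def u0 v0)
  have Teq: "T = fps_embed fps_X" by (simp add: T_def)
  have Tc: "y * T = T * y" for y unfolding Teq by (rule fps_embed_commute)
  have Tc': "y * (T * z) = T * (y * z)" for y z by (metis Tc mult.assoc)
  have shift: "T * fps_shift 1 F = F" if "fps_nth F 0 = 0" for F :: "'a fps"
    using that by (intro fps_ext) (auto simp: T_def)
  have A: "A = 1 + T + T * a'" and B: "B = 1 + T + T * b'"
    unfolding a'_def b'_def
    by (subst shift; simp add: A_def B_def fps_geometric_def T_def)+
  have cancel: "F = H" if "T * F = T * H" for F H
  proof (rule fps_ext)
    fix n show "fps_nth F n = fps_nth H n"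
      using arg_cong[OF that, of "\<lambda>Q. fps_nth Q (Suc n)"] by (simp add: T_def)
  qed
  \<comment> \<open>The choice of u and v makes the states of A and B equal to 1 + X, so X times the
    state of a' (or b') is 0.\<close>
  have centered_aux: "F' = 0"
    if "fps_state (1 + T + T * F) = 1 + fps_X" "F' = fps_state F" for F F'
  proof -
    have "fps_state (1 + T + T * F) = fps_state 1 + fps_state (fps_embed fps_X * 1) +
        fps_state (fps_embed fps_X * F)"
      by (simp add: Teq fps_state_add)
    also have "\<dots> = 1 + fps_X + fps_X * fps_state F"
      by (simp only: fps_state_embed_mult) simp
    finally show ?thesis using that by simp
  qed
  have "fps_state A = 1 + fps_X" "fps_state B = 1 + fps_X"
    unfolding A_def B_def p_def q_def by (simp_all add: fps_state_geometric u0 v0 u v)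
  then have "fps_state a' = 0" "fps_state b' = 0"
    using centered_aux A B by metis+
  then have ca: "\<phi> (fps_nth a' n) = 0" and cb: "\<phi> (fps_nth b' n) = 0" for n
    by (simp_all add: fps_state_def fps_eq_iff)
  have ha: "fps_nth a' n \<in> ?Alg True" and hb: "fps_nth b' n \<in> ?Alg False" for n
    unfolding a'_def b'_def T_def A_def B_def p_def q_def
    by (auto simp: fps_X_nth intro!: subspace_diff hull_subspace geometric_nth_in_hull one_in_hull
        subspace_0 subspace_add)
  define P where "P = 1 - fps_embed x * fps_const (a * b)"
  have Ap: "A * p = A - 1" and qB: "q * B = B - 1"
    using fps_geometric_inverse(2)[OF p0] fps_geometric_inverse(1)[OF q0]
    by (simp_all add: A_def B_def algebra_simps)
  \<comment> \<open>The hypothesis determines only X * x, so the identity is proved after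
    multiplication by T, which is cancelled at the end.\<close>
  have "T * (A * P * B) = T * (A * B) - (T * fps_embed x) * (A * fps_const a) * (fps_const b * B)"
  proof -
    have "A * (fps_embed x * fps_const (a * b)) * B
        = fps_embed x * (A * fps_const a) * (fps_const b * B)"
      by (simp only: fps_const_mult[symmetric] mult.assoc[symmetric] fps_embed_commute[of A x])
    then show ?thesis
      unfolding P_def by (simp add: right_diff_distrib left_diff_distrib mult.assoc)
  qed
  also have "T * fps_embed x = fps_embed u * fps_embed v * (1 + T)"
    using arg_cong[OF x, of fps_embed] by (simp add: fps_embed_mult Teq)
  also have "fps_embed u * fps_embed v * (1 + T) * (A * fps_const a) * (fps_const b * B)
      = (1 + T) * (A * p) * (q * B)"
  proof -
    have "fps_embed u * fps_embed v * (1 + T) * (A * fps_const a) * (fps_const b * B)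
      = (1 + T) * (fps_embed u * fps_embed v * (A * fps_const a)) * (fps_const b * B)"
      using Tc[of "fps_embed u * fps_embed v"]
      by (simp only: mult.assoc[symmetric] distrib_left distrib_right mult_1 mult.right_neutral)
    also have "fps_embed u * fps_embed v * (A * fps_const a) = A * p * fps_embed v"
      by (simp only: p_def mult.assoc[symmetric]
          fps_embed_commute[of "A * fps_embed u * fps_const a" v]
          fps_embed_commute[of "fps_embed v * A" u])
    finally show ?thesis by (simp add: q_def mult.assoc)
  qed
  \<comment> \<open>Since A - 1 = T (1 + a') and B - 1 = T (1 + b'), all terms linear in a' and b'
    cancel. The factor (1 + t) / t of the S-transform is what makes this happen.\<close>
  also have "T * (A * B) - (1 + T) * (A * p) * (q * B) = T * (1 + T - T * a' * b')"
    unfolding Ap qB unfolding A B by (simp add: algebra_simps Tc[of a'] Tc'[of a'])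
  finally have "A * P * B = 1 + T - T * a' * b'"
    by (rule cancel)
  moreover define e where "e = inverse (1 + fps_X :: complex fps)"
  have e: "e * (1 + fps_X) = 1" "(1 + fps_X) * e = 1"
    unfolding e_def by (simp_all add: inverse_mult_eq_1 inverse_mult_eq_1')
  have Ee: "(1 + T) * fps_embed e = 1" "fps_embed e * (1 + T) = 1"
    using arg_cong[OF e(1), of fps_embed] arg_cong[OF e(2), of fps_embed]
    by (simp_all add: fps_embed_mult Teq)
  define w where "w = fps_embed (e * fps_X) * (a' * b')"
  have w0: "fps_nth w 0 = 0" by (simp add: w_def fps_embed_def)
  define G where "G = fps_geometric w"
  have G: "G * (1 - w) = 1" "(1 - w) * G = 1"
    using fps_geometric_inverse[OF w0] by (simp_all add: G_def)
  have "1 + T - T * a' * b' = (1 + T) * (1 - w)"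
    unfolding w_def fps_embed_mult Teq[symmetric] using Ee
    by (simp add: right_diff_distrib mult.assoc[symmetric])
  ultimately have APB: "A * P * B = (1 + T) * (1 - w)" by simp
  have x0: "fps_nth x 0 = 0"
  proof -
    have "fps_nth (fps_X * x) 1 = fps_nth (u * v * (1 + fps_X)) 1" by (simp add: x)
    then show ?thesis by (simp add: fps_mult_nth u0 v0)
  qed
  define pab where "pab = fps_embed x * fps_const (a * b)"
  have pab0: "fps_nth pab 0 = 0" by (simp add: pab_def x0)
  have "(1 - p) * A = 1" "B * (1 - q) = 1"
    using fps_geometric_inverse[OF p0] fps_geometric_inverse[OF q0] by (simp_all add: A_def B_def)
  then have "P = (1 - p) * (A * P * B) * (1 - q)"
    by (metis mult.assoc mult.right_neutral mult_1)
  then have P: "P = (1 - p) * ((1 + T) * (1 - w)) * (1 - q)" by (simp add: APB)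
  \<comment> \<open>Only a right inverse of P is exhibited; the left inverse
    \<open>fps_geometric pab\<close> then agrees with it.\<close>
  have "P * (B * G * fps_embed e * A) = 1"
  proof -
    have "(1 - q) * B = 1" "(1 - p) * A = 1"
      using fps_geometric_inverse[OF p0] fps_geometric_inverse[OF q0] by (simp_all add: A_def B_def)
    then have "(1 - p) * ((1 + T) * ((1 - w) * (((1 - q) * B) * G) * fps_embed e)) * A = 1"
      by (simp add: G(2) Ee(1))
    then show ?thesis by (simp only: P mult.assoc)
  qed
  then have "fps_geometric pab = fps_geometric pab * P * (B * G * fps_embed e * A)"
    by (simp add: mult.assoc)
  also have "fps_geometric pab * P = 1"
    using fps_geometric_inverse(2)[OF pab0] by (simp add: P_def pab_def)
  finally have "fps_geometric pab = B * G * fps_embed e * A" by simp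
  also have "\<dots> = fps_embed e * (B * G * A)"
    by (metis fps_embed_commute mult.assoc)
  finally have "fps_state (fps_geometric pab) = e * fps_state (B * G * A)"
    by (simp add: fps_state_embed_mult)
  also have "fps_state (B * G * A) = (1 + fps_X) ^ 2"
  proof -
    have fam: "free_family UNIV ?Alg" using free by (simp add: freely_independent_def)
    note sw = starts_with_fps_mult[where B = ?Alg]
    have ka: "fps_nth a' n \<in> starts_with ?Alg True" for n
      by (rule starts_with_centered[OF fam ha ca])
    have kb: "fps_nth b' n \<in> starts_with ?Alg False" for n
      by (rule starts_with_centered[OF fam hb cb])
    \<comment> \<open>The families of words that occur in B G A: nonempty, alternating in a' and b',
      hence of state 0.\<close>
    have k1: "fps_nth ((a' * b') ^ Suc n) k \<in> starts_with ?Alg True" for n k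
    proof (induction n arbitrary: k)
      case 0 show ?case using sw[OF ha ca kb] by simp
    next
      case (Suc n)
      have "fps_nth (b' * (a' * b') ^ Suc n) k \<in> starts_with ?Alg False" for k
        using sw[OF hb cb Suc] by simp
      from sw[OF ha ca this] show ?case by (simp add: mult.assoc)
    qed
    have k2: "fps_nth (b' * (a' * b') ^ n) k \<in> starts_with ?Alg False" for n k
    proof (cases n)
      case 0 then show ?thesis using kb by simp
    next
      case (Suc m) then show ?thesis using sw[OF hb cb k1] by simp
    qed
    have k3: "fps_nth ((a' * b') ^ n * a') k \<in> starts_with ?Alg True" for n k
    proof (induction n arbitrary: k)
      case 0 show ?case using ka by simp
    next
      case (Suc n)
      have "fps_nth (b' * ((a' * b') ^ n * a')) k \<in> starts_with ?Alg False" for k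
        using sw[OF hb cb Suc] by simp
      from sw[OF ha ca this] show ?case by (simp add: mult.assoc)
    qed
    have k4: "fps_nth (b' * ((a' * b') ^ n * a')) k \<in> starts_with ?Alg False" for n k
      using sw[OF hb cb k3] by simp
    have wn: "L * w ^ n * R = fps_embed ((e * fps_X) ^ n) * (L * (a' * b') ^ n * R)" for L R n
    proof -
      have "w ^ n = fps_embed ((e * fps_X) ^ n) * (a' * b') ^ n"
      proof (induction n)
        case (Suc n)
        have "w ^ Suc n = fps_embed ((e * fps_X) ^ n) * (fps_embed (e * fps_X)) * (a' * b') * (a' * b') ^ n"
          by (simp only: power_Suc Suc mult.assoc[symmetric] fps_embed_commute[of w "(e * fps_X) ^ n"])
            (simp only: w_def mult.assoc)
        then show ?case
          by (simp only: fps_embed_mult[symmetric] power_Suc2[symmetric]) (simp only: power_Suc mult.assoc)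
      qed simp
      then show ?thesis by (metis fps_embed_commute mult.assoc)
    qed
    have st0: "fps_state F = 0" if "\<And>k. fps_nth F k \<in> starts_with ?Alg i" for F i
      using starts_with_state[OF that] by (intro fps_ext) (simp add: fps_state_def)
    have GLR: "fps_nth (fps_state (L * G * R)) k
        = (\<Sum>n\<le>k. fps_nth ((e * fps_X) ^ n * fps_state (L * (a' * b') ^ n * R)) k)" for L R k
    proof -
      have "fps_nth (fps_state (L * G * R)) k = (\<Sum>n\<le>k. fps_nth (fps_state (L * w ^ n * R)) k)"
        unfolding G_def fps_state_def fps_nth_mult_geometric[OF w0] by (simp add: state_sum)
      then show ?thesis by (simp only: wn fps_state_embed_mult)
    qed
    have "fps_state (b' * ((a' * b') ^ n)) = 0" "fps_state ((a' * b') ^ n * a') = 0"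
      "fps_state (b' * ((a' * b') ^ n * a')) = 0" "fps_state ((a' * b') ^ Suc n) = 0" for n
      using st0[OF k2] st0[OF k3] st0[OF k4] st0[OF k1] by blast+
    note z = this
    have "fps_state (b' * G) = 0" "fps_state (G * a') = 0" "fps_state (b' * G * a') = 0"
      using GLR[of b' 1] GLR[of 1 a'] GLR[of b' a'] z
      by (auto intro!: fps_ext simp: mult.assoc)
    moreover have "fps_state G = 1"
    proof (rule fps_ext)
      fix k
      have "fps_nth (fps_state G) k
          = (\<Sum>n\<le>k. fps_nth ((e * fps_X) ^ n * fps_state ((a' * b') ^ n)) k)"
        using GLR[of 1 1 k] by simp
      also have "\<dots> = (\<Sum>n\<le>k. if n = 0 then fps_nth 1 k else 0)"
      proof (rule sum.cong)
        fix n show "fps_nth ((e * fps_X) ^ n * fps_state ((a' * b') ^ n)) k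
            = (if n = 0 then fps_nth 1 k else 0)"
          using z(4) by (cases n) (auto simp del: power_Suc)
      qed simp
      finally show "fps_nth (fps_state G) k = fps_nth 1 k" by simp
    qed
    \<comment> \<open>Of this expansion only the first term has a nonzero state.\<close>
    moreover have "B * G * A = fps_embed ((1 + fps_X) ^ 2) * G
       + fps_embed ((1 + fps_X) * fps_X) * (b' * G) + fps_embed ((1 + fps_X) * fps_X) * (G * a')
       + fps_embed (fps_X * fps_X) * (b' * G * a')"
      unfolding A B fps_embed_mult power2_eq_square fps_embed_simps T_def[symmetric]
      by (simp add: algebra_simps Tc[of b'] Tc'[of b'] Tc[of G] Tc'[of G])
    ultimately show ?thesis
      by (simp only: fps_state_add fps_state_embed_mult) simp
  qed
  also have "e * (1 + fps_X) ^ 2 = 1 + fps_X"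
    by (simp add: power2_eq_square mult.assoc[symmetric] e)
  finally have "1 + (moment_series (a * b) oo x) = 1 + fps_X"
    unfolding pab_def using fps_state_geometric[OF x0] by simp
  then show ?thesis by simp
qed

end

section \<open>Gaussian integration by parts for polynomials\<close>

text \<open>Stein's recursion for the moments of the standard normal law, in the form in which
  \<open>monom_wick\<close> uses it.\<close>

fun gauss_moment :: "nat \<Rightarrow> real" where
  "gauss_moment 0 = 1"
| "gauss_moment (Suc 0) = 0"
| "gauss_moment (Suc (Suc n)) = real (Suc n) * gauss_moment n"

lemma gauss_moment_even: "gauss_moment (2 * k) = fact (2 * k) / (2 ^ k * fact k)"
proof (induction k)
  case (Suc k)
  have "gauss_moment (2 * Suc k) = real (Suc (2 * k)) * (fact (2 * k) / (2 ^ k * fact k))"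
    by (simp add: Suc[symmetric])
  also have "\<dots> = fact (2 * Suc k) / (2 ^ Suc k * fact (Suc k))"
    by (simp add: divide_simps)
  finally show ?case .
qed simp

lemma gauss_moment_odd: "gauss_moment (2 * k + 1) = 0"
  by (induction k) simp_all

lemma integral_std_normal_power:
  "(\<integral>x. std_normal_density x * x ^ n \<partial>lborel) = gauss_moment n"
proof (cases "even n")
  case True
  then obtain k where "n = 2 * k" by (elim evenE)
  then show ?thesis using integral_std_normal_moment_even[of k] gauss_moment_even[of k] by simp
next
  case False
  then obtain k where "n = 2 * k + 1" by (elim oddE)
  then show ?thesis using integral_std_normal_moment_odd[of k] gauss_moment_odd[of k] by simp
qed

text \<open>A monomial is a list of variables with repetitions, so that an induction can push
  variables onto it one at a time.\<close>

definition list_monom :: "'i list \<Rightarrow> ('i \<Rightarrow> real) \<Rightarrow> real" where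
  "list_monom es x = (\<Prod>e\<leftarrow>es. x e)"

lemma list_monom_simps [simp]:
  "list_monom [] x = 1" "list_monom (e # es) x = x e * list_monom es x"
  by (simp_all add: list_monom_def)

lemma list_monom_eq_prod:
  assumes "finite I" "set es \<subseteq> I"
  shows "list_monom es x = (\<Prod>e\<in>I. x e ^ count_list es e)"
  using assms(2)
proof (induction es)
  case (Cons f es)
  have "(\<Prod>e\<in>I. x e ^ count_list (f # es) e)
      = (\<Prod>e\<in>I. (if e = f then x f else 1) * x e ^ count_list es e)"
    by (intro prod.cong) auto
  also have "\<dots> = x f * (\<Prod>e\<in>I. x e ^ count_list es e)"
    using Cons.prems assms(1) by (simp add: prod.distrib)
  finally show ?case using Cons by simp
qed simp

text \<open>
  Products are generated by multiplying with one variable at a time, so that integration by parts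
  against a monomial can be proved by rule induction.
\<close>
inductive poly_deriv :: "'i set \<Rightarrow> 'i \<Rightarrow> (('i \<Rightarrow> real) \<Rightarrow> real) \<Rightarrow> (('i \<Rightarrow> real) \<Rightarrow> real) \<Rightarrow> bool"
  for I e where
  const: "poly_deriv I e (\<lambda>x. c) (\<lambda>x. 0)"
| add: "poly_deriv I e f f' \<Longrightarrow> poly_deriv I e g g' \<Longrightarrow>
    poly_deriv I e (\<lambda>x. f x + g x) (\<lambda>x. f' x + g' x)"
| var_mult: "i \<in> I \<Longrightarrow> poly_deriv I e f f' \<Longrightarrow>
    poly_deriv I e (\<lambda>x. x i * f x) (\<lambda>x. (if i = e then f x else 0) + x i * f' x)"

lemma poly_deriv_cong:
  assumes "poly_deriv I e f f'" "\<And>x. f x = g x" "\<And>x. f' x = g' x"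
  shows "poly_deriv I e g g'"
proof -
  have "f = g" "f' = g'" using assms by auto
  then show ?thesis using assms(1) by simp
qed

lemma poly_deriv_scale:
  assumes "poly_deriv I e f f'"
  shows "poly_deriv I e (\<lambda>x. c * f x) (\<lambda>x. c * f' x)"
  using assms
proof induction
  case (const d)
  show ?case by (rule poly_deriv_cong[OF poly_deriv.const[of I e "c * d"]]) auto
next
  case (add f f' g g')
  show ?case by (rule poly_deriv_cong[OF poly_deriv.add[OF add.IH]]) (auto simp: distrib_left)
next
  case (var_mult i f f')
  show ?case
    by (rule poly_deriv_cong[OF poly_deriv.var_mult[OF var_mult.hyps(1) var_mult.IH]])
      (auto simp: algebra_simps)
qed

lemma poly_deriv_mult:
  assumes "poly_deriv I e f f'" "poly_deriv I e g g'"
  shows "poly_deriv I e (\<lambda>x. f x * g x) (\<lambda>x. f' x * g x + f x * g' x)"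
  using assms(1)
proof induction
  case (const c)
  show ?case by (rule poly_deriv_cong[OF poly_deriv_scale[OF assms(2), of c]]) auto
next
  case (add f1 f1' f2 f2')
  show ?case by (rule poly_deriv_cong[OF poly_deriv.add[OF add.IH]]) (auto simp: algebra_simps)
next
  case (var_mult i f1 f1')
  show ?case
    by (rule poly_deriv_cong[OF poly_deriv.var_mult[OF var_mult.hyps(1) var_mult.IH]])
      (auto simp: algebra_simps)
qed

lemma poly_deriv_var:
  "i \<in> I \<Longrightarrow> poly_deriv I e (\<lambda>x. x i) (\<lambda>x. if i = e then 1 else 0)"
  by (rule poly_deriv_cong[OF poly_deriv.var_mult[OF _ poly_deriv.const[of I e 1]]]) auto

lemma poly_deriv_sum:
  assumes "\<And>k. k \<in> K \<Longrightarrow> poly_deriv I e (f k) (f' k)"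
  shows "poly_deriv I e (\<lambda>x. \<Sum>k\<in>K. f k x) (\<lambda>x. \<Sum>k\<in>K. f' k x)"
  using assms
  by (induction K rule: infinite_finite_induct) (auto intro: poly_deriv.intros)

fun list_monom_deriv :: "'i \<Rightarrow> 'i list \<Rightarrow> ('i \<Rightarrow> real) \<Rightarrow> real" where
  "list_monom_deriv e [] x = 0"
| "list_monom_deriv e (f # es) x =
     (if f = e then list_monom es x else 0) + x f * list_monom_deriv e es x"

lemma list_monom_remove1: "e \<in> set es \<Longrightarrow> x e * list_monom (remove1 e es) x = list_monom es x"
  by (induction es) (auto simp: mult.left_commute)

lemma list_monom_deriv_eq:
  "list_monom_deriv e es x = real (count_list es e) * list_monom (remove1 e es) x"
proof (induction es)
  case (Cons f es)
  then show ?case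
    using list_monom_remove1[of e es x]
    by (cases "e \<in> set es") (auto simp: algebra_simps count_list_0_iff remove1_idem)
qed simp

locale gaussian_family = prob_space M for M :: "'w measure" +
  fixes I :: "'i set" and X :: "'i \<Rightarrow> 'w \<Rightarrow> real"
  assumes finite_I: "finite I"
    and indep: "indep_vars (\<lambda>_. borel) X I"
    and normal: "\<And>i. i \<in> I \<Longrightarrow> distributed M lborel (X i) std_normal_density"
begin

abbreviation sample :: "'w \<Rightarrow> 'i \<Rightarrow> real" where
  "sample \<omega> \<equiv> (\<lambda>i. X i \<omega>)"

lemma power_integrable: "i \<in> I \<Longrightarrow> integrable M (\<lambda>\<omega>. X i \<omega> ^ n)"
  using distributed_integrable[OF normal, of i "\<lambda>x. x ^ n"]
    integrable_std_normal_moment[of n] by simp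

lemma expectation_power: "i \<in> I \<Longrightarrow> expectation (\<lambda>\<omega>. X i \<omega> ^ n) = gauss_moment n"
  using distributed_integral[OF normal, of i "\<lambda>x. x ^ n"]
    integral_std_normal_power[of n] by simp

lemma monom_expectation:
  assumes "set es \<subseteq> I"
  shows "integrable M (\<lambda>\<omega>. list_monom es (sample \<omega>))"
    and "expectation (\<lambda>\<omega>. list_monom es (sample \<omega>)) = (\<Prod>e\<in>I. gauss_moment (count_list es e))"
proof -
  have ind: "indep_vars (\<lambda>_. borel) (\<lambda>e \<omega>. X e \<omega> ^ count_list es e) I"
    by (rule indep_vars_compose2[OF indep, where Y = "\<lambda>e x. x ^ count_list es e"]) auto
  show "integrable M (\<lambda>\<omega>. list_monom es (sample \<omega>))"
    unfolding list_monom_eq_prod[OF finite_I assms]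
    by (rule indep_vars_integrable[OF finite_I ind]) (rule power_integrable)
  show "expectation (\<lambda>\<omega>. list_monom es (sample \<omega>)) = (\<Prod>e\<in>I. gauss_moment (count_list es e))"
    unfolding list_monom_eq_prod[OF finite_I assms]
    by (subst indep_vars_lebesgue_integral[OF finite_I ind])
      (auto intro: power_integrable prod.cong expectation_power)
qed

lemma monom_deriv_integrable:
  assumes "set es \<subseteq> I"
  shows "integrable M (\<lambda>\<omega>. list_monom_deriv e es (sample \<omega>))"
  unfolding list_monom_deriv_eq
  using assms set_remove1_subset[of e es] by (intro integrable_mult_right monom_expectation) auto

text \<open>Independence factors both sides over the variables. The factors differ only at e, where
  the claim is m(k + 1) = k m(k - 1) for normal moments m, with k the exponent of e.\<close>

lemma monom_wick:
  assumes "set es \<subseteq> I" "e \<in> I"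
  shows "expectation (\<lambda>\<omega>. X e \<omega> * list_monom es (sample \<omega>))
       = expectation (\<lambda>\<omega>. list_monom_deriv e es (sample \<omega>))"
proof -
  let ?c = "count_list es e"
  have "expectation (\<lambda>\<omega>. X e \<omega> * list_monom es (sample \<omega>))
      = (\<Prod>f\<in>I. gauss_moment (count_list (e # es) f))"
    using monom_expectation(2)[of "e # es"] assms by simp
  also have "\<dots> = gauss_moment (Suc ?c) * (\<Prod>f\<in>I - {e}. gauss_moment (count_list es f))"
    unfolding prod.remove[OF finite_I assms(2)]
    by (intro arg_cong2[where f = "(*)"] prod.cong) auto
  \<comment> \<open>For ?c = 0 the truncated difference ?c - 1 is harmless, as its factor is
    0.\<close>
  also have "gauss_moment (Suc ?c) = real ?c * gauss_moment (?c - 1)"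
    by (cases ?c) simp_all
  also have "real ?c * gauss_moment (?c - 1) * (\<Prod>f\<in>I - {e}. gauss_moment (count_list es f))
      = real ?c * (\<Prod>f\<in>I. gauss_moment (count_list (remove1 e es) f))"
  proof -
    have "count_list (remove1 e es) f = (if f = e then ?c - 1 else count_list es f)" for f
      by (induction es) (auto simp: count_list_0_iff)
    then have "(\<Prod>f\<in>I. gauss_moment (count_list (remove1 e es) f))
        = gauss_moment (?c - 1) * (\<Prod>f\<in>I - {e}. gauss_moment (count_list es f))"
      unfolding prod.remove[OF finite_I assms(2)]
      by (intro arg_cong2[where f = "(*)"] prod.cong) auto
    then show ?thesis by simp
  qed
  also have "\<dots> = expectation (\<lambda>\<omega>. list_monom_deriv e es (sample \<omega>))"
    unfolding list_monom_deriv_eq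
    using monom_expectation(2)[of "remove1 e es"] assms set_remove1_subset[of e es] by auto
  finally show ?thesis .
qed

text \<open>The monomial es is an accumulator: in the case \<open>var_mult\<close> the variable
  moves from the polynomial into es, and the induction hypothesis is applied with and without it.
  The integrability claims travel along because the case \<open>add\<close> needs them to split
  expectations.\<close>

lemma integration_by_parts_monom:
  assumes "poly_deriv I e f f'" "e \<in> I" "set es \<subseteq> I"
  shows "integrable M (\<lambda>\<omega>. list_monom es (sample \<omega>) * f (sample \<omega>)) \<and>
    integrable M (\<lambda>\<omega>. list_monom es (sample \<omega>) * f' (sample \<omega>)) \<and>
    integrable M (\<lambda>\<omega>. list_monom_deriv e es (sample \<omega>) * f (sample \<omega>)) \<and>
    expectation (\<lambda>\<omega>. X e \<omega> * list_monom es (sample \<omega>) * f (sample \<omega>)) =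
    expectation (\<lambda>\<omega>. list_monom_deriv e es (sample \<omega>) * f (sample \<omega>)
                   + list_monom es (sample \<omega>) * f' (sample \<omega>)) \<and>
    integrable M (\<lambda>\<omega>. X e \<omega> * list_monom es (sample \<omega>) * f (sample \<omega>))"
  using assms(1,3)
proof (induction arbitrary: es)
  case (const c)
  then show ?case
    using monom_expectation(1)[of es] monom_expectation(1)[of "e # es"]
      monom_deriv_integrable[of es e] monom_wick[of es e] assms(2) by simp
next
  case (add f f' g g')
  note F = add.IH(1)[OF add.prems] and G = add.IH(2)[OF add.prems]
  show ?case using F G
    by (simp add: distrib_left Bochner_Integration.integral_add)
next
  case (var_mult i f f')
  have "set (i # es) \<subseteq> I" using var_mult by simp
  note F = var_mult.IH[OF this] and G = var_mult.IH[OF var_mult.prems]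
  show ?case
  proof (intro conjI)
    show "integrable M (\<lambda>\<omega>. list_monom es (sample \<omega>) * (X i \<omega> * f (sample \<omega>)))"
      using F by (simp add: mult.assoc mult.left_commute)
    have "integrable M (\<lambda>\<omega>. (if i = e then list_monom es (sample \<omega>) * f (sample \<omega>) else 0)
        + list_monom (i # es) (sample \<omega>) * f' (sample \<omega>))"
      by (intro Bochner_Integration.integrable_add) (use F G in \<open>cases "i = e"; simp\<close>)+
    then show "integrable M (\<lambda>\<omega>. list_monom es (sample \<omega>)
        * ((if i = e then f (sample \<omega>) else 0) + X i \<omega> * f' (sample \<omega>)))"
      by (rule back_subst[of "integrable M"]) (auto simp: algebra_simps)
    have "integrable M (\<lambda>\<omega>. list_monom_deriv e (i # es) (sample \<omega>) * f (sample \<omega>)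
        - (if i = e then list_monom es (sample \<omega>) * f (sample \<omega>) else 0))"
      by (intro Bochner_Integration.integrable_diff) (use F G in \<open>cases "i = e"; simp\<close>)+
    then show "integrable M (\<lambda>\<omega>. list_monom_deriv e es (sample \<omega>) * (X i \<omega> * f (sample \<omega>)))"
      by (rule back_subst[of "integrable M"]) (auto simp: algebra_simps)
    show "integrable M (\<lambda>\<omega>. X e \<omega> * list_monom es (sample \<omega>) * (X i \<omega> * f (sample \<omega>)))"
      using F by (simp add: mult_ac)
    have "expectation (\<lambda>\<omega>. X e \<omega> * list_monom es (sample \<omega>) * (X i \<omega> * f (sample \<omega>)))
        = expectation (\<lambda>\<omega>. X e \<omega> * list_monom (i # es) (sample \<omega>) * f (sample \<omega>))"
      by (simp add: mult_ac)
    also have "\<dots> = expectation (\<lambda>\<omega>. list_monom_deriv e (i # es) (sample \<omega>) * f (sample \<omega>)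
                   + list_monom (i # es) (sample \<omega>) * f' (sample \<omega>))"
      using F by blast
    also have "\<dots> = expectation (\<lambda>\<omega>. list_monom_deriv e es (sample \<omega>) * (X i \<omega> * f (sample \<omega>))
        + list_monom es (sample \<omega>) * ((if i = e then f (sample \<omega>) else 0) + X i \<omega> * f' (sample \<omega>)))"
      by (intro Bochner_Integration.integral_cong) (auto simp: algebra_simps)
    finally show "expectation (\<lambda>\<omega>. X e \<omega> * list_monom es (sample \<omega>) * (X i \<omega> * f (sample \<omega>)))
      = expectation (\<lambda>\<omega>. list_monom_deriv e es (sample \<omega>) * (X i \<omega> * f (sample \<omega>))
        + list_monom es (sample \<omega>) * ((if i = e then f (sample \<omega>) else 0) + X i \<omega> * f' (sample \<omega>)))" .
  qed
qed

theorem integration_by_parts: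
  assumes "poly_deriv I e f f'" "e \<in> I"
  shows "integrable M (\<lambda>\<omega>. f (sample \<omega>))" "integrable M (\<lambda>\<omega>. f' (sample \<omega>))"
    "integrable M (\<lambda>\<omega>. X e \<omega> * f (sample \<omega>))"
    "expectation (\<lambda>\<omega>. X e \<omega> * f (sample \<omega>)) = expectation (\<lambda>\<omega>. f' (sample \<omega>))"
  using integration_by_parts_monom[OF assms, of "[]"] by simp_all

end

section \<open>Moments of Wishart matrices\<close>

definition gram :: "nat \<Rightarrow> (nat \<times> nat \<Rightarrow> real) \<Rightarrow> nat \<Rightarrow> nat \<Rightarrow> real" where
  "gram n x l m = (\<Sum>p<n. x (p, l) * x (p, m))"

fun gram_power :: "nat \<Rightarrow> nat \<Rightarrow> nat \<Rightarrow> (nat \<times> nat \<Rightarrow> real) \<Rightarrow> nat \<Rightarrow> nat \<Rightarrow> real" where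
  "gram_power n t 0 x l j = (if l = j then 1 else 0)"
| "gram_power n t (Suc k) x l j = (\<Sum>m<t. gram n x l m * gram_power n t k x m j)"

text \<open>The entries of x (x^T x)^k, up to a factor the gradient of the trace of (x^T x)^(k+1);
  see \<open>poly_deriv_gram_trace\<close>.\<close>

definition row_power :: "nat \<Rightarrow> nat \<Rightarrow> nat \<Rightarrow> (nat \<times> nat \<Rightarrow> real) \<Rightarrow> nat \<Rightarrow> nat \<Rightarrow> real" where
  "row_power n t k x p j = (\<Sum>m<t. x (p, m) * gram_power n t k x m j)"

definition gram_trace :: "nat \<Rightarrow> nat \<Rightarrow> nat \<Rightarrow> (nat \<times> nat \<Rightarrow> real) \<Rightarrow> real" where
  "gram_trace n t k x = (\<Sum>l<t. gram_power n t k x l l)"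

lemma gram_sym: "gram n x l m = gram n x m l"
  by (simp add: gram_def mult.commute)

lemma gram_power_add:
  assumes "l < t"
  shows "(\<Sum>m<t. gram_power n t a x l m * gram_power n t b x m j) = gram_power n t (a + b) x l j"
  using assms
proof (induction a arbitrary: l)
  case 0
  have "(\<Sum>m<t. gram_power n t 0 x l m * gram_power n t b x m j)
      = (\<Sum>m<t. if m = l then gram_power n t b x m j else 0)"
    by (intro sum.cong) auto
  then show ?case using 0 by simp
next
  case (Suc a)
  have "(\<Sum>m<t. gram_power n t (Suc a) x l m * gram_power n t b x m j)
      = (\<Sum>m'<t. gram n x l m' * (\<Sum>m<t. gram_power n t a x m' m * gram_power n t b x m j))"
    by (simp add: sum_distrib_left sum_distrib_right mult.assoc) (rule sum.swap)
  also have "\<dots> = gram_power n t (Suc a + b) x l j"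
    using Suc.IH by (auto intro!: sum.cong)
  finally show ?case .
qed

lemma gram_power_one: "l < t \<Longrightarrow> j < t \<Longrightarrow> gram_power n t 1 x l j = gram n x l j"
  by (simp add: if_distrib[of "\<lambda>z. _ * z"] cong: if_cong)

lemma gram_power_Suc_right:
  assumes "l < t" "j < t"
  shows "gram_power n t (Suc k) x l j = (\<Sum>m<t. gram_power n t k x l m * gram n x m j)"
proof -
  have "(\<Sum>m<t. gram_power n t k x l m * gram n x m j)
      = (\<Sum>m<t. gram_power n t k x l m * gram_power n t 1 x m j)"
    using assms by (intro sum.cong) (auto simp: gram_power_one simp del: gram_power.simps One_nat_def)
  then show ?thesis
    using gram_power_add[OF assms(1), of n k x 1 j] by (simp del: gram_power.simps)
qed

lemma gram_power_sym:
  "l < t \<Longrightarrow> j < t \<Longrightarrow> gram_power n t k x l j = gram_power n t k x j l"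
proof (induction k arbitrary: l j)
  case (Suc k)
  have "gram_power n t (Suc k) x l j = (\<Sum>m<t. gram_power n t k x l m * gram n x m j)"
    by (rule gram_power_Suc_right[OF Suc.prems])
  also have "\<dots> = (\<Sum>m<t. gram n x j m * gram_power n t k x m l)"
    using Suc by (intro sum.cong) (auto simp: gram_sym mult.commute)
  finally show ?case by simp
qed simp

lemma sum_rotate:
  "(\<Sum>p\<in>A. \<Sum>m\<in>B. \<Sum>k\<in>C. f p m k) = (\<Sum>m\<in>B. \<Sum>k\<in>C. \<Sum>p\<in>A. f p m k)"
  by (subst sum.swap) (intro sum.cong refl sum.swap)

lemma row_power_prod:
  assumes "q < t" "j < t"
  shows "(\<Sum>p<n. row_power n t a x p q * row_power n t b x p j) = gram_power n t (Suc (a + b)) x q j"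
proof -
  have "(\<Sum>p<n. row_power n t a x p q * row_power n t b x p j)
      = (\<Sum>m<t. \<Sum>m'<t. gram_power n t a x m q * (gram n x m m' * gram_power n t b x m' j))"
    unfolding row_power_def gram_def sum_product
    by (subst sum_rotate) (simp add: sum_distrib_left sum_distrib_right mult_ac)
  also have "\<dots> = (\<Sum>m<t. gram_power n t a x q m * gram_power n t (Suc b) x m j)"
  proof (rule sum.cong[OF refl])
    fix m assume "m \<in> {..<t}"
    then have "gram_power n t a x m q = gram_power n t a x q m"
      using assms by (intro gram_power_sym) auto
    then show "(\<Sum>m'<t. gram_power n t a x m q * (gram n x m m' * gram_power n t b x m' j))
        = gram_power n t a x q m * gram_power n t (Suc b) x m j"
      by (simp add: sum_distrib_left)
  qed
  also have "\<dots> = gram_power n t (Suc (a + b)) x q j"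
    using gram_power_add[OF assms(1), of n a x "Suc b" j] by simp
  finally show ?thesis .
qed

lemma gram_row_power:
  "(\<Sum>m<t. gram n x l m * row_power n t a x p m) = row_power n t (Suc a) x p l" if "l < t"
proof -
  have "(\<Sum>m<t. gram n x l m * row_power n t a x p m)
      = (\<Sum>m'<t. x (p, m') * (\<Sum>m<t. gram_power n t a x m' m * gram n x m l))"
    unfolding row_power_def sum_distrib_left
    by (subst sum.swap) (intro sum.cong, auto simp: gram_sym mult_ac)
  also have "\<dots> = row_power n t (Suc a) x p l"
    unfolding row_power_def using gram_power_Suc_right[OF _ that] by (intro sum.cong) auto
  finally show ?thesis .
qed

text \<open>Singles out one factor x(p, q) in each term of the trace, as integration by parts
  requires.\<close>

lemma sum_var_row_power:
  "(\<Sum>p<n. \<Sum>q<t. x (p, q) * row_power n t k x p q) = gram_trace n t (Suc k) x"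
proof -
  have "(\<Sum>p<n. \<Sum>q<t. x (p, q) * row_power n t k x p q)
      = (\<Sum>q<t. \<Sum>m<t. gram n x q m * gram_power n t k x m q)"
    unfolding row_power_def gram_def sum_distrib_left sum_distrib_right
    by (subst sum.swap, rule sum.cong[OF refl], subst sum.swap) (simp add: mult_ac)
  then show ?thesis by (simp add: gram_trace_def)
qed

text \<open>With G = x^T x this is the derivative of the entry (l, j) of G^k in x(p, q): the product
  rule replaces one factor G by its derivative, a sum of two matrices of rank at most one, between
  G^a and G^(k - 1 - a).\<close>

definition gram_power_deriv where
  "gram_power_deriv n t k p q x l j =
     (\<Sum>a<k. gram_power n t a x l q * row_power n t (k - 1 - a) x p j
           + row_power n t a x p l * gram_power n t (k - 1 - a) x q j)"

lemma gram_power_deriv_Suc: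
  assumes "l < t" "q < t"
  shows "gram_power_deriv n t (Suc k) p q x l j =
    (if l = q then row_power n t k x p j else 0) + x (p, l) * gram_power n t k x q j
    + (\<Sum>m<t. gram n x l m * gram_power_deriv n t k p q x m j)"
proof -
  have "(\<Sum>m<t. gram n x l m * gram_power_deriv n t k p q x m j)
      = (\<Sum>a<k. (\<Sum>m<t. gram n x l m * gram_power n t a x m q) * row_power n t (k - 1 - a) x p j
           + (\<Sum>m<t. gram n x l m * row_power n t a x p m) * gram_power n t (k - 1 - a) x q j)"
    unfolding gram_power_deriv_def sum_distrib_left sum_distrib_right sum.distrib[symmetric]
    by (subst sum.swap) (simp add: algebra_simps)
  also have "\<dots> = (\<Sum>a<k. gram_power n t (Suc a) x l q * row_power n t (k - Suc a) x p j
           + row_power n t (Suc a) x p l * gram_power n t (k - Suc a) x q j)"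
    using gram_row_power[OF assms(1)] by simp
  finally show ?thesis
    using assms unfolding gram_power_deriv_def sum.lessThan_Suc_shift
    by (simp add: row_power_def if_distrib[of "\<lambda>z. _ * z"] if_distrib[of "\<lambda>z. z * _"] cong: if_cong)
qed

lemma poly_deriv_gram:
  assumes "l < t" "m < t"
  shows "poly_deriv ({..<n} \<times> {..<t}) (p, q) (\<lambda>x. gram n x l m)
    (\<lambda>x. (if p < n \<and> l = q then x (p, m) else 0) + (if p < n \<and> m = q then x (p, l) else 0))"
proof -
  have "poly_deriv ({..<n} \<times> {..<t}) (p, q) (\<lambda>x. gram n x l m)
     (\<lambda>x. \<Sum>p'<n. (if (p', l) = (p, q) then 1 else 0) * x (p', m)
             + x (p', l) * (if (p', m) = (p, q) then 1 else 0))"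
    unfolding gram_def using assms by (intro poly_deriv_sum poly_deriv_mult poly_deriv_var) auto
  then show ?thesis
    by (rule poly_deriv_cong)
      (auto simp: sum.distrib if_distrib[of "\<lambda>z. _ * z"] if_distrib[of "\<lambda>z. z * _"] cong: if_cong)
qed

lemma poly_deriv_gram_power:
  assumes "l < t" "p < n" "q < t"
  shows "poly_deriv ({..<n} \<times> {..<t}) (p, q) (\<lambda>x. gram_power n t k x l j)
    (\<lambda>x. gram_power_deriv n t k p q x l j)"
  using assms(1)
proof (induction k arbitrary: l)
  case 0
  show ?case
    by (rule poly_deriv_cong[OF poly_deriv.const[of _ _ "if l = j then 1 else 0"]])
      (auto simp: gram_power_deriv_def)
next
  case (Suc k)
  have "poly_deriv ({..<n} \<times> {..<t}) (p, q) (\<lambda>x. gram_power n t (Suc k) x l j)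
    (\<lambda>x. \<Sum>m<t. ((if p < n \<and> l = q then x (p, m) else 0) + (if p < n \<and> m = q then x (p, l) else 0))
          * gram_power n t k x m j + gram n x l m * gram_power_deriv n t k p q x m j)"
    unfolding gram_power.simps using Suc
    by (intro poly_deriv_sum poly_deriv_mult poly_deriv_gram) auto
  then show ?case
  proof (rule poly_deriv_cong)
    fix x
    show "(\<Sum>m<t. ((if p < n \<and> l = q then x (p, m) else 0) + (if p < n \<and> m = q then x (p, l) else 0))
          * gram_power n t k x m j + gram n x l m * gram_power_deriv n t k p q x m j)
        = gram_power_deriv n t (Suc k) p q x l j"
      unfolding gram_power_deriv_Suc[OF Suc.prems assms(3)] using assms
      by (auto simp: sum.distrib row_power_def distrib_right if_distrib[of "\<lambda>z. z * _"] cong: if_cong)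
  qed simp
qed

text \<open>By cyclicity all 2k terms of the product rule agree after summation over l. For k = 0
  the index k - 1 is truncated, but its factor is 0.\<close>

lemma poly_deriv_gram_trace:
  assumes "p < n" "q < t"
  shows "poly_deriv ({..<n} \<times> {..<t}) (p, q) (gram_trace n t k)
    (\<lambda>x. 2 * real k * row_power n t (k - 1) x p q)"
proof -
  have "poly_deriv ({..<n} \<times> {..<t}) (p, q) (\<lambda>x. gram_trace n t k x)
    (\<lambda>x. \<Sum>l<t. gram_power_deriv n t k p q x l l)"
    unfolding gram_trace_def using assms by (intro poly_deriv_sum poly_deriv_gram_power) auto
  then show ?thesis
  proof (rule poly_deriv_cong)
    fix x
    have rg: "(\<Sum>l<t. row_power n t b x p l * gram_power n t a x l q) = row_power n t (a + b) x p q" for a b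
    proof -
      have "(\<Sum>l<t. row_power n t b x p l * gram_power n t a x l q)
          = (\<Sum>m<t. x (p, m) * (\<Sum>l<t. gram_power n t b x m l * gram_power n t a x l q))"
        unfolding row_power_def sum_distrib_left sum_distrib_right
        by (subst sum.swap) (simp add: mult_ac)
      also have "\<dots> = row_power n t (a + b) x p q"
        unfolding row_power_def using gram_power_add[of _ t n b x a q]
        by (intro sum.cong) (auto simp: add.commute)
      finally show ?thesis .
    qed
    have "(\<Sum>l<t. gram_power_deriv n t k p q x l l)
        = (\<Sum>a<k. (\<Sum>l<t. row_power n t (k - 1 - a) x p l * gram_power n t a x l q)
             + (\<Sum>l<t. row_power n t a x p l * gram_power n t (k - 1 - a) x l q))"
      unfolding gram_power_deriv_def sum.distrib[symmetric]
      by (subst sum.swap) (use gram_power_sym assms in \<open>auto intro!: sum.cong simp: mult.commute\<close>)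
    also have "\<dots> = (\<Sum>a<k. 2 * row_power n t (k - 1) x p q)"
      unfolding rg by (intro sum.cong) auto
    finally show "(\<Sum>l<t. gram_power_deriv n t k p q x l l) = 2 * real k * row_power n t (k - 1) x p q"
      by simp
  qed simp
qed

lemma poly_deriv_row_power:
  assumes "p < n" "q < t"
  shows "poly_deriv ({..<n} \<times> {..<t}) (p, q) (\<lambda>x. row_power n t k x p q)
    (\<lambda>x. gram_power n t k x q q
       + (\<Sum>a<k. row_power n t a x p q * row_power n t (k - 1 - a) x p q
            + (\<Sum>m<t. x (p, m) * row_power n t a x p m) * gram_power n t (k - 1 - a) x q q))"
proof -
  have "poly_deriv ({..<n} \<times> {..<t}) (p, q) (\<lambda>x. row_power n t k x p q)
    (\<lambda>x. \<Sum>m<t. (if (p, m) = (p, q) then 1 else 0) * gram_power n t k x m q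
       + x (p, m) * gram_power_deriv n t k p q x m q)"
    unfolding row_power_def using assms
    by (intro poly_deriv_sum poly_deriv_mult poly_deriv_var poly_deriv_gram_power) auto
  then show ?thesis
  proof (rule poly_deriv_cong)
    fix x
    have "(\<Sum>m<t. x (p, m) * gram_power_deriv n t k p q x m q)
        = (\<Sum>a<k. row_power n t a x p q * row_power n t (k - 1 - a) x p q
            + (\<Sum>m<t. x (p, m) * row_power n t a x p m) * gram_power n t (k - 1 - a) x q q)"
      unfolding gram_power_deriv_def sum_distrib_left
    proof (subst sum.swap, rule sum.cong[OF refl])
      fix a
      have "row_power n t a x p q * row_power n t (k - 1 - a) x p q
          = (\<Sum>m<t. x (p, m) * gram_power n t a x m q * row_power n t (k - 1 - a) x p q)"
        by (simp add: row_power_def[of n t a] sum_distrib_right)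
      then show "(\<Sum>m<t. x (p, m) * (gram_power n t a x m q * row_power n t (k - 1 - a) x p q
            + row_power n t a x p m * gram_power n t (k - 1 - a) x q q))
          = row_power n t a x p q * row_power n t (k - 1 - a) x p q
            + (\<Sum>m<t. x (p, m) * row_power n t a x p m) * gram_power n t (k - 1 - a) x q q"
        by (simp add: distrib_left sum.distrib sum_distrib_right mult.assoc)
    qed
    then show "(\<Sum>m<t. (if (p, m) = (p, q) then 1 else 0) * gram_power n t k x m q
       + x (p, m) * gram_power_deriv n t k p q x m q)
     = gram_power n t k x q q
       + (\<Sum>a<k. row_power n t a x p q * row_power n t (k - 1 - a) x p q
            + (\<Sum>m<t. x (p, m) * row_power n t a x p m) * gram_power n t (k - 1 - a) x q q)"
      using assms by (simp add: sum.distrib if_distrib[of "\<lambda>z. z * _"] cong: if_cong)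
  qed simp
qed

text \<open>Products of two row powers close up to a single trace, once for each a < k; the
  remaining products split into two traces. The summand k Tr G^k is of lower order: divided by t it
  becomes the k / t of \<open>moment_Suc_Cons\<close>.\<close>

lemma gram_divergence:
  "(\<Sum>p<n. \<Sum>q<t. gram_power n t k x q q
       + (\<Sum>a<k. row_power n t a x p q * row_power n t (k - 1 - a) x p q
            + (\<Sum>m<t. x (p, m) * row_power n t a x p m) * gram_power n t (k - 1 - a) x q q))
   = (real n + real k) * gram_trace n t k x
     + (\<Sum>a<k. gram_trace n t (Suc a) x * gram_trace n t (k - 1 - a) x)"
proof -
  have 1: "(\<Sum>p<n. \<Sum>q<t. row_power n t a x p q * row_power n t (k - 1 - a) x p q) = gram_trace n t k x"
    if "a < k" for a
    unfolding gram_trace_def using that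
    by (subst sum.swap) (intro sum.cong refl, simp add: row_power_prod del: gram_power.simps)
  have 2: "(\<Sum>p<n. \<Sum>q<t. (\<Sum>m<t. x (p, m) * row_power n t a x p m) * gram_power n t (k - 1 - a) x q q)
     = gram_trace n t (Suc a) x * gram_trace n t (k - 1 - a) x" for a
    by (simp only: sum_var_row_power gram_trace_def[of n t "k - 1 - a"] sum_product[symmetric])
  have "(\<Sum>p<n. \<Sum>q<t. \<Sum>a<k. row_power n t a x p q * row_power n t (k - 1 - a) x p q
            + (\<Sum>m<t. x (p, m) * row_power n t a x p m) * gram_power n t (k - 1 - a) x q q)
    = (\<Sum>a<k. (\<Sum>p<n. \<Sum>q<t. row_power n t a x p q * row_power n t (k - 1 - a) x p q)
        + (\<Sum>p<n. \<Sum>q<t. (\<Sum>m<t. x (p, m) * row_power n t a x p m) * gram_power n t (k - 1 - a) x q q))"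
    by (subst sum.swap[of _ "{..<k}"], subst sum.swap[of _ "{..<k}"]) (simp add: sum.distrib)
  also have "\<dots> = (\<Sum>a<k. gram_trace n t k x + gram_trace n t (Suc a) x * gram_trace n t (k - 1 - a) x)"
    unfolding 2 by (intro sum.cong refl arg_cong2[where f = "(+)"] 1) auto
  finally show ?thesis
    by (simp add: sum.distrib gram_trace_def[of n t k] algebra_simps)
qed

section \<open>Products of traces and their loop equations\<close>

definition trace_prod :: "nat \<Rightarrow> nat \<Rightarrow> nat list \<Rightarrow> (nat \<times> nat \<Rightarrow> real) \<Rightarrow> real" where
  "trace_prod n t ks x = (\<Prod>k\<leftarrow>ks. gram_trace n t k x)"

lemma trace_prod_simps [simp]:
  "trace_prod n t [] x = 1" "trace_prod n t (k # ks) x = gram_trace n t k x * trace_prod n t ks x"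
  by (simp_all add: trace_prod_def)

fun trace_prod_deriv where
  "trace_prod_deriv n t p q [] x = 0"
| "trace_prod_deriv n t p q (k # ks) x = 2 * real k * row_power n t (k - 1) x p q * trace_prod n t ks x
     + gram_trace n t k x * trace_prod_deriv n t p q ks x"

lemma poly_deriv_trace_prod:
  assumes "p < n" "q < t"
  shows "poly_deriv ({..<n} \<times> {..<t}) (p, q) (trace_prod n t ks) (trace_prod_deriv n t p q ks)"
proof (induction ks)
  case Nil
  show ?case by (rule poly_deriv_cong[OF poly_deriv.const[of _ _ 1]]) auto
next
  case (Cons k ks)
  show ?case
    by (rule poly_deriv_cong[OF poly_deriv_mult[OF poly_deriv_gram_trace[OF assms, of k] Cons]]) auto
qed

text \<open>Differentiating another trace Tr G^k of the list merges it with the row power of index a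
  into 2k Tr G^(a + k). Each list entry yields one such term, stored with its coefficient.\<close>

fun contractions :: "nat \<Rightarrow> nat list \<Rightarrow> (real \<times> nat list) list" where
  "contractions a [] = []"
| "contractions a (k # ks) =
     (2 * real k, (a + k) # ks) # map (\<lambda>(c, ls). (c, k # ls)) (contractions a ks)"

text \<open>For a = k the weight sum + length is two less than that of \<open>Suc k # ks\<close>,
  which is the origin of the factor 1 / t^2 in \<open>moment_Suc_Cons\<close>.\<close>

lemma contractions_sum_length:
  "(c, ls) \<in> set (contractions a ks) \<Longrightarrow> sum_list ls = a + sum_list ks \<and> length ls = length ks"
  by (induction ks arbitrary: c ls) fastforce+

lemma row_power_trace:
  "(\<Sum>p<n. \<Sum>q<t. row_power n t a x p q * row_power n t b x p q) = gram_trace n t (Suc (a + b)) x"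
  unfolding gram_trace_def
  by (subst sum.swap) (intro sum.cong refl, simp add: row_power_prod del: gram_power.simps)

lemma trace_prod_deriv_contract:
  "(\<Sum>p<n. \<Sum>q<t. row_power n t a x p q * trace_prod_deriv n t p q ks x)
     = (\<Sum>(c, ls)\<leftarrow>contractions a ks. c * trace_prod n t ls x)"
proof (induction ks)
  case (Cons k ks)
  have "row_power n t a x p q * trace_prod_deriv n t p q (k # ks) x
      = (2 * real k * trace_prod n t ks x) * (row_power n t a x p q * row_power n t (k - 1) x p q)
        + gram_trace n t k x * (row_power n t a x p q * trace_prod_deriv n t p q ks x)" for p q
    by (simp add: distrib_left mult_ac)
  then have "(\<Sum>p<n. \<Sum>q<t. row_power n t a x p q * trace_prod_deriv n t p q (k # ks) x)
     = (2 * real k * trace_prod n t ks x) * (\<Sum>p<n. \<Sum>q<t. row_power n t a x p q * row_power n t (k - 1) x p q)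
       + gram_trace n t k x * (\<Sum>p<n. \<Sum>q<t. row_power n t a x p q * trace_prod_deriv n t p q ks x)"
    by (simp only: sum.distrib sum_distrib_left[symmetric])
  also have "(2 * real k * trace_prod n t ks x) * (\<Sum>p<n. \<Sum>q<t. row_power n t a x p q * row_power n t (k - 1) x p q)
      = 2 * real k * gram_trace n t (a + k) x * trace_prod n t ks x"
    by (cases k) (simp_all add: row_power_trace)
  finally show ?case
    unfolding Cons.IH
    by (simp add: sum_list_const_mult[symmetric] o_def case_prod_unfold mult_ac)
qed simp

locale wishart = gaussian_family M "{..<n} \<times> {..<t}" X
  for M :: "'w measure" and n t :: nat and X :: "nat \<times> nat \<Rightarrow> 'w \<Rightarrow> real" +
  assumes pos: "0 < n" "0 < t"
begin

lemma trace_prod_integrable: "integrable M (\<lambda>\<omega>. trace_prod n t ks (sample \<omega>))"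
  \<comment> \<open>Integrability is a by-product of integration by parts in the variable (0, 0),
    which exists because n and t are positive.\<close>
  using integration_by_parts(1)[OF poly_deriv_trace_prod[OF pos]] pos by auto

lemma expectation_double_sum:
  assumes "\<And>p q. p < n \<Longrightarrow> q < t \<Longrightarrow> integrable M (\<lambda>\<omega>. f p q \<omega> :: real)"
  shows "expectation (\<lambda>\<omega>. \<Sum>p<n. \<Sum>q<t. f p q \<omega>) = (\<Sum>p<n. \<Sum>q<t. expectation (f p q))"
proof -
  have "expectation (\<lambda>\<omega>. \<Sum>p<n. \<Sum>q<t. f p q \<omega>) = (\<Sum>p<n. expectation (\<lambda>\<omega>. \<Sum>q<t. f p q \<omega>))"
    using assms by (intro Bochner_Integration.integral_sum Bochner_Integration.integrable_sum) auto
  also have "\<dots> = (\<Sum>p<n. \<Sum>q<t. expectation (f p q))"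
    using assms by (intro sum.cong refl Bochner_Integration.integral_sum) auto
  finally show ?thesis .
qed

text \<open>Integration by parts of x(p, q) against the row power times the remaining traces, summed
  over p and q: the derivative of the row power gives \<open>gram_divergence\<close>, that of the
  traces gives the contractions.\<close>

lemma loop_equation:
  "expectation (\<lambda>\<omega>. trace_prod n t (Suc k # ks) (sample \<omega>)) =
     (real n + real k) * expectation (\<lambda>\<omega>. trace_prod n t (k # ks) (sample \<omega>))
     + (\<Sum>a<k. expectation (\<lambda>\<omega>. trace_prod n t (Suc a # (k - 1 - a) # ks) (sample \<omega>)))
     + (\<Sum>(c, ls)\<leftarrow>contractions k ks. c * expectation (\<lambda>\<omega>. trace_prod n t ls (sample \<omega>)))"
proof -
  define D where "D = (\<lambda>p q x. gram_power n t k x q q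
       + (\<Sum>a<k. row_power n t a x p q * row_power n t (k - 1 - a) x p q
            + (\<Sum>m<t. x (p, m) * row_power n t a x p m) * gram_power n t (k - 1 - a) x q q))"
  define G where "G = (\<lambda>p q x. D p q x * trace_prod n t ks x
       + row_power n t k x p q * trace_prod_deriv n t p q ks x)"
  have pd: "poly_deriv ({..<n} \<times> {..<t}) (p, q)
      (\<lambda>x. row_power n t k x p q * trace_prod n t ks x) (G p q)" if "p < n" "q < t" for p q
    unfolding G_def D_def
    by (intro poly_deriv_mult poly_deriv_row_power poly_deriv_trace_prod that)
  note ibp = integration_by_parts[OF pd]
  have "trace_prod n t (Suc k # ks) x
      = (\<Sum>p<n. \<Sum>q<t. x (p, q) * (row_power n t k x p q * trace_prod n t ks x))" for x
    by (simp add: sum_var_row_power[symmetric] sum_distrib_right mult.assoc)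
  then have "expectation (\<lambda>\<omega>. trace_prod n t (Suc k # ks) (sample \<omega>))
      = (\<Sum>p<n. \<Sum>q<t. expectation (\<lambda>\<omega>. X (p, q) \<omega> *
          (row_power n t k (sample \<omega>) p q * trace_prod n t ks (sample \<omega>))))"
    using ibp(3) by (simp only:) (intro expectation_double_sum, auto)
  also have "\<dots> = (\<Sum>p<n. \<Sum>q<t. expectation (\<lambda>\<omega>. G p q (sample \<omega>)))"
    using ibp(4) by (intro sum.cong refl) auto
  also have "\<dots> = expectation (\<lambda>\<omega>. \<Sum>p<n. \<Sum>q<t. G p q (sample \<omega>))"
    using ibp(2) by (intro expectation_double_sum[symmetric]) auto
  also have "(\<lambda>\<omega>. \<Sum>p<n. \<Sum>q<t. G p q (sample \<omega>)) = (\<lambda>\<omega>.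
     (real n + real k) * trace_prod n t (k # ks) (sample \<omega>)
     + (\<Sum>a<k. trace_prod n t (Suc a # (k - 1 - a) # ks) (sample \<omega>))
     + (\<Sum>(c, ls)\<leftarrow>contractions k ks. c * trace_prod n t ls (sample \<omega>)))"
  proof
    fix \<omega> let ?x = "sample \<omega>"
    have "(\<Sum>p<n. \<Sum>q<t. G p q ?x) = (\<Sum>p<n. \<Sum>q<t. D p q ?x) * trace_prod n t ks ?x
       + (\<Sum>p<n. \<Sum>q<t. row_power n t k ?x p q * trace_prod_deriv n t p q ks ?x)"
      unfolding G_def by (simp add: sum.distrib sum_distrib_right)
    moreover have "(\<Sum>p<n. \<Sum>q<t. D p q ?x) = (real n + real k) * gram_trace n t k ?x
     + (\<Sum>a<k. gram_trace n t (Suc a) ?x * gram_trace n t (k - 1 - a) ?x)"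
      unfolding D_def by (rule gram_divergence)
    ultimately show "(\<Sum>p<n. \<Sum>q<t. G p q ?x) = (real n + real k) * trace_prod n t (k # ks) ?x
     + (\<Sum>a<k. trace_prod n t (Suc a # (k - 1 - a) # ks) ?x)
     + (\<Sum>(c, ls)\<leftarrow>contractions k ks. c * trace_prod n t ls ?x)"
      unfolding trace_prod_deriv_contract
      by (simp add: distrib_right sum_distrib_right mult.assoc)
  qed
  also have "expectation \<dots> = (real n + real k) * expectation (\<lambda>\<omega>. trace_prod n t (k # ks) (sample \<omega>))
     + (\<Sum>a<k. expectation (\<lambda>\<omega>. trace_prod n t (Suc a # (k - 1 - a) # ks) (sample \<omega>)))
     + (\<Sum>(c, ls)\<leftarrow>contractions k ks. c * expectation (\<lambda>\<omega>. trace_prod n t ls (sample \<omega>)))"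
  proof -
    have sl: "integrable M (\<lambda>\<omega>. \<Sum>(c, ls)\<leftarrow>cs. c * trace_prod n t ls (sample \<omega>)) \<and>
      expectation (\<lambda>\<omega>. \<Sum>(c, ls)\<leftarrow>cs. c * trace_prod n t ls (sample \<omega>))
      = (\<Sum>(c, ls)\<leftarrow>cs. c * expectation (\<lambda>\<omega>. trace_prod n t ls (sample \<omega>)))" for cs
      by (induction cs) (auto simp: trace_prod_integrable)
    note I = trace_prod_integrable
    have 1: "integrable M (\<lambda>\<omega>. (real n + real k) * trace_prod n t (k # ks) (sample \<omega>))"
      using I by (intro integrable_mult_right) blast
    have 2: "integrable M (\<lambda>\<omega>. \<Sum>a<k. trace_prod n t (Suc a # (k - 1 - a) # ks) (sample \<omega>))"
      using I by (intro Bochner_Integration.integrable_sum) blast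
    show ?thesis
      using sl[of "contractions k ks"] 1 2 I
      by (simp add: Bochner_Integration.integral_add Bochner_Integration.integral_sum
          del: trace_prod_simps)
  qed
  finally show ?thesis .
qed

text \<open>Each factor Tr G^k is divided by t^(k + 1): k powers scale G to G / t, one more
  normalizes the trace.\<close>

definition moment :: "nat list \<Rightarrow> real" where
  "moment ks = expectation (\<lambda>\<omega>. trace_prod n t ks (sample \<omega>)) / real t ^ (sum_list ks + length ks)"

lemma moment_Nil: "moment [] = 1"
  by (simp add: moment_def prob_space)

lemma moment_0_Cons: "moment (0 # ks) = moment ks"
  using pos by (simp add: moment_def gram_trace_def)

lemma moment_Suc_Cons:
  "moment (Suc k # ks) =
     (real n / real t + real k / real t) * moment (k # ks)
     + (\<Sum>a<k. moment (Suc a # (k - 1 - a) # ks))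
     + (\<Sum>(c, ls)\<leftarrow>contractions k ks. c * moment ls) / (real t)\<^sup>2"
proof -
  let ?E = "\<lambda>ks. expectation (\<lambda>\<omega>. trace_prod n t ks (sample \<omega>))"
  define d where "d = k + sum_list ks + length ks"
  have t: "real t > 0" using pos by simp
  have "moment (Suc k # ks) = ?E (Suc k # ks) / real t ^ (d + 2)"
    by (simp add: moment_def d_def ac_simps del: trace_prod_simps)
  also have "\<dots> = (real n + real k) * ?E (k # ks) / real t ^ (d + 2)
     + (\<Sum>a<k. ?E (Suc a # (k - 1 - a) # ks)) / real t ^ (d + 2)
     + (\<Sum>(c, ls)\<leftarrow>contractions k ks. c * ?E ls) / real t ^ (d + 2)"
    by (subst loop_equation) (simp only: add_divide_distrib)
  also have "(real n + real k) * ?E (k # ks) / real t ^ (d + 2)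
      = (real n / real t + real k / real t) * moment (k # ks)"
    using t by (simp add: moment_def d_def ac_simps field_simps del: trace_prod_simps)
  also have "(\<Sum>a<k. ?E (Suc a # (k - 1 - a) # ks)) / real t ^ (d + 2)
      = (\<Sum>a<k. moment (Suc a # (k - 1 - a) # ks))"
    unfolding sum_divide_distrib
  proof (rule sum.cong[OF refl])
    fix a assume "a \<in> {..<k}"
    then have "sum_list (Suc a # (k - 1 - a) # ks) + length (Suc a # (k - 1 - a) # ks) = d + 2"
      by (simp add: d_def)
    then show "?E (Suc a # (k - 1 - a) # ks) / real t ^ (d + 2) = moment (Suc a # (k - 1 - a) # ks)"
      unfolding moment_def by simp
  qed
  also have "(\<Sum>(c, ls)\<leftarrow>contractions k ks. c * ?E ls) / real t ^ (d + 2)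
     = (\<Sum>(c, ls)\<leftarrow>contractions k ks. c * moment ls) / (real t)\<^sup>2"
  proof -
    have "(\<Sum>(c, ls)\<leftarrow>contractions k ks. c * ?E ls) = (\<Sum>(c, ls)\<leftarrow>contractions k ks. c * moment ls * real t ^ d)"
    proof (intro arg_cong[where f = sum_list] map_cong refl, clarify)
      fix c ls assume "(c, ls) \<in> set (contractions k ks)"
      from contractions_sum_length[OF this] have "sum_list ls + length ls = d" by (simp add: d_def)
      then show "c * ?E ls = c * moment ls * real t ^ d"
        using t by (simp add: moment_def)
    qed
    also have "\<dots> = (\<Sum>(c, ls)\<leftarrow>contractions k ks. c * moment ls) * real t ^ d"
      by (simp add: sum_list_mult_const[symmetric] case_prod_unfold)
    finally show ?thesis using t by (simp add: power_add power2_eq_square)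
  qed
  finally show ?thesis .
qed

end

text \<open>What remains of the loop equation for a single trace in the limit. The moments belong to
  (1/T) W^T W and the T x T trace, so the first one is c.\<close>

fun mp_moment :: "real \<Rightarrow> nat \<Rightarrow> real" where
  "mp_moment c 0 = 1"
| "mp_moment c (Suc k) = c * mp_moment c k + (\<Sum>a<k. mp_moment c (Suc a) * mp_moment c (k - 1 - a))"

declare mp_moment.simps(2) [simp del]

lemma tendsto_sum_list:
  assumes "\<And>z. z \<in> set zs \<Longrightarrow> ((\<lambda>x. f z x) \<longlongrightarrow> g z) F"
  shows "((\<lambda>x. \<Sum>z\<leftarrow>zs. f z x) \<longlongrightarrow> (\<Sum>z\<leftarrow>zs. g z :: real)) F"
  using assms by (induction zs) (auto intro: tendsto_add)

text \<open>Induction on the total degree, for all lists at once: the loop equation for one trace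
  involves products of two, and every term on its right has smaller degree. The contractions, which
  alone tie the first trace to the others, carry 1 / T^2, so the limit factorizes. The inner
  induction on the list removes leading zeros, which do not lower the degree.\<close>

lemma wishart_moment_limit:
  fixes c :: real and T :: "nat \<Rightarrow> nat"
  assumes T: "filterlim T at_top sequentially" and c: "(\<lambda>N. real N / real (T N)) \<longlonglongrightarrow> c"
    and w: "\<And>N. 0 < N \<Longrightarrow> 0 < T N \<Longrightarrow> wishart M N (T N) (X N)"
  shows "(\<lambda>N. wishart.moment M N (T N) (X N) ks) \<longlonglongrightarrow> (\<Prod>k\<leftarrow>ks. mp_moment c k)"
proof -
  define e where "e = (\<lambda>ks N. wishart.moment M N (T N) (X N) ks)"
  have ev: "\<forall>\<^sub>F N in sequentially. wishart M N (T N) (X N)"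
    using eventually_gt_at_top[of 0] filterlim_at_top[THEN iffD1, OF T, rule_format, of 1]
    by eventually_elim (auto intro: w)
  have Tr: "filterlim (\<lambda>N. real (T N)) at_top sequentially"
    using T filterlim_compose filterlim_real_sequentially by blast
  have T0: "(\<lambda>N. a / real (T N)) \<longlonglongrightarrow> 0" for a
    by (rule real_tendsto_divide_at_top[OF tendsto_const Tr])
  have T2: "filterlim (\<lambda>N. (real (T N))\<^sup>2) at_top sequentially"
    using filterlim_pow_at_top[OF _ Tr, of 2] by simp
  have "\<forall>ks. sum_list ks = s \<longrightarrow> e ks \<longlonglongrightarrow> (\<Prod>k\<leftarrow>ks. mp_moment c k)" for s
  proof (induction s rule: less_induct)
    case (less s)
    have IH: "e ls \<longlonglongrightarrow> (\<Prod>k\<leftarrow>ls. mp_moment c k)" if "sum_list ls < s" for ls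
      using less that by blast
    have "e ks \<longlonglongrightarrow> (\<Prod>k\<leftarrow>ks. mp_moment c k)" if "sum_list ks = s" for ks
      using that
    proof (induction ks)
      case Nil
      have "\<forall>\<^sub>F N in sequentially. e [] N = 1"
        using ev by eventually_elim (simp add: e_def wishart.moment_Nil)
      then show ?case by (simp add: tendsto_eventually)
    next
      case (Cons k0 ks)
      show ?case
      proof (cases k0)
        case 0
        have "e ks \<longlonglongrightarrow> (\<Prod>k\<leftarrow>k0 # ks. mp_moment c k)" using Cons 0 by simp
        moreover have "\<forall>\<^sub>F N in sequentially. e ks N = e (k0 # ks) N"
          using ev by eventually_elim (simp add: e_def wishart.moment_0_Cons 0)
        ultimately show ?thesis by (rule Lim_transform_eventually)
      next
        case (Suc k)
        have deg: "sum_list (k # ks) < s" "\<And>a. a < k \<Longrightarrow> sum_list (Suc a # (k - 1 - a) # ks) < s"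
          "\<And>d ls. (d, ls) \<in> set (contractions k ks) \<Longrightarrow> sum_list ls < s"
          using Cons.prems Suc contractions_sum_length by fastforce+
        have "(\<lambda>N. (real N / real (T N) + real k / real (T N)) * e (k # ks) N
          + (\<Sum>a<k. e (Suc a # (k - 1 - a) # ks) N)
          + (\<Sum>(d, ls)\<leftarrow>contractions k ks. d * e ls N) / (real (T N))\<^sup>2)
          \<longlonglongrightarrow> (c + 0) * (\<Prod>k\<leftarrow>k # ks. mp_moment c k)
             + (\<Sum>a<k. \<Prod>k\<leftarrow>Suc a # (k - 1 - a) # ks. mp_moment c k) + 0"
        proof (intro tendsto_add tendsto_mult tendsto_sum c T0)
          have "(\<lambda>N. \<Sum>(d, ls)\<leftarrow>contractions k ks. d * e ls N)
              \<longlonglongrightarrow> (\<Sum>z\<leftarrow>contractions k ks. fst z * (\<Prod>k\<leftarrow>snd z. mp_moment c k))"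
            unfolding case_prod_unfold
            using deg(3) by (intro tendsto_sum_list tendsto_mult tendsto_const IH) auto
          then show "(\<lambda>N. (\<Sum>(d, ls)\<leftarrow>contractions k ks. d * e ls N) / (real (T N))\<^sup>2) \<longlonglongrightarrow> 0"
            by (rule real_tendsto_divide_at_top[OF _ T2])
        qed (use deg in \<open>auto intro!: IH simp del: list.map\<close>)
        moreover have "\<forall>\<^sub>F N in sequentially.
          (real N / real (T N) + real k / real (T N)) * e (k # ks) N
          + (\<Sum>a<k. e (Suc a # (k - 1 - a) # ks) N)
          + (\<Sum>(d, ls)\<leftarrow>contractions k ks. d * e ls N) / (real (T N))\<^sup>2 = e (k0 # ks) N"
          using ev unfolding Suc e_def
          by eventually_elim (rule wishart.moment_Suc_Cons[symmetric])
        moreover have "(c + 0) * (\<Prod>k\<leftarrow>k # ks. mp_moment c k)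
             + (\<Sum>a<k. \<Prod>k\<leftarrow>Suc a # (k - 1 - a) # ks. mp_moment c k) + 0
             = (\<Prod>k\<leftarrow>k0 # ks. mp_moment c k)"
          unfolding Suc list.map prod_list.Cons
          by (subst mp_moment.simps(2)) (simp add: distrib_right sum_distrib_right mult.assoc)
        ultimately show ?thesis using Lim_transform_eventually by simp
      qed
    qed
    then show ?case by (intro allI impI)
  qed
  then show ?thesis by (auto simp: e_def)
qed

text \<open>The limits for [k] and [k, k] are m and m^2, so the mean of (Z - m)^2 tends to 0. An
  L1-null sequence has an almost surely null subsequence, which forces L = m.\<close>

theorem wishart_trace_limit:
  fixes c L :: real and T :: "nat \<Rightarrow> nat"
  assumes T: "filterlim T at_top sequentially" and c: "(\<lambda>N. real N / real (T N)) \<longlonglongrightarrow> c"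
    and w: "\<And>N. 0 < N \<Longrightarrow> 0 < T N \<Longrightarrow> wishart M N (T N) (X N)"
    and M: "prob_space M"
    and lim: "AE \<omega> in M. (\<lambda>N. gram_trace N (T N) k (\<lambda>i. X N i \<omega>) / real (T N) ^ Suc k) \<longlonglongrightarrow> L"
  shows "L = mp_moment c k"
proof -
  interpret prob_space M by fact
  define m where "m = mp_moment c k"
  define Z where "Z = (\<lambda>N \<omega>. gram_trace N (T N) k (\<lambda>i. X N i \<omega>) / real (T N) ^ Suc k)"
  have ev: "\<forall>\<^sub>F N in sequentially. wishart M N (T N) (X N)"
    using eventually_gt_at_top[of 0] filterlim_at_top[THEN iffD1, OF T, rule_format, of 1]
    by eventually_elim (auto intro: w)
  then obtain N0 where N0: "\<And>N. N \<ge> N0 \<Longrightarrow> wishart M N (T N) (X N)"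
    unfolding eventually_sequentially by blast
  let ?mom = "\<lambda>N ks. wishart.moment M N (T N) (X N) ks"
  have Z2: "integrable M (\<lambda>\<omega>. (Z N \<omega> - m)\<^sup>2) \<and>
      expectation (\<lambda>\<omega>. (Z N \<omega> - m)\<^sup>2) = ?mom N [k, k] - 2 * m * ?mom N [k] + m\<^sup>2"
    if "N \<ge> N0" for N
  proof -
    interpret wishart M N "T N" "X N" by (rule N0[OF that])
    let ?t = "real (T N)"
    have i1: "integrable M (\<lambda>\<omega>. trace_prod N (T N) [k] (sample \<omega>))"
      and i2: "integrable M (\<lambda>\<omega>. trace_prod N (T N) [k, k] (sample \<omega>))"
      by (rule trace_prod_integrable)+
    have eq: "(Z N \<omega> - m)\<^sup>2 = trace_prod N (T N) [k, k] (sample \<omega>) / ?t ^ (k + k + 2)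
        - 2 * m * (trace_prod N (T N) [k] (sample \<omega>) / ?t ^ (k + 1)) + m\<^sup>2" for \<omega>
    proof -
      have "?t ^ (k + k + 2) = ?t ^ Suc k * ?t ^ Suc k"
        by (simp add: power_add power2_eq_square)
      then show ?thesis by (simp add: Z_def power2_eq_square algebra_simps power_add)
    qed
    show ?thesis
      unfolding eq using i1 i2
      by (simp add: moment_def prob_space numeral_2_eq_2 add.assoc del: trace_prod_simps)
  qed
  \<comment> \<open>Shifted by N0, since integrability is needed for every index.\<close>
  define u where "u = (\<lambda>N \<omega>. (Z (N + N0) \<omega> - m)\<^sup>2)"
  have "(\<lambda>N. ?mom N [k, k] - 2 * m * ?mom N [k] + m\<^sup>2) \<longlonglongrightarrow> m * m - 2 * m * m + m\<^sup>2"
    using wishart_moment_limit[OF T c w, of "[k, k]"] wishart_moment_limit[OF T c w, of "[k]"]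
    by (intro tendsto_intros) (simp_all add: m_def)
  then have "(\<lambda>N. ?mom (N + N0) [k, k] - 2 * m * ?mom (N + N0) [k] + m\<^sup>2) \<longlonglongrightarrow> 0"
    using LIMSEQ_ignore_initial_segment by (fastforce simp: power2_eq_square)
  then have "(\<lambda>N. \<integral>\<omega>. norm (u N \<omega>) \<partial>M) \<longlonglongrightarrow> 0"
    using Z2 by (simp add: u_def)
  moreover have "integrable M (u N)" for N using Z2[of "N + N0"] by (simp add: u_def)
  ultimately obtain r where r: "strict_mono r" "AE \<omega> in M. (\<lambda>N. u (r N) \<omega>) \<longlonglongrightarrow> 0"
    using tendsto_L1_AE_subseq[of M u] by blast
  have "AE \<omega> in M. L = m"
    using r(2) lim
  proof eventually_elim
    case (elim \<omega>)
    have "(\<lambda>N. Z (N + N0) \<omega>) \<longlonglongrightarrow> L"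
      unfolding Z_def using elim(2) by (rule LIMSEQ_ignore_initial_segment)
    then have "(\<lambda>N. u N \<omega>) \<longlonglongrightarrow> (L - m)\<^sup>2"
      unfolding u_def by (intro tendsto_intros)
    then have "(\<lambda>N. u (r N) \<omega>) \<longlonglongrightarrow> (L - m)\<^sup>2"
      using LIMSEQ_subseq_LIMSEQ[OF _ r(1)] by (fastforce simp: o_def)
    then have "(L - m)\<^sup>2 = 0" using elim(1) LIMSEQ_unique by blast
    then show ?case by simp
  qed
  then show ?thesis by (simp add: m_def)
qed

section \<open>Row sums and traces\<close>

text \<open>A bound in the operator norm that belongs to the maximum norm on vectors:
  submultiplicative, dominating the normalized trace, and for the covariance matrix uniform in the
  size.\<close>

definition row_sums_le :: "complex mat \<Rightarrow> real \<Rightarrow> bool" where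
  "row_sums_le A K \<longleftrightarrow> (\<forall>i<dim_row A. (\<Sum>j<dim_col A. cmod (A $$ (i, j))) \<le> K)"

lemma index_mult_mat_sum:
  assumes "A \<in> carrier_mat n k" "B \<in> carrier_mat k m" "i < n" "j < m"
  shows "(A * B) $$ (i, j) = (\<Sum>l<k. A $$ (i, l) * B $$ (l, j))"
  using assms by (auto simp: scalar_prod_def atLeast0LessThan)

lemma row_sums_le_mult:
  assumes A: "A \<in> carrier_mat n n" and B: "B \<in> carrier_mat n n"
    and a: "row_sums_le A K" and b: "row_sums_le B L" and "0 \<le> L"
  shows "row_sums_le (A * B) (K * L)"
  unfolding row_sums_le_def
proof (intro allI impI)
  fix i assume "i < dim_row (A * B)"
  then have i: "i < n" using A by simp
  have "(\<Sum>j<dim_col (A * B). cmod ((A * B) $$ (i, j)))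
      \<le> (\<Sum>j<n. \<Sum>l<n. cmod (A $$ (i, l)) * cmod (B $$ (l, j)))"
    using B i by (auto intro!: sum_mono norm_sum[THEN order_trans]
        simp: index_mult_mat_sum[OF A B] norm_mult simp del: index_mult_mat(1))
  also have "\<dots> = (\<Sum>l<n. cmod (A $$ (i, l)) * (\<Sum>j<n. cmod (B $$ (l, j))))"
    unfolding sum_distrib_left by (rule sum.swap)
  also have "\<dots> \<le> (\<Sum>l<n. cmod (A $$ (i, l)) * L)"
    using b B by (intro sum_mono mult_left_mono) (auto simp: row_sums_le_def)
  also have "\<dots> \<le> K * L"
    using a A i \<open>0 \<le> L\<close> by (auto simp: row_sums_le_def sum_distrib_right[symmetric] intro!: mult_right_mono)
  finally show "(\<Sum>j<dim_col (A * B). cmod ((A * B) $$ (i, j))) \<le> K * L" .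
qed

lemma row_sums_le_pow:
  assumes A: "A \<in> carrier_mat n n" and a: "row_sums_le A K" and "0 \<le> K"
  shows "row_sums_le (A ^\<^sub>m k) (K ^ k)"
proof (induction k)
  case 0
  have "(\<Sum>j<n. cmod (1\<^sub>m n $$ (i, j))) \<le> 1" if "i < n" for i
  proof -
    have "(\<Sum>j<n. cmod (1\<^sub>m n $$ (i, j))) = (\<Sum>j<n. if i = j then 1 else 0)"
      using that by (intro sum.cong) auto
    then show ?thesis using that by simp
  qed
  then show ?case using A by (simp add: row_sums_le_def)
next
  case (Suc k)
  then show ?case
    using row_sums_le_mult[OF pow_carrier_mat[OF A] A Suc a \<open>0 \<le> K\<close>] by (simp add: mult.commute)
qed

lemma norm_trace_le:
  assumes A: "A \<in> carrier_mat n n" and a: "row_sums_le A K" and "0 \<le> K"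
  shows "cmod (norm_trace A) \<le> K"
proof -
  have "cmod (A $$ (i, i)) \<le> K" if "i < n" for i
  proof -
    have "cmod (A $$ (i, i)) \<le> (\<Sum>j<n. cmod (A $$ (i, j)))"
      using that by (intro member_le_sum) auto
    then show ?thesis using a A that by (fastforce simp: row_sums_le_def)
  qed
  then have "cmod (\<Sum>i<n. A $$ (i, i)) \<le> (\<Sum>i<n. K)"
    by (intro sum_norm_le) auto
  then show ?thesis
    using A \<open>0 \<le> K\<close> by (auto simp: norm_trace_def norm_divide divide_le_eq mult.commute)
qed

lemma norm_trace_linear:
  assumes "A \<in> carrier_mat n n" "B \<in> carrier_mat n n" "C \<in> carrier_mat n n"
  shows "norm_trace (a \<cdot>\<^sub>m A + b \<cdot>\<^sub>m B + C) = a * norm_trace A + b * norm_trace B + norm_trace C"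
  using assms by (auto simp: norm_trace_def sum.distrib add_divide_distrib sum_distrib_left)

section \<open>The exponential covariance matrix\<close>

lemma exp_covariance_carrier [simp]: "exp_covariance r n \<in> carrier_mat n n"
  by (simp add: exp_covariance_def)

lemma exp_covariance_dim [simp]:
  "dim_row (exp_covariance r n) = n" "dim_col (exp_covariance r n) = n"
  by (simp_all add: exp_covariance_def)

lemma exp_covariance_index:
  "a < n \<Longrightarrow> b < n \<Longrightarrow> exp_covariance r n $$ (a, b) = of_real (r ^ nat \<bar>int a - int b\<bar>)"
  by (simp add: exp_covariance_def)

lemma sum_lessThan_add:
  fixes f :: "nat \<Rightarrow> 'a::comm_monoid_add"
  shows "(\<Sum>i<m + k. f i) = (\<Sum>i<m. f i) + (\<Sum>j<k. f (m + j))"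
  by (induction k) (auto simp: ac_simps)

lemma geometric_le:
  fixes r :: real
  assumes "0 < r" "r < 1"
  shows "(\<Sum>i<n. r ^ i) \<le> 1 / (1 - r)"
  using assms by (simp add: sum_gp_strict divide_right_mono)

lemma exp_covariance_row_sums:
  assumes r: "0 < r" "r < 1"
  shows "row_sums_le (exp_covariance r n) (2 / (1 - r))"
  unfolding row_sums_le_def
proof (intro allI impI)
  fix a assume "a < dim_row (exp_covariance r n)"
  then obtain k where n: "n = a + k" and a: "a < n" by (auto simp: less_iff_Suc_add)
  have "(\<Sum>b<dim_col (exp_covariance r n). cmod (exp_covariance r n $$ (a, b)))
      = (\<Sum>b<a + k. r ^ nat \<bar>int a - int b\<bar>)"
    using r a n by (intro sum.cong) (auto simp: exp_covariance_index norm_power)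
  also have "\<dots> = (\<Sum>b<a. r ^ (a - b)) + (\<Sum>j<k. r ^ j)"
    unfolding sum_lessThan_add
    by (intro arg_cong2[where f = "(+)"] sum.cong refl arg_cong2[where f = "(^)"]) auto
  also have "(\<Sum>b<a. r ^ (a - b)) \<le> (\<Sum>b<a. r ^ (a - Suc b))"
    using r by (intro sum_mono power_decreasing) auto
  also have "(\<Sum>b<a. r ^ (a - Suc b)) = (\<Sum>b<a. r ^ b)"
    by (rule sum.nat_diff_reindex)
  finally show "(\<Sum>b<dim_col (exp_covariance r n). cmod (exp_covariance r n $$ (a, b))) \<le> 2 / (1 - r)"
    using geometric_le[OF r, of a] geometric_le[OF r, of k] by simp
qed

text \<open>
  The terms without \<open>n\<close> are the convolution of the two sequences over all integers, the last two
  terms correct for the truncation to \<open>{0..<n}\<close>.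
\<close>
lemma exp_sum_product_le:
  fixes r \<rho> :: real
  assumes r: "0 < r" "r < 1" and \<rho>: "0 < \<rho>" "\<rho> < 1" and neq: "r \<noteq> \<rho>"
    and ab: "a \<le> b" "b < n"
  shows "(\<Sum>c<n. r ^ nat \<bar>int a - int c\<bar> * \<rho> ^ nat \<bar>int c - int b\<bar>)
    = ((1 / r - r) * \<rho> ^ (b - a) - (1 / \<rho> - \<rho>) * r ^ (b - a)) / ((r + 1 / r) - (\<rho> + 1 / \<rho>))
      - (r ^ (a + 1) * \<rho> ^ (b + 1) + r ^ (n - a) * \<rho> ^ (n - b)) / (1 - r * \<rho>)"
proof -
  define d e where "d = b - a" and "e = n - Suc b"
  have n: "n = a + Suc d + e" and b: "b = a + d" using ab by (auto simp: d_def e_def)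
  define q where "q = r * \<rho>"
  have q1: "q < 1" "0 < q" using r \<rho> mult_strict_mono[of r 1 \<rho> 1] by (auto simp: q_def)
  \<comment> \<open>The index c runs below a, from a to b, and above b. The outer parts are
    geometric sums in q = r \<rho>, the middle one is a difference of powers divided by r -
    \<rho>.\<close>
  have "(\<Sum>c<n. r ^ nat \<bar>int a - int c\<bar> * \<rho> ^ nat \<bar>int c - int b\<bar>)
     = (\<Sum>c<a. r ^ (a - c) * \<rho> ^ (a - c + d)) + (\<Sum>j<Suc d. r ^ j * \<rho> ^ (d - j))
        + (\<Sum>j<e. r ^ (Suc d + j) * \<rho> ^ (Suc j))"
    unfolding n sum_lessThan_add
    by (intro arg_cong2[where f = "(+)"] sum.cong refl arg_cong2[where f = "(*)"]
        arg_cong2[where f = "(^)"]) (auto simp: b nat_eq_iff of_nat_diff)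
  also have "(\<Sum>c<a. r ^ (a - c) * \<rho> ^ (a - c + d)) = \<rho> ^ d * (q * (1 - q ^ a) / (1 - q))"
  proof -
    have "(\<Sum>c<a. r ^ (a - c) * \<rho> ^ (a - c + d)) = (\<Sum>c<a. \<rho> ^ d * q * q ^ (a - Suc c))"
    proof (rule sum.cong[OF refl])
      fix c assume "c \<in> {..<a}"
      then obtain k where "a - c = Suc k" "a - Suc c = k" by (metis Suc_diff_Suc lessThan_iff)
      then show "r ^ (a - c) * \<rho> ^ (a - c + d) = \<rho> ^ d * q * q ^ (a - Suc c)"
        by (simp add: q_def power_mult_distrib power_add)
    qed
    also have "\<dots> = \<rho> ^ d * q * (\<Sum>c<a. q ^ c)"
      unfolding sum_distrib_left[symmetric] sum.nat_diff_reindex[of "\<lambda>i. q ^ i"] ..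
    finally show ?thesis using q1 by (simp add: sum_gp_strict)
  qed
  also have "(\<Sum>j<Suc d. r ^ j * \<rho> ^ (d - j)) = (r ^ Suc d - \<rho> ^ Suc d) / (r - \<rho>)"
  proof -
    have "r ^ Suc d - \<rho> ^ Suc d = (r - \<rho>) * (\<Sum>j<Suc d. r ^ j * \<rho> ^ (d - j))"
      by (subst power_diff_sumr2) (simp add: mult.commute)
    then show ?thesis using neq by simp
  qed
  also have "(\<Sum>j<e. r ^ (Suc d + j) * \<rho> ^ (Suc j)) = r ^ d * (q * (1 - q ^ e) / (1 - q))"
  proof -
    have "(\<Sum>j<e. r ^ (Suc d + j) * \<rho> ^ (Suc j)) = r ^ d * q * (\<Sum>j<e. q ^ j)"
      unfolding sum_distrib_left by (intro sum.cong) (auto simp: q_def power_mult_distrib power_add)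
    then show ?thesis using q1 by (simp add: sum_gp_strict)
  qed
  also have "\<rho> ^ d * (q * (1 - q ^ a) / (1 - q)) + (r ^ Suc d - \<rho> ^ Suc d) / (r - \<rho>)
        + r ^ d * (q * (1 - q ^ e) / (1 - q))
     = ((1 / r - r) * \<rho> ^ d - (1 / \<rho> - \<rho>) * r ^ d) / ((r + 1 / r) - (\<rho> + 1 / \<rho>))
        - (\<rho> ^ d * q * q ^ a + r ^ d * q * q ^ e) / (1 - q)"
  proof -
    \<comment> \<open>Partial fractions with the denominators 1 - q and r - \<rho>.\<close>
    have R: "(r + 1 / r) - (\<rho> + 1 / \<rho>) = (r - \<rho>) * (q - 1) / q"
      using r \<rho> by (simp add: q_def field_simps)
    have 1: "(1 / r - r) / ((r - \<rho>) * (q - 1) / q) = q / (1 - q) - \<rho> / (r - \<rho>)"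
    proof -
      have "(1 / r - r) * q = \<rho> * (1 - r * r)" using r by (simp add: q_def field_simps)
      then have "(1 / r - r) / ((r - \<rho>) * (q - 1) / q) = \<rho> * (1 - r * r) / ((r - \<rho>) * (q - 1))"
        by simp
      also have "\<dots> = q / (1 - q) - \<rho> / (r - \<rho>)"
        using q1 neq by (simp add: divide_simps q_def) (simp add: algebra_simps)
      finally show ?thesis .
    qed
    have 2: "(1 / \<rho> - \<rho>) / ((r - \<rho>) * (q - 1) / q) = - (q / (1 - q) + r / (r - \<rho>))"
    proof -
      have "(1 / \<rho> - \<rho>) * q = r * (1 - \<rho> * \<rho>)" using \<rho> by (simp add: q_def field_simps)
      then have "(1 / \<rho> - \<rho>) / ((r - \<rho>) * (q - 1) / q) = r * (1 - \<rho> * \<rho>) / ((r - \<rho>) * (q - 1))"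
        by simp
      also have "\<dots> = - (q / (1 - q) + r / (r - \<rho>))"
        using q1 neq by (simp add: divide_simps q_def) (simp add: algebra_simps)
      finally show ?thesis .
    qed
    have split: "(u * x - v * y) / D = x * (u / D) - y * (v / D)" for u v x y D :: real
      by (simp add: diff_divide_distrib mult.commute)
    have "((1 / r - r) * \<rho> ^ d - (1 / \<rho> - \<rho>) * r ^ d) / ((r + 1 / r) - (\<rho> + 1 / \<rho>))
      = \<rho> ^ d * ((1 / r - r) / ((r - \<rho>) * (q - 1) / q)) - r ^ d * ((1 / \<rho> - \<rho>) / ((r - \<rho>) * (q - 1) / q))"
      unfolding R by (rule split)
    also have "\<dots> = \<rho> ^ d * (q / (1 - q) - \<rho> / (r - \<rho>)) + r ^ d * (q / (1 - q) + r / (r - \<rho>))"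
      unfolding 1 2 by (simp only: mult_minus_right diff_minus_eq_add)
    finally show ?thesis
      by (simp add: diff_divide_distrib add_divide_distrib algebra_simps)
  qed
  also have "\<rho> ^ d * q * q ^ a = r ^ (a + 1) * \<rho> ^ (b + 1)"
    by (simp add: q_def b power_mult_distrib power_add)
  also have "r ^ d * q * q ^ e = r ^ (n - a) * \<rho> ^ (n - b)"
    by (simp add: q_def n b power_mult_distrib power_add)
  finally show ?thesis by (simp add: d_def q_def)
qed

lemma exp_sum_product:
  fixes r \<rho> :: real
  assumes r: "0 < r" "r < 1" and \<rho>: "0 < \<rho>" "\<rho> < 1" and neq: "r \<noteq> \<rho>"
    and ab: "a < n" "b < n"
  shows "(\<Sum>c<n. r ^ nat \<bar>int a - int c\<bar> * \<rho> ^ nat \<bar>int c - int b\<bar>)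
    = ((1 / r - r) * \<rho> ^ nat \<bar>int a - int b\<bar> - (1 / \<rho> - \<rho>) * r ^ nat \<bar>int a - int b\<bar>)
        / ((r + 1 / r) - (\<rho> + 1 / \<rho>))
      - (r ^ (a + 1) * \<rho> ^ (b + 1) + r ^ (n - a) * \<rho> ^ (n - b)) / (1 - r * \<rho>)"
proof (cases "a \<le> b")
  case True
  then have "nat \<bar>int a - int b\<bar> = b - a" by simp
  show ?thesis unfolding \<open>nat \<bar>int a - int b\<bar> = b - a\<close>
    by (rule exp_sum_product_le[OF r \<rho> neq True ab(2)])
next
  case False
  then have ba: "b \<le> a" "nat \<bar>int a - int b\<bar> = a - b" by auto
  have "(\<Sum>c<n. r ^ nat \<bar>int a - int c\<bar> * \<rho> ^ nat \<bar>int c - int b\<bar>)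
      = (\<Sum>c<n. \<rho> ^ nat \<bar>int b - int c\<bar> * r ^ nat \<bar>int c - int a\<bar>)"
    by (intro sum.cong) (auto simp: abs_minus_commute mult.commute)
  also have "\<dots> = ((1 / \<rho> - \<rho>) * r ^ (a - b) - (1 / r - r) * \<rho> ^ (a - b)) / ((\<rho> + 1 / \<rho>) - (r + 1 / r))
      - (\<rho> ^ (b + 1) * r ^ (a + 1) + \<rho> ^ (n - b) * r ^ (n - a)) / (1 - \<rho> * r)"
    by (rule exp_sum_product_le[OF \<rho> r neq[symmetric] ba(1) ab(1)])
  also have "((1 / \<rho> - \<rho>) * r ^ (a - b) - (1 / r - r) * \<rho> ^ (a - b)) / ((\<rho> + 1 / \<rho>) - (r + 1 / r))
     = ((1 / r - r) * \<rho> ^ (a - b) - (1 / \<rho> - \<rho>) * r ^ (a - b)) / ((r + 1 / r) - (\<rho> + 1 / \<rho>))"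
    by (metis minus_diff_eq minus_divide_divide)
  finally show ?thesis unfolding ba(2) by (simp add: mult.commute)
qed

text \<open>
  With \<open>w\<close> and \<open>s\<close> as below, \<open>s \<Sigma>\<^sub>\<rho>\<close> is the resolvent \<open>\<Sigma>\<^sub>r (1 - w \<Sigma>\<^sub>r)\<^sup>-\<^sup>1\<close> up to a matrix of rank two
  whose entries decay away from the corners.
\<close>
lemma exp_covariance_resolvent:
  fixes r \<rho> :: real and n :: nat
  assumes r: "0 < r" "r < \<rho>" and \<rho>: "\<rho> < 1"
  defines "w \<equiv> ((r + 1 / r) - (\<rho> + 1 / \<rho>)) / (1 / r - r)" and "s \<equiv> (1 / r - r) / (1 / \<rho> - \<rho>)"
  defines "E \<equiv> Matrix.mat n n (\<lambda>(a, b). complex_of_real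
     (- (s * w / (1 - r * \<rho>)) * (r ^ (a + 1) * \<rho> ^ (b + 1) + r ^ (n - a) * \<rho> ^ (n - b))))"
  shows "exp_covariance r n = of_real s \<cdot>\<^sub>m exp_covariance \<rho> n
     + of_real (- s * w) \<cdot>\<^sub>m (exp_covariance r n * exp_covariance \<rho> n) + E"
proof (rule eq_matI)
  have pos: "1 / r - r > 0" "1 / \<rho> - \<rho> > 0"
  proof -
    have "x < 1 / x" if "0 < x" "x < 1" for x :: real
      using that mult_strict_mono[of x 1 x 1] by (simp add: field_simps)
    from this[of r] this[of \<rho>] show "1 / r - r > 0" "1 / \<rho> - \<rho> > 0" using r \<rho> by auto
  qed
  have D: "(r + 1 / r) - (\<rho> + 1 / \<rho>) \<noteq> 0"
  proof -
    have "(r + 1 / r) - (\<rho> + 1 / \<rho>) = (r - \<rho>) * (r * \<rho> - 1) / (r * \<rho>)"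
      using r \<rho> by (simp add: field_simps)
    moreover have "r * \<rho> < 1" using r \<rho> mult_strict_mono[of r 1 \<rho> 1] by auto
    ultimately show ?thesis using r \<rho> by auto
  qed
  fix a b assume "a < dim_row (of_real s \<cdot>\<^sub>m exp_covariance \<rho> n
     + of_real (- s * w) \<cdot>\<^sub>m (exp_covariance r n * exp_covariance \<rho> n) + E)"
    "b < dim_col (of_real s \<cdot>\<^sub>m exp_covariance \<rho> n
     + of_real (- s * w) \<cdot>\<^sub>m (exp_covariance r n * exp_covariance \<rho> n) + E)"
  then have ab: "a < n" "b < n" by (auto simp: E_def)
  define x y g where "x = r ^ nat \<bar>int a - int b\<bar>" and "y = \<rho> ^ nat \<bar>int a - int b\<bar>"
    and "g = (r ^ (a + 1) * \<rho> ^ (b + 1) + r ^ (n - a) * \<rho> ^ (n - b)) / (1 - r * \<rho>)"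
  define k1 k2 d where "k1 = 1 / r - r" and "k2 = 1 / \<rho> - \<rho>" and "d = (r + 1 / r) - (\<rho> + 1 / \<rho>)"
  have "(exp_covariance r n * exp_covariance \<rho> n) $$ (a, b)
      = of_real (\<Sum>c<n. r ^ nat \<bar>int a - int c\<bar> * \<rho> ^ nat \<bar>int c - int b\<bar>)"
    using ab by (simp add: index_mult_mat_sum[of _ n n _ n] exp_covariance_index del: index_mult_mat(1))
  also have "\<dots> = of_real ((k1 * y - k2 * x) / d - g)"
    using exp_sum_product[of r \<rho> a n b] r \<rho> ab by (simp add: x_def y_def g_def k1_def k2_def d_def)
  finally have P: "(exp_covariance r n * exp_covariance \<rho> n) $$ (a, b) = of_real ((k1 * y - k2 * x) / d - g)" .
  \<comment> \<open>The constants come from the symbol of the infinite Toeplitz matrix, f = k1 / ((r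
    + 1/r) - 2 cos \<theta>). The denominator of f / (1 - w f) is (r + 1/r) - w k1 - 2 cos \<theta>;
    w is chosen to make it the one for \<rho>, and s = k1 / k2 adjusts the numerator.\<close>
  have "x = s * y + (- s * w) * ((k1 * y - k2 * x) / d - g) + (- (s * w) * g)"
  proof -
    have "s * w = d / k2" using pos by (simp add: s_def w_def k1_def k2_def d_def)
    moreover have "s * k2 = k1" using pos by (simp add: s_def k1_def k2_def)
    ultimately have "s * w * ((k1 * y - k2 * x) / d) = (s * k2 * y - k2 * x) / k2"
      using D by (simp add: d_def)
    also have "\<dots> = s * y - x"
      using pos by (simp add: k2_def[symmetric] diff_divide_distrib)
    finally have sw: "s * w * ((k1 * y - k2 * x) / d) = s * y - x" .
    define Q where "Q = (k1 * y - k2 * x) / d"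
    have "s * w * Q = s * y - x" unfolding Q_def by (rule sw)
    then show ?thesis unfolding Q_def[symmetric] by (simp add: algebra_simps)
  qed
  then have x: "of_real x = complex_of_real s * of_real y
      + of_real (- s * w) * of_real ((k1 * y - k2 * x) / d - g) + of_real (- (s * w) * g)"
    by (simp only: of_real_mult[symmetric] of_real_add[symmetric])
  have "E $$ (a, b) = of_real (- (s * w) * g)"
    using ab by (simp add: E_def g_def)
  moreover have "E \<in> carrier_mat n n" by (simp add: E_def)
  ultimately show "exp_covariance r n $$ (a, b) = (of_real s \<cdot>\<^sub>m exp_covariance \<rho> n
     + of_real (- s * w) \<cdot>\<^sub>m (exp_covariance r n * exp_covariance \<rho> n) + E) $$ (a, b)"
    using ab x P
    by (simp add: exp_covariance_index x_def[symmetric] y_def[symmetric] del: index_mult_mat(1) of_real_power)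
qed (auto simp: E_def)

text \<open>If the column bounds h j have a bounded sum, the normalized trace is of order 1 / n.
  This disposes of the corner terms of the resolvent.\<close>

lemma norm_trace_mult_le:
  assumes A: "A \<in> carrier_mat n n" and E: "E \<in> carrier_mat n n" and a: "row_sums_le A K"
    and e: "\<And>i j. i < n \<Longrightarrow> j < n \<Longrightarrow> cmod (E $$ (i, j)) \<le> h j" and K: "0 \<le> K"
  shows "cmod (norm_trace (A * E)) \<le> K * (\<Sum>j<n. h j) / real n"
proof -
  have "cmod (\<Sum>j<n. (A * E) $$ (j, j)) \<le> (\<Sum>j<n. \<Sum>i<n. cmod (A $$ (j, i)) * cmod (E $$ (i, j)))"
    by (auto intro!: sum_mono norm_sum[THEN order_trans]
        simp: index_mult_mat_sum[OF A E] norm_mult simp del: index_mult_mat(1))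
  also have "\<dots> \<le> (\<Sum>j<n. K * h j)"
  proof (rule sum_mono)
    fix j assume "j \<in> {..<n}"
    then have j: "j < n" by simp
    have "(\<Sum>i<n. cmod (A $$ (j, i)) * cmod (E $$ (i, j))) \<le> (\<Sum>i<n. cmod (A $$ (j, i)) * h j)"
      using e j by (intro sum_mono mult_left_mono) auto
    also have "\<dots> = (\<Sum>i<n. cmod (A $$ (j, i))) * h j" by (simp add: sum_distrib_right)
    also have "\<dots> \<le> K * h j"
      using a A j order_trans[OF norm_ge_zero e[OF j j]]
      by (intro mult_right_mono) (auto simp: row_sums_le_def)
    finally show "(\<Sum>i<n. cmod (A $$ (j, i)) * cmod (E $$ (i, j))) \<le> K * h j" .
  qed
  finally show ?thesis
    using A E by (simp add: norm_trace_def norm_divide sum_distrib_left divide_right_mono)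
qed

text \<open>Multiplying the resolvent identity by A^j and taking traces gives a two-term recursion
  for tr(A^j B), B the matrix for \<rho>, which starts at 1. The recursion makes these traces
  converge, and it makes the sum telescope to s - s w^J \<tau> J, so that no inverse matrix has to
  be formed.\<close>

lemma exp_covariance_moment_sums:
  fixes r \<rho> :: real and T :: "nat \<Rightarrow> nat" and m :: "nat \<Rightarrow> complex"
  assumes r: "0 < r" "r < \<rho>" and \<rho>: "\<rho> < 1"
    and T: "filterlim T at_top sequentially"
    and m: "\<And>k. (\<lambda>N. norm_trace (exp_covariance r (T N) ^\<^sub>m Suc k)) \<longlonglongrightarrow> m (Suc k)"
  defines "w \<equiv> ((r + 1 / r) - (\<rho> + 1 / \<rho>)) / (1 / r - r)" and "s \<equiv> (1 / r - r) / (1 / \<rho> - \<rho>)"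
  assumes w: "0 < w" "w * (2 / (1 - r)) < 1"
  shows "(\<lambda>j. of_real w ^ j * m (Suc j)) sums of_real s"
proof -
  let ?A = "\<lambda>N. exp_covariance r (T N)" and ?B = "\<lambda>N. exp_covariance \<rho> (T N)"
  define L L' where "L = 2 / (1 - r)" and "L' = 2 / (1 - \<rho>)"
  have L: "0 \<le> L" "0 \<le> L'" using r \<rho> by (auto simp: L_def L'_def)
  define E where "E = (\<lambda>n. Matrix.mat n n (\<lambda>(a, b). complex_of_real
     (- (s * w / (1 - r * \<rho>)) * (r ^ (a + 1) * \<rho> ^ (b + 1) + r ^ (n - a) * \<rho> ^ (n - b)))))"
  have E: "E n \<in> carrier_mat n n" for n by (simp add: E_def)
  have res: "exp_covariance r n = of_real s \<cdot>\<^sub>m exp_covariance \<rho> n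
     + of_real (- s * w) \<cdot>\<^sub>m (exp_covariance r n * exp_covariance \<rho> n) + E n" for n
    unfolding w_def s_def E_def by (rule exp_covariance_resolvent[OF r \<rho>])
  define t where "t = (\<lambda>j N. norm_trace (?A N ^\<^sub>m j * ?B N))"
  define \<epsilon> where "\<epsilon> = (\<lambda>j N. norm_trace (?A N ^\<^sub>m j * E (T N)))"
  have rowA: "row_sums_le (exp_covariance r n ^\<^sub>m j) (L ^ j)" for n j
    using row_sums_le_pow[OF exp_covariance_carrier[of r n] exp_covariance_row_sums[of r n], of j] r \<rho> L
    by (simp add: L_def)
  have rec: "norm_trace (?A N ^\<^sub>m Suc j) = of_real s * t j N - of_real (s * w) * t (Suc j) N + \<epsilon> j N" for j N
  proof -
    let ?n = "T N"
    have P: "?A N ^\<^sub>m j \<in> carrier_mat ?n ?n" by (rule pow_carrier_mat) simp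
    have c: "?A N ^\<^sub>m j * ?B N \<in> carrier_mat ?n ?n" "?A N ^\<^sub>m Suc j * ?B N \<in> carrier_mat ?n ?n"
      "?A N ^\<^sub>m j * E ?n \<in> carrier_mat ?n ?n"
      using P E by (auto intro!: mult_carrier_mat[where n = ?n])
    have eq: "?A N ^\<^sub>m Suc j = ?A N ^\<^sub>m j * (of_real s \<cdot>\<^sub>m ?B N
        + of_real (- s * w) \<cdot>\<^sub>m (?A N * ?B N) + E ?n)"
      using res[of ?n] by simp
    also have "?A N ^\<^sub>m j * (of_real s \<cdot>\<^sub>m ?B N
        + of_real (- s * w) \<cdot>\<^sub>m (?A N * ?B N) + E ?n) = of_real s \<cdot>\<^sub>m (?A N ^\<^sub>m j * ?B N)
        + of_real (- s * w) \<cdot>\<^sub>m (?A N ^\<^sub>m Suc j * ?B N) + ?A N ^\<^sub>m j * E ?n"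
      using P E[of ?n]
      by (simp add: mult_add_distrib_mat[of _ ?n ?n _ ?n] mult_smult_distrib[of _ ?n ?n _ ?n]
          assoc_mult_mat[of _ ?n ?n _ ?n _ ?n, symmetric] mult_carrier_mat[of _ ?n ?n _ ?n])
    finally show ?thesis
      unfolding t_def \<epsilon>_def
      using norm_trace_linear[OF c, of "of_real s" "of_real (- s * w)"] by (simp del: pow_mat.simps)
  qed
  have Tr: "filterlim (\<lambda>N. real (T N)) at_top sequentially"
    using T filterlim_compose filterlim_real_sequentially by blast
  have \<epsilon>: "\<epsilon> j \<longlonglongrightarrow> 0" for j
  proof -
    define K where "K = \<bar>s * w / (1 - r * \<rho>)\<bar>"
    define C where "C = L ^ j * (K * (2 / (1 - \<rho>)))"
    have "cmod (\<epsilon> j N) \<le> C / real (T N)" for N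
    proof -
      let ?n = "T N"
      \<comment> \<open>The powers of r are bounded by 1; the decay of the powers of \<rho> along
        the columns suffices.\<close>
      have "cmod (E ?n $$ (a, b)) \<le> K * (\<rho> ^ b + \<rho> ^ (?n - Suc b))" if "a < ?n" "b < ?n" for a b
      proof -
        have "r ^ (a + 1) * \<rho> ^ (b + 1) \<le> 1 * \<rho> ^ b" "r ^ (?n - a) * \<rho> ^ (?n - b) \<le> 1 * \<rho> ^ (?n - Suc b)"
          using r \<rho> by (intro mult_mono power_decreasing power_le_one; simp)+
        moreover have "0 \<le> r ^ (a + 1) * \<rho> ^ (b + 1) + r ^ (?n - a) * \<rho> ^ (?n - b)"
          using r \<rho> by simp
        ultimately have "\<bar>r ^ (a + 1) * \<rho> ^ (b + 1) + r ^ (?n - a) * \<rho> ^ (?n - b)\<bar> \<le> \<rho> ^ b + \<rho> ^ (?n - Suc b)"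
          by linarith
        moreover have "cmod (E ?n $$ (a, b)) = K * \<bar>r ^ (a + 1) * \<rho> ^ (b + 1) + r ^ (?n - a) * \<rho> ^ (?n - b)\<bar>"
          using that by (simp add: E_def K_def norm_of_real abs_mult del: of_real_mult of_real_minus of_real_add of_real_power of_real_divide)
        moreover have "0 \<le> K" by (simp add: K_def)
        ultimately show ?thesis by (simp only: mult_left_mono)
      qed
      then have "cmod (\<epsilon> j N) \<le> L ^ j * (\<Sum>b<?n. K * (\<rho> ^ b + \<rho> ^ (?n - Suc b))) / real ?n"
        unfolding \<epsilon>_def using L(1)
        by (intro norm_trace_mult_le[OF _ E rowA] pow_carrier_mat) auto
      also have "(\<Sum>b<?n. K * (\<rho> ^ b + \<rho> ^ (?n - Suc b))) = K * ((\<Sum>b<?n. \<rho> ^ b) + (\<Sum>b<?n. \<rho> ^ b))"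
        by (simp only: sum_distrib_left[symmetric] sum.distrib sum.nat_diff_reindex[of "\<lambda>i. \<rho> ^ i"])
      also have "L ^ j * (K * ((\<Sum>b<?n. \<rho> ^ b) + (\<Sum>b<?n. \<rho> ^ b))) / real ?n \<le> C / real ?n"
        unfolding C_def using geometric_le[of \<rho> ?n] r \<rho> L
        by (intro divide_right_mono mult_left_mono) (auto simp: K_def)
      finally show ?thesis .
    qed
    moreover have "(\<lambda>N. C / real (T N)) \<longlonglongrightarrow> 0"
      by (rule real_tendsto_divide_at_top[OF tendsto_const Tr])
    ultimately show ?thesis by (rule Lim_null_comparison[OF always_eventually[OF allI]])
  qed
  have tb: "cmod (t j N) \<le> L ^ j * L'" for j N
    unfolding t_def
  proof (rule norm_trace_le[of _ "T N"])
    show "row_sums_le (?A N ^\<^sub>m j * ?B N) (L ^ j * L')"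
      using exp_covariance_row_sums[of \<rho> "T N"] r \<rho> L
      by (intro row_sums_le_mult[where n = "T N"] rowA pow_carrier_mat) (auto simp: L'_def)
  qed (use L in \<open>auto intro!: mult_carrier_mat[where n = "T N"] pow_carrier_mat\<close>)
  have s0: "s \<noteq> 0" "complex_of_real (s * w) \<noteq> 0"
  proof -
    have "x < 1 / x" if "0 < x" "x < 1" for x :: real
      using that mult_strict_mono[of x 1 x 1] by (simp add: field_simps)
    from this[of r] this[of \<rho>] show "s \<noteq> 0" using r \<rho> by (auto simp: s_def)
    then show "complex_of_real (s * w) \<noteq> 0" using w by simp
  qed
  have "\<exists>\<tau>. t j \<longlonglongrightarrow> \<tau> \<and> (j = 0 \<longrightarrow> \<tau> = 1)" for j
  proof (induction j)
    case 0
    have "\<forall>\<^sub>F N in sequentially. t 0 N = 1"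
      using filterlim_at_top[THEN iffD1, OF T, rule_format, of 1]
    proof eventually_elim
      case (elim N)
      then show ?case by (simp add: t_def norm_trace_def exp_covariance_index)
    qed
    then show ?case by (auto intro: tendsto_eventually)
  next
    case (Suc j)
    then obtain \<tau> where "t j \<longlonglongrightarrow> \<tau>" by blast
    \<comment> \<open>As s w is nonzero, the recursion can be solved for \<open>t (Suc j)\<close>,
      whose limit therefore exists.\<close>
    then have "(\<lambda>N. (of_real s * t j N + \<epsilon> j N - norm_trace (?A N ^\<^sub>m Suc j)) / of_real (s * w))
        \<longlonglongrightarrow> (of_real s * \<tau> + 0 - m (Suc j)) / of_real (s * w)"
      by (intro tendsto_intros \<epsilon> m s0)
    moreover have "(of_real s * t j N + \<epsilon> j N - norm_trace (?A N ^\<^sub>m Suc j)) / of_real (s * w) = t (Suc j) N" for N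
      unfolding rec using s0 by simp
    ultimately show ?case by auto
  qed
  then obtain \<tau> where \<tau>: "\<And>j. t j \<longlonglongrightarrow> \<tau> j" "\<tau> 0 = 1" by metis
  have \<tau>b: "cmod (\<tau> j) \<le> L ^ j * L'" for j
    by (rule tendsto_upperbound[OF tendsto_norm[OF \<tau>(1)]]) (auto simp: tb)
  have mrec: "m (Suc j) = of_real s * \<tau> j - of_real (s * w) * \<tau> (Suc j)" for j
  proof -
    have "(\<lambda>N. of_real s * t j N - of_real (s * w) * t (Suc j) N + \<epsilon> j N)
       \<longlonglongrightarrow> of_real s * \<tau> j - of_real (s * w) * \<tau> (Suc j) + 0"
      by (intro tendsto_intros \<epsilon> \<tau>)
    then show ?thesis using m[of j] LIMSEQ_unique unfolding rec by fastforce
  qed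
  have "(\<Sum>j<J. of_real w ^ j * m (Suc j)) = of_real s - of_real s * (of_real w ^ J * \<tau> J)" for J
    by (induction J) (simp_all add: \<tau>(2) mrec algebra_simps)
  moreover have "(\<lambda>J. of_real w ^ J * \<tau> J) \<longlonglongrightarrow> 0"
  proof (rule Lim_null_comparison)
    show "\<forall>\<^sub>F J in sequentially. norm (of_real w ^ J * \<tau> J) \<le> (w * L) ^ J * L'"
    proof (rule always_eventually, rule allI)
      fix J
      have "norm (of_real w ^ J * \<tau> J) \<le> w ^ J * (L ^ J * L')"
        unfolding norm_mult norm_power using w \<tau>b by (intro mult_mono) auto
      then show "norm (of_real w ^ J * \<tau> J) \<le> (w * L) ^ J * L'"
        by (simp add: power_mult_distrib mult.assoc)
    qed
    have "(\<lambda>J. (w * L) ^ J) \<longlonglongrightarrow> 0"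
      using w L by (intro LIMSEQ_realpow_zero) (auto simp: L_def)
    then show "(\<lambda>J. (w * L) ^ J * L') \<longlonglongrightarrow> 0" by (rule tendsto_mult_left_zero)
  qed
  then have "(\<lambda>J. complex_of_real s - of_real s * (of_real w ^ J * \<tau> J)) \<longlonglongrightarrow> of_real s - of_real s * 0"
    by (intro tendsto_intros)
  ultimately show ?thesis by (simp add: sums_def)
qed

text \<open>Zeros of a nonzero convergent series are isolated, so an identity may be tested along
  one null sequence, such as the real parameters w(\<rho>) below.\<close>

lemma fps_eq_0_if_zeros:
  fixes F :: "complex fps"
  assumes rad: "0 < fps_conv_radius F" and z: "z \<longlonglongrightarrow> 0"
    and zeros: "\<forall>\<^sub>F n in sequentially. z n \<noteq> 0 \<and> eval_fps F (z n) = 0"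
  shows "F = 0"
proof (rule ccontr)
  assume "F \<noteq> 0"
  have "isCont (eval_fps F) 0" using rad by (intro continuous_eval_fps) (simp add: zero_ereal_def)
  then have "(\<lambda>n. eval_fps F (z n)) \<longlonglongrightarrow> eval_fps F 0" by (rule isCont_tendsto_compose[OF _ z])
  moreover have "(\<lambda>n. eval_fps F (z n)) \<longlonglongrightarrow> 0"
    using zeros by (intro tendsto_eventually) (auto elim: eventually_mono)
  ultimately have F0: "eval_fps F 0 = 0" using LIMSEQ_unique by blast
  then have "fps_nth F 0 = 0" by (simp add: eval_fps_at_0)
  with \<open>F \<noteq> 0\<close> obtain m where m: "fps_nth F m \<noteq> 0" "0 < m"
    by (metis fps_eq_iff fps_zero_nth gr0I)
  obtain r where r: "0 < r" "ereal r < fps_conv_radius F"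
    using rad ereal_dense2[OF rad] by (auto simp: zero_ereal_def)
  obtain s where s: "0 < s" "\<And>x. x \<in> cball 0 s - {0} \<Longrightarrow> eval_fps F x \<noteq> 0"
  proof (rule powser_0_nonzero[of r 0 "fps_nth F" "eval_fps F" m])
    fix x :: complex assume "norm (x - 0) < r"
    then show "(\<lambda>n. fps_nth F n * (x - 0) ^ n) sums eval_fps F x"
      using sums_eval_fps[of x F] r(2) by (simp add: less_trans[of "ereal (norm x)" "ereal r"])
  qed (use r m F0 in auto)
  have "\<forall>\<^sub>F n in sequentially. z n \<in> ball 0 s"
    using z s(1) by (intro topological_tendstoD) auto
  then have "\<forall>\<^sub>F n in sequentially. False"
    using zeros by eventually_elim (use s(2) in auto)
  then show False by simp
qed

text \<open>With R = r + 1/r, P = \<rho> + 1/\<rho> and the differences k = 1/r - r, k' = 1/\<rho> -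
  \<rho> one has w k = R - P, s = k / k' and \<gamma> = R / k. The relations k^2 = R^2 - 4 and k'^2
  = P^2 - 4 eliminate \<rho>.\<close>

lemma kms_parameter_identity:
  fixes r \<rho> :: real
  assumes r: "0 < r" "r < 1" and \<rho>: "0 < \<rho>" "\<rho> < 1"
  defines "w \<equiv> ((r + 1 / r) - (\<rho> + 1 / \<rho>)) / (1 / r - r)" and "s \<equiv> (1 / r - r) / (1 / \<rho> - \<rho>)"
  shows "s\<^sup>2 * (1 - 2 * ((1 + r\<^sup>2) / (1 - r\<^sup>2)) * w + w\<^sup>2) = 1"
proof -
  define k k' R P where "k = 1 / r - r" and "k' = 1 / \<rho> - \<rho>" and "R = r + 1 / r" and "P = \<rho> + 1 / \<rho>"
  have pos: "x < 1 / x" if "0 < x" "x < 1" for x :: real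
    using that mult_strict_mono[of x 1 x 1] by (simp add: field_simps)
  have k: "k > 0" "k' > 0" using pos[OF r] pos[OF \<rho>] by (simp_all add: k_def k'_def)
  have sq: "k\<^sup>2 = R\<^sup>2 - 4" "k'\<^sup>2 = P\<^sup>2 - 4"
    using r \<rho> by (simp_all add: k_def k'_def R_def P_def power2_eq_square field_simps)
  have "r\<^sup>2 < 1" using r by (simp add: power_less_one_iff)
  then have \<gamma>: "(1 + r\<^sup>2) / (1 - r\<^sup>2) = R / k"
    using r k(1) by (simp add: R_def k_def power2_eq_square divide_simps)
  have "s\<^sup>2 * (1 - 2 * (R / k) * w + w\<^sup>2) = (k\<^sup>2 - 2 * R * (R - P) + (R - P)\<^sup>2) / k'\<^sup>2"
    using k by (simp add: s_def w_def k_def[symmetric] k'_def[symmetric] R_def[symmetric] P_def[symmetric]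
        field_simps power2_eq_square)
  also have "k\<^sup>2 - 2 * R * (R - P) + (R - P)\<^sup>2 = k'\<^sup>2"
    unfolding sq by (simp add: power2_eq_square algebra_simps)
  finally show ?thesis unfolding \<gamma> using k by simp
qed

text \<open>At w = w(\<rho>) the value of \<psi> is w s by
  \<open>exp_covariance_moment_sums\<close>, and \<open>kms_parameter_identity\<close> relates s to
  w. As \<rho> tends to r from above, w tends to 0, which gives the equation for the series.\<close>

theorem exp_covariance_moment_series:
  fixes r :: real and T :: "nat \<Rightarrow> nat" and m :: "nat \<Rightarrow> complex"
  assumes r: "0 < r" "r < 1" and T: "filterlim T at_top sequentially"
    and m: "\<And>k. (\<lambda>N. norm_trace (exp_covariance r (T N) ^\<^sub>m Suc k)) \<longlonglongrightarrow> m (Suc k)"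
  defines "\<psi> \<equiv> Abs_fps (\<lambda>n. if n = 0 then 0 else m n)"
  shows "\<psi>\<^sup>2 * (1 - fps_const (of_real (2 * ((1 + r\<^sup>2) / (1 - r\<^sup>2)))) * fps_X + fps_X\<^sup>2) = fps_X\<^sup>2"
proof -
  define g where "g = 2 * ((1 + r\<^sup>2) / (1 - r\<^sup>2))"
  define w where "w = (\<lambda>\<rho>. ((r + 1 / r) - (\<rho> + 1 / \<rho>)) / (1 / r - r))"
  define s where "s = (\<lambda>\<rho>. (1 / r - r) / (1 / \<rho> - \<rho>))"
  define \<rho> where "\<rho> = (\<lambda>n. r + (1 - r) / real (n + 2))"
  have kr: "1 / r - r > 0"
    using r mult_strict_mono[of r 1 r 1] by (simp add: field_simps)
  have \<rho>: "r < \<rho> n" "\<rho> n < 1" for n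
  proof -
    show "r < \<rho> n" using r by (simp add: \<rho>_def)
    have "(1 - r) / real (n + 2) < (1 - r) / 1"
      using r by (intro divide_strict_left_mono) auto
    then show "\<rho> n < 1" by (simp add: \<rho>_def)
  qed
  have "(\<lambda>n. (1 - r) / real (n + 2)) \<longlonglongrightarrow> 0"
    by (rule LIMSEQ_ignore_initial_segment[OF lim_const_over_n])
  then have \<rho>lim: "\<rho> \<longlonglongrightarrow> r" unfolding \<rho>_def by (auto intro: tendsto_eq_intros)
  have "isCont w r" unfolding w_def using r kr by (intro continuous_intros) auto
  then have wlim: "(\<lambda>n. w (\<rho> n)) \<longlonglongrightarrow> 0"
    using isCont_tendsto_compose[OF _ \<rho>lim, of w] by (simp add: w_def)
  have wpos: "0 < w (\<rho> n)" for n
  proof -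
    have "(r + 1 / r) - (\<rho> n + 1 / \<rho> n) = (\<rho> n - r) * (1 - r * \<rho> n) / (r * \<rho> n)"
      using r \<rho>[of n] by (simp add: field_simps)
    moreover have "r * \<rho> n < 1" using r \<rho>[of n] mult_strict_mono[of r 1 "\<rho> n" 1] by auto
    ultimately show ?thesis unfolding w_def using r \<rho>[of n] kr by (auto intro!: divide_pos_pos mult_pos_pos)
  qed
  have sums: "(\<lambda>j. fps_nth \<psi> j * of_real (w (\<rho> n)) ^ j) sums of_real (w (\<rho> n) * s (\<rho> n))"
    if "w (\<rho> n) * (2 / (1 - r)) < 1" for n
  proof -
    have "(\<lambda>j. of_real (w (\<rho> n)) ^ j * m (Suc j)) sums of_real (s (\<rho> n))"
      using exp_covariance_moment_sums[OF r(1) \<rho> T m] wpos[of n] that by (simp add: w_def s_def)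
    then have "(\<lambda>j. of_real (w (\<rho> n)) * (of_real (w (\<rho> n)) ^ j * m (Suc j)))
        sums (of_real (w (\<rho> n)) * of_real (s (\<rho> n)))"
      by (rule sums_mult)
    then have "(\<lambda>j. fps_nth \<psi> (Suc j) * of_real (w (\<rho> n)) ^ Suc j) sums (of_real (w (\<rho> n) * s (\<rho> n)))"
      by (simp add: \<psi>_def mult_ac)
    then show ?thesis by (subst (asm) sums_Suc_iff) (simp add: \<psi>_def)
  qed
  have ev: "\<forall>\<^sub>F n in sequentially. w (\<rho> n) * (2 / (1 - r)) < 1"
    using order_tendstoD(2)[OF tendsto_mult_left_zero[OF wlim, of "2 / (1 - r)"], of 1] by simp
  then obtain n0 where n0: "w (\<rho> n0) * (2 / (1 - r)) < 1"
    unfolding eventually_sequentially by blast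
  \<comment> \<open>Convergence at a single nonzero point already gives a positive radius.\<close>
  have "ereal (norm (complex_of_real (w (\<rho> n0)))) \<le> fps_conv_radius \<psi>"
    unfolding fps_conv_radius_def using sums_summable[OF sums[OF n0]] by (rule conv_radius_geI)
  then have rad: "0 < fps_conv_radius \<psi>"
  proof (rule less_le_trans[rotated])
    show "0 < ereal (norm (complex_of_real (w (\<rho> n0))))" using wpos[of n0] by (simp add: zero_ereal_def)
  qed
  define f where "f = (\<lambda>z. (eval_fps \<psi> z)\<^sup>2 * (1 - of_real g * z + z\<^sup>2) - z\<^sup>2)"
  have "eval_fps \<psi> has_fps_expansion \<psi>" by (rule eval_fps_has_fps_expansion[OF rad])
  then have f: "f has_fps_expansion \<psi>\<^sup>2 * (1 - fps_const (of_real g) * fps_X + fps_X\<^sup>2) - fps_X\<^sup>2"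
    unfolding f_def by (intro fps_expansion_intros)
  have "\<psi>\<^sup>2 * (1 - fps_const (of_real g) * fps_X + fps_X\<^sup>2) - fps_X\<^sup>2 = 0" (is "?F = 0")
  proof (rule fps_eq_0_if_zeros)
    show "0 < fps_conv_radius ?F" using f by (simp add: has_fps_expansion_def)
    show wl: "(\<lambda>n. complex_of_real (w (\<rho> n))) \<longlonglongrightarrow> 0"
      using tendsto_of_real[OF wlim, where 'a = complex] by simp
    have "\<forall>\<^sub>F z in nhds 0. eval_fps ?F z = f z" using f by (simp add: has_fps_expansion_def)
    then have "\<forall>\<^sub>F n in sequentially. eval_fps ?F (of_real (w (\<rho> n))) = f (of_real (w (\<rho> n)))"
      using wl by (rule eventually_compose_filterlim)
    then show "\<forall>\<^sub>F n in sequentially. complex_of_real (w (\<rho> n)) \<noteq> 0 \<and> eval_fps ?F (of_real (w (\<rho> n))) = 0"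
      using ev
    proof eventually_elim
      case (elim n)
      have "eval_fps \<psi> (of_real (w (\<rho> n))) = of_real (w (\<rho> n) * s (\<rho> n))"
        using sums_unique[OF sums[OF elim(2)]] by (simp add: eval_fps_def)
      then have "f (of_real (w (\<rho> n))) = of_real ((w (\<rho> n) * s (\<rho> n))\<^sup>2 * (1 - g * w (\<rho> n) + (w (\<rho> n))\<^sup>2) - (w (\<rho> n))\<^sup>2)"
        by (simp add: f_def)
      also have "(w (\<rho> n) * s (\<rho> n))\<^sup>2 * (1 - g * w (\<rho> n) + (w (\<rho> n))\<^sup>2) - (w (\<rho> n))\<^sup>2
          = (w (\<rho> n))\<^sup>2 * ((s (\<rho> n))\<^sup>2 * (1 - g * w (\<rho> n) + (w (\<rho> n))\<^sup>2)) - (w (\<rho> n))\<^sup>2"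
        by (simp add: power_mult_distrib)
      also have "(s (\<rho> n))\<^sup>2 * (1 - g * w (\<rho> n) + (w (\<rho> n))\<^sup>2) = 1"
        using kms_parameter_identity[OF r, of "\<rho> n"] r \<rho>[of n] by (simp add: g_def w_def s_def)
      finally show ?case using elim wpos[of n] by simp
    qed
  qed
  then show ?thesis by (simp add: g_def)
qed

section \<open>Square roots of non-negative definite matrices\<close>

text \<open>Vectors are functions on indices, so that splitting off the index 0 in
  \<open>psd_sqrt_exists\<close> is a shift of the argument.\<close>

definition quad_form :: "nat \<Rightarrow> complex mat \<Rightarrow> (nat \<Rightarrow> complex) \<Rightarrow> complex" where
  "quad_form n A x = (\<Sum>i<n. cnj (x i) * (\<Sum>j<n. A $$ (i, j) * x j))"

definition psd :: "nat \<Rightarrow> complex mat \<Rightarrow> bool" where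
  "psd n A \<longleftrightarrow> A \<in> carrier_mat n n \<and> (\<forall>i<n. \<forall>j<n. A $$ (i, j) = cnj (A $$ (j, i))) \<and>
     (\<forall>x. 0 \<le> Re (quad_form n A x))"

lemma psdD:
  assumes "psd n A"
  shows "A \<in> carrier_mat n n" "i < n \<Longrightarrow> j < n \<Longrightarrow> A $$ (i, j) = cnj (A $$ (j, i))"
    "0 \<le> Re (quad_form n A x)"
  using assms unfolding psd_def by blast+

lemma mat_adjoint_index:
  assumes "A \<in> carrier_mat n m" "i < m" "j < n"
  shows "mat_adjoint A $$ (i, j) = cnj (A $$ (j, i))"
  using assms by (simp add: mat_adjoint_def mat_of_rows_def conjugate_complex_def)

lemma mat_adjoint_carrier: "A \<in> carrier_mat n m \<Longrightarrow> mat_adjoint A \<in> carrier_mat m n"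
  by (auto simp: mat_adjoint_def mat_of_rows_def)

lemma quad_form_cscalar_prod:
  assumes "A \<in> carrier_mat n n" "v \<in> carrier_vec n"
  shows "(A *\<^sub>v v) \<bullet>c v = quad_form n A (\<lambda>i. vec_index v i)"
  using assms
  by (auto simp: scalar_prod_def quad_form_def atLeast0LessThan mult.commute intro!: sum.cong)

lemma quad_form_cong: "(\<And>i. i < n \<Longrightarrow> x i = y i) \<Longrightarrow> quad_form n A x = quad_form n A y"
  by (simp add: quad_form_def)

lemma nonneg_definite_iff_psd:
  assumes "A \<in> carrier_mat n n"
  shows "nonneg_definite A \<longleftrightarrow> psd n A"
proof -
  have "mat_adjoint A = A \<longleftrightarrow> (\<forall>i<n. \<forall>j<n. A $$ (i, j) = cnj (A $$ (j, i)))"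
    using assms mat_adjoint_carrier[OF assms] mat_adjoint_index[OF assms]
    by (metis (no_types, lifting) carrier_matD eq_matI)
  moreover have "(\<forall>v \<in> carrier_vec n. 0 \<le> Re ((A *\<^sub>v v) \<bullet>c v)) \<longleftrightarrow> (\<forall>x. 0 \<le> Re (quad_form n A x))"
  proof safe
    fix x assume "\<forall>v \<in> carrier_vec n. 0 \<le> Re ((A *\<^sub>v v) \<bullet>c v)"
    then have "0 \<le> Re ((A *\<^sub>v Matrix.vec n x) \<bullet>c Matrix.vec n x)" by simp
    then show "0 \<le> Re (quad_form n A x)"
      using quad_form_cscalar_prod[OF assms, of "Matrix.vec n x"] by (simp cong: quad_form_cong)
  qed (use quad_form_cscalar_prod[OF assms] in auto)
  ultimately show ?thesis
    using assms by (auto simp: nonneg_definite_def psd_def)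
qed

lemma quad_form_congruence:
  assumes A: "A \<in> carrier_mat n n" and W: "W \<in> carrier_mat n n"
  shows "quad_form n (mat_adjoint W * A * W) x = quad_form n A (\<lambda>i. \<Sum>j<n. W $$ (i, j) * x j)"
proof -
  let ?y = "\<lambda>i. \<Sum>j<n. W $$ (i, j) * x j"
  have W': "mat_adjoint W \<in> carrier_mat n n" by (rule mat_adjoint_carrier[OF W])
  have 1: "(\<Sum>j<n. (A * W) $$ (k, j) * x j) = (\<Sum>l<n. A $$ (k, l) * ?y l)" if "k < n" for k
  proof -
    have "(\<Sum>j<n. (A * W) $$ (k, j) * x j) = (\<Sum>j<n. \<Sum>l<n. A $$ (k, l) * (W $$ (l, j) * x j))"
      using that by (intro sum.cong) (auto simp: index_mult_mat_sum[OF A W] sum_distrib_right mult.assoc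
          simp del: index_mult_mat(1))
    also have "\<dots> = (\<Sum>l<n. A $$ (k, l) * ?y l)"
      unfolding sum_distrib_left by (rule sum.swap)
    finally show ?thesis .
  qed
  have 2: "(\<Sum>j<n. (mat_adjoint W * A * W) $$ (i, j) * x j)
      = (\<Sum>k<n. cnj (W $$ (k, i)) * (\<Sum>l<n. A $$ (k, l) * ?y l))" if "i < n" for i
  proof -
    have "(\<Sum>j<n. (mat_adjoint W * A * W) $$ (i, j) * x j)
        = (\<Sum>j<n. \<Sum>k<n. cnj (W $$ (k, i)) * ((A * W) $$ (k, j) * x j))"
      using that A W W' assoc_mult_mat[OF W' A W]
      by (simp add: index_mult_mat_sum[OF W' mult_carrier_mat[OF A W]] mat_adjoint_index[OF W]
          sum_distrib_right mult.assoc del: index_mult_mat(1))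
    also have "\<dots> = (\<Sum>k<n. cnj (W $$ (k, i)) * (\<Sum>j<n. (A * W) $$ (k, j) * x j))"
      unfolding sum_distrib_left by (rule sum.swap)
    finally show ?thesis using 1 by simp
  qed
  have "quad_form n (mat_adjoint W * A * W) x
      = (\<Sum>i<n. \<Sum>k<n. cnj (x i) * (cnj (W $$ (k, i)) * (\<Sum>l<n. A $$ (k, l) * ?y l)))"
    unfolding quad_form_def by (simp add: 2 sum_distrib_left del: index_mult_mat(1))
  also have "\<dots> = (\<Sum>k<n. cnj (?y k) * (\<Sum>l<n. A $$ (k, l) * ?y l))"
    by (subst sum.swap) (simp add: sum_distrib_right mult_ac)
  finally show ?thesis by (simp add: quad_form_def)
qed

lemma mat_adjoint_mult:
  fixes A B :: "complex mat"
  assumes A: "A \<in> carrier_mat n k" and B: "B \<in> carrier_mat k m"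
  shows "mat_adjoint (A * B) = mat_adjoint B * mat_adjoint A"
proof (rule eq_matI)
  fix i j assume "i < dim_row (mat_adjoint B * mat_adjoint A)" "j < dim_col (mat_adjoint B * mat_adjoint A)"
  then have ij: "i < m" "j < n" using mat_adjoint_carrier[OF A] mat_adjoint_carrier[OF B] by auto
  then show "mat_adjoint (A * B) $$ (i, j) = (mat_adjoint B * mat_adjoint A) $$ (i, j)"
    by (simp add: mat_adjoint_index[OF mult_carrier_mat[OF A B]] mat_adjoint_index[OF A] mat_adjoint_index[OF B]
        index_mult_mat_sum[OF A B] index_mult_mat_sum[OF mat_adjoint_carrier[OF B] mat_adjoint_carrier[OF A]]
        mult.commute del: index_mult_mat(1))
qed (use mat_adjoint_carrier[OF A] mat_adjoint_carrier[OF B] mat_adjoint_carrier[OF mult_carrier_mat[OF A B]] in auto)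

lemma mat_adjoint_adjoint: "A \<in> carrier_mat n m \<Longrightarrow> mat_adjoint (mat_adjoint A) = (A :: complex mat)"
proof (rule eq_matI)
  assume A: "A \<in> carrier_mat n m"
  note A' = mat_adjoint_carrier[OF A]
  show "dim_row (mat_adjoint (mat_adjoint A)) = dim_row A" "dim_col (mat_adjoint (mat_adjoint A)) = dim_col A"
    using A mat_adjoint_carrier[OF A'] by auto
  fix i j assume "i < dim_row A" "j < dim_col A"
  then have "i < n" "j < m" using A by auto
  then show "mat_adjoint (mat_adjoint A) $$ (i, j) = A $$ (i, j)"
    by (simp add: mat_adjoint_index[OF A'] mat_adjoint_index[OF A])
qed

lemma psd_hermitian: "psd n A \<Longrightarrow> mat_adjoint A = A"
  using nonneg_definite_iff_psd[OF psdD(1)] by (auto simp: nonneg_definite_def)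

lemma psd_congruence:
  assumes A: "psd n A" and W: "W \<in> carrier_mat n n"
  shows "psd n (mat_adjoint W * A * W)"
proof -
  note Ac = psdD(1)[OF A]
  note W' = mat_adjoint_carrier[OF W]
  have c: "mat_adjoint W * A * W \<in> carrier_mat n n" using Ac W W' by auto
  have "mat_adjoint (mat_adjoint W * A * W) = mat_adjoint W * (A * W)"
    using psd_hermitian[OF A]
    by (simp add: mat_adjoint_mult[OF mult_carrier_mat[OF W' Ac] W] mat_adjoint_mult[OF W' Ac]
        mat_adjoint_adjoint[OF W])
  also have "\<dots> = mat_adjoint W * A * W" using assoc_mult_mat[OF W' Ac W] by simp
  finally have eq: "mat_adjoint (mat_adjoint W * A * W) = mat_adjoint W * A * W" .
  have herm: "(mat_adjoint W * A * W) $$ (i, j) = cnj ((mat_adjoint W * A * W) $$ (j, i))"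
    if "i < n" "j < n" for i j
    using mat_adjoint_index[OF c that] unfolding eq .
  show ?thesis
    unfolding psd_def quad_form_congruence[OF Ac W]
    by (intro conjI allI impI c psdD(3)[OF A] herm)
qed

text \<open>Gram-Schmidt yields columns that are orthogonal but not normalized. Dividing by the
  lengths \<open>N j\<close> makes them orthonormal and turns the first one into a multiple of
  v.\<close>

lemma unitary_completion:
  fixes v :: "complex vec"
  assumes v: "v \<in> carrier_vec n" and v0: "v \<noteq> 0\<^sub>v n"
  obtains W c where "W \<in> carrier_mat n n" "mat_adjoint W * W = 1\<^sub>m n" "W * mat_adjoint W = 1\<^sub>m n"
    "col W 0 = c \<cdot>\<^sub>v v"
proof -
  interpret cof_vec_space n "TYPE(complex)" .
  define b where "b = basis_completion v"
  from basis_completion[OF v v0, folded b_def]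
  have dist_b: "distinct b" and indep: "\<not> lin_dep (set b)" and b: "set b \<subseteq> carrier_vec n"
    and hdb: "hd b = v" and len_b: "length b = n" by auto
  have n: "n \<noteq> 0" using v v0 by (cases n) auto
  then obtain vs where bv: "b = v # vs" using hdb len_b by (cases b) auto
  define ws where "ws = gram_schmidt n b"
  from gram_schmidt_result[OF b dist_b indep refl, folded ws_def]
  have ws: "set ws \<subseteq> carrier_vec n" "corthogonal ws" "length ws = n"
    by (auto simp: len_b)
  have hdws: "hd ws = v" unfolding ws_def using gram_schmidt_hd[OF v, of vs, folded bv] .
  have wsc: "ws ! j \<in> carrier_vec n" if "j < n" for j using ws that by auto
  define N where "N = (\<lambda>j. complex_of_real (sqrt (Re ((ws ! j) \<bullet>c (ws ! j)))))"
  have ip: "(ws ! i) \<bullet>c (ws ! j) = (\<Sum>k<n. vec_index (ws ! i) k * cnj (vec_index (ws ! j) k))"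
    if "i < n" "j < n" for i j
    using wsc[OF that(1)] wsc[OF that(2)] by (auto simp: scalar_prod_def atLeast0LessThan)
  have orth: "((ws ! i) \<bullet>c (ws ! j) = 0) = (i \<noteq> j)" if "i < n" "j < n" for i j
    using ws that by (simp add: corthogonal_def)
  have sq: "(ws ! j) \<bullet>c (ws ! j) = complex_of_real (Re ((ws ! j) \<bullet>c (ws ! j)))"
    and pos: "0 < Re ((ws ! j) \<bullet>c (ws ! j))" if "j < n" for j
  proof -
    have *: "(ws ! j) \<bullet>c (ws ! j) = complex_of_real (\<Sum>k<n. (cmod (vec_index (ws ! j) k))\<^sup>2)"
      unfolding ip[OF that that] by (simp add: complex_norm_square[symmetric])
    then show "(ws ! j) \<bullet>c (ws ! j) = complex_of_real (Re ((ws ! j) \<bullet>c (ws ! j)))" by simp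
    have "(ws ! j) \<bullet>c (ws ! j) \<noteq> 0" using orth[OF that that] by simp
    then show "0 < Re ((ws ! j) \<bullet>c (ws ! j))"
      unfolding * by (simp add: less_le sum_nonneg del: of_real_sum)
  qed
  define W where "W = Matrix.mat n n (\<lambda>(i, j). vec_index (ws ! j) i / N j)"
  have W: "W \<in> carrier_mat n n" by (simp add: W_def)
  note W' = mat_adjoint_carrier[OF W]
  have W'W: "mat_adjoint W * W = 1\<^sub>m n"
  proof (rule eq_matI)
    fix i j assume "i < dim_row (1\<^sub>m n :: complex mat)" "j < dim_col (1\<^sub>m n :: complex mat)"
    then have ij: "i < n" "j < n" by auto
    have "(mat_adjoint W * W) $$ (i, j) = (\<Sum>k<n. vec_index (ws ! j) k * cnj (vec_index (ws ! i) k) / (N i * N j))"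
    proof -
      have Wi: "W $$ (k, l) = vec_index (ws ! l) k / N l" if "k < n" "l < n" for k l
        using that by (simp add: W_def)
      have "cnj (N l) = N l" for l by (simp add: N_def)
      then show ?thesis
        unfolding index_mult_mat_sum[OF W' W ij] using ij
        by (intro sum.cong) (auto simp: mat_adjoint_index[OF W] Wi mult.commute)
    qed
    also have "\<dots> = ((ws ! j) \<bullet>c (ws ! i)) / (N i * N j)"
      using ij by (simp add: ip sum_divide_distrib)
    also have "\<dots> = 1\<^sub>m n $$ (i, j)"
    proof (cases "i = j")
      case True
      have "N i * N i = (ws ! i) \<bullet>c (ws ! i)"
        using pos[OF ij(1)] by (subst sq[OF ij(1)]) (simp add: N_def flip: of_real_mult)
      moreover have "(ws ! i) \<bullet>c (ws ! i) \<noteq> 0" using orth[OF ij(1) ij(1)] by simp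
      ultimately show ?thesis using True ij by simp
    next
      case False
      then show ?thesis using orth[OF ij(2) ij(1)] ij by simp
    qed
    finally show "(mat_adjoint W * W) $$ (i, j) = 1\<^sub>m n $$ (i, j)" .
  qed (use W W' in auto)
  moreover have "W * mat_adjoint W = 1\<^sub>m n"
    by (rule mat_mult_left_right_inverse[OF W' W W'W])
  moreover have "col W 0 = (1 / N 0) \<cdot>\<^sub>v v"
  proof -
    have "ws ! 0 = v" using hdws ws n by (metis hd_conv_nth length_0_conv)
    then show ?thesis using n v by (intro eq_vecI) (auto simp: W_def)
  qed
  ultimately show ?thesis using that W by blast
qed

lemma eigenvector_exists:
  fixes A :: "complex mat"
  assumes A: "A \<in> carrier_mat n n" and n: "n \<noteq> 0"
  obtains v e where "v \<in> carrier_vec n" "v \<noteq> 0\<^sub>v n" "A *\<^sub>v v = e \<cdot>\<^sub>v v"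
proof -
  have "\<not> constant (poly (char_poly A))"
    using degree_monic_char_poly[OF A] n by (simp add: constant_degree)
  then obtain e where "poly (char_poly A) e = 0" using Fundamental_Theorem_Algebra.fundamental_theorem_of_algebra by blast
  then have "eigenvalue A e" using eigenvalue_root_char_poly[OF A] by simp
  then show ?thesis using that A by (auto simp: eigenvalue_def eigenvector_def)
qed

text \<open>Induction on the size. In an orthonormal basis that starts with an eigenvector the
  matrix is block diagonal, with the eigenvalue and a smaller non-negative block; the root is taken
  blockwise and conjugated back.\<close>

lemma psd_sqrt_exists: "psd n A \<Longrightarrow> \<exists>B. psd n B \<and> B * B = A"
proof (induction n arbitrary: A)
  case 0
  then show ?case by (intro exI[of _ A]) (auto simp: psd_def)
next
  case (Suc n)
  note A = psdD(1)[OF Suc.prems]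
  obtain v e where v: "v \<in> carrier_vec (Suc n)" "v \<noteq> 0\<^sub>v (Suc n)" "A *\<^sub>v v = e \<cdot>\<^sub>v v"
    using eigenvector_exists[OF A] by blast
  obtain W c where W: "W \<in> carrier_mat (Suc n) (Suc n)" "mat_adjoint W * W = 1\<^sub>m (Suc n)"
    "W * mat_adjoint W = 1\<^sub>m (Suc n)" "col W 0 = c \<cdot>\<^sub>v v"
    using unitary_completion[OF v(1,2)] by blast
  note W' = mat_adjoint_carrier[OF W(1)]
  define A' where "A' = mat_adjoint W * A * W"
  have A': "psd (Suc n) A'" unfolding A'_def by (rule psd_congruence[OF Suc.prems W(1)])
  note A'c = psdD(1)[OF A']
  have col0: "A' $$ (i, 0) = (if i = 0 then e else 0)" if "i < Suc n" for i
  proof -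
    have "A *\<^sub>v col W 0 = e \<cdot>\<^sub>v col W 0"
      using v A unfolding W(4) by (simp add: mult_mat_vec smult_smult_assoc mult.commute)
    then have "col (A * W) 0 = e \<cdot>\<^sub>v col W 0" using A W(1) by (metis carrier_matD(2) col_mult2 zero_less_Suc)
    then have AW: "(A * W) $$ (k, 0) = e * W $$ (k, 0)" if "k < Suc n" for k
      using that A W(1) arg_cong[of _ _ "\<lambda>u. vec_index u k"] by fastforce
    have "A' $$ (i, 0) = (mat_adjoint W * (A * W)) $$ (i, 0)"
      unfolding A'_def using assoc_mult_mat[OF W' A W(1)] by simp
    also have "\<dots> = (\<Sum>k<Suc n. mat_adjoint W $$ (i, k) * (e * W $$ (k, 0)))"
      using that by (simp only: index_mult_mat_sum[OF W' mult_carrier_mat[OF A W(1)]] zero_less_Suc)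
        (intro sum.cong, auto simp: AW simp del: index_mult_mat(1))
    also have "\<dots> = e * (mat_adjoint W * W) $$ (i, 0)"
      using that by (simp only: index_mult_mat_sum[OF W' W(1)] zero_less_Suc sum_distrib_left mult_ac)
    finally show ?thesis using that by (simp add: W(2))
  qed
  note herm = psdD(2)[OF A']
  \<comment> \<open>The matrix is Hermitian, so its first row is determined by the first
    column.\<close>
  have row0: "A' $$ (0, i) = (if i = 0 then e else 0)" if "i < Suc n" for i
    using col0[OF that] herm[of 0 i] herm[of 0 0] col0[of 0] that by auto
  have e: "e = complex_of_real (Re e)" "0 \<le> Re e"
  proof -
    have "e = cnj e" using herm[of 0 0] col0[of 0] by simp
    then show "e = complex_of_real (Re e)" by (metis Reals_cnj_iff of_real_Re)
    have "quad_form (Suc n) A' (\<lambda>i. if i = 0 then 1 else 0) = e"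
      unfolding quad_form_def by (simp add: sum.lessThan_Suc_shift col0 del: sum.lessThan_Suc)
    then show "0 \<le> Re e" using psdD(3)[OF A'] by metis
  qed
  define A3 where "A3 = Matrix.mat n n (\<lambda>(i, j). A' $$ (Suc i, Suc j))"
  have "psd n A3"
    unfolding psd_def
  proof (intro conjI allI impI)
    fix x
    have "quad_form n A3 x = quad_form (Suc n) A' (\<lambda>i. case i of 0 \<Rightarrow> 0 | Suc k \<Rightarrow> x k)"
      unfolding quad_form_def by (simp add: sum.lessThan_Suc_shift A3_def del: sum.lessThan_Suc)
    then show "0 \<le> Re (quad_form n A3 x)" by (simp only: psdD(3)[OF A'])
  next
    fix i j assume "i < n" "j < n"
    then show "A3 $$ (i, j) = cnj (A3 $$ (j, i))" using herm[of "Suc i" "Suc j"] by (simp add: A3_def)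
  qed (simp add: A3_def)
  from Suc.IH[OF this] obtain B3 where B3: "psd n B3" "B3 * B3 = A3" by blast
  note B3c = psdD(1)[OF B3(1)]
  define B' where "B' = Matrix.mat (Suc n) (Suc n) (\<lambda>(i, j).
     case (i, j) of (0, 0) \<Rightarrow> complex_of_real (sqrt (Re e)) | (Suc k, Suc l) \<Rightarrow> B3 $$ (k, l) | _ \<Rightarrow> 0)"
  have B'c: "B' \<in> carrier_mat (Suc n) (Suc n)" by (simp add: B'_def)
  have B'i: "B' $$ (0, 0) = complex_of_real (sqrt (Re e))" "k < n \<Longrightarrow> B' $$ (0, Suc k) = 0"
    "k < n \<Longrightarrow> B' $$ (Suc k, 0) = 0" "k < n \<Longrightarrow> l < n \<Longrightarrow> B' $$ (Suc k, Suc l) = B3 $$ (k, l)" for k l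
    by (simp_all add: B'_def)
  have "psd (Suc n) B'"
    unfolding psd_def
  proof (intro conjI allI impI)
    fix x
    have "quad_form (Suc n) B' x = cnj (x 0) * (of_real (sqrt (Re e)) * x 0) + quad_form n B3 (\<lambda>i. x (Suc i))"
      unfolding quad_form_def by (simp add: sum.lessThan_Suc_shift B'i del: sum.lessThan_Suc)
    moreover have "Re (cnj (x 0) * (of_real (sqrt (Re e)) * x 0)) = sqrt (Re e) * (cmod (x 0))\<^sup>2"
      by (simp only: cmod_power2) (simp add: power2_eq_square algebra_simps)
    ultimately show "0 \<le> Re (quad_form (Suc n) B' x)"
      using psdD(3)[OF B3(1)] e(2) by simp
  next
    fix i j assume "i < Suc n" "j < Suc n"
    then show "B' $$ (i, j) = cnj (B' $$ (j, i))"
      using psdD(2)[OF B3(1), of "i - 1" "j - 1"] by (cases i; cases j) (simp_all add: B'i)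
  qed (rule B'c)
  have "B' * B' = A'"
  proof (rule eq_matI)
    fix i j assume "i < dim_row A'" "j < dim_col A'"
    then have ij: "i < Suc n" "j < Suc n" using A'c by auto
    have "(B' * B') $$ (i, j) = B' $$ (i, 0) * B' $$ (0, j) + (\<Sum>l<n. B' $$ (i, Suc l) * B' $$ (Suc l, j))"
      using ij by (simp only: index_mult_mat_sum[OF B'c B'c] sum.lessThan_Suc_shift)
    also have "\<dots> = A' $$ (i, j)"
    proof (cases i)
      case 0
      then show ?thesis
        using ij e by (cases j) (auto simp: B'i row0 simp flip: of_real_mult)
    next
      case (Suc k)
      then have k: "k < n" using ij by simp
      show ?thesis
      proof (cases j)
        case 0
        then show ?thesis using Suc k col0[OF ij(1)] by (simp add: B'i)
      next
        case (Suc l)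
        then have "(\<Sum>m<n. B3 $$ (k, m) * B3 $$ (m, l)) = A3 $$ (k, l)"
          using k ij index_mult_mat_sum[OF B3c B3c, of k l] B3(2) by simp
        then show ?thesis using \<open>i = Suc k\<close> Suc k ij by (simp add: B'i A3_def)
      qed
    qed
    finally show "(B' * B') $$ (i, j) = A' $$ (i, j)" .
  qed (use A'c B'c in auto)
  \<comment> \<open>The double adjoint is W; written this way, \<open>psd_congruence\<close> applies
    with \<open>mat_adjoint W\<close>.\<close>
  define B where "B = mat_adjoint (mat_adjoint W) * B' * mat_adjoint W"
  have "psd (Suc n) B" unfolding B_def by (rule psd_congruence[OF \<open>psd (Suc n) B'\<close> W'])
  moreover have "B * B = A"
  proof -
    have B: "B = W * B' * mat_adjoint W" by (simp add: B_def mat_adjoint_adjoint[OF W(1)])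
    let ?n = "Suc n" and ?V = "mat_adjoint W"
    note as = assoc_mult_mat[of _ ?n ?n _ ?n _ ?n] and mc = mult_carrier_mat[of _ ?n ?n _ ?n]
    have "B * B = W * B' * (?V * W) * (B' * ?V)"
      unfolding B using W(1) W' B'c by (simp add: as mc)
    also have "\<dots> = W * (B' * B') * ?V"
      unfolding W(2) using W(1) W' B'c by (simp add: as mc)
    also have "B' * B' = ?V * A * W" using \<open>B' * B' = A'\<close> by (simp add: A'_def)
    also have "W * (?V * A * W) * ?V = (W * ?V) * A * (W * ?V)"
      using W(1) W' A by (simp add: as mc)
    finally show ?thesis using A by (simp add: W(3))
  qed
  ultimately show ?case by blast
qed

text \<open>With y = A x, S = |y|^2 and q the form at y, the form at x - t y is -2 t S + t^2 q,
  which is negative for small t > 0 unless y = 0.\<close>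

lemma psd_form_0_imp:
  assumes A: "psd n A" and 0: "quad_form n A x = 0" and i: "i < n"
  shows "(\<Sum>j<n. A $$ (i, j) * x j) = 0"
proof (rule ccontr)
  define y where "y = (\<lambda>i. \<Sum>j<n. A $$ (i, j) * x j)"
  assume "(\<Sum>j<n. A $$ (i, j) * x j) \<noteq> 0"
  then have "y i \<noteq> 0" by (simp add: y_def)
  define S where "S = (\<Sum>k<n. (cmod (y k))\<^sup>2)"
  have "(cmod (y i))\<^sup>2 \<le> S" unfolding S_def using i by (intro member_le_sum) auto
  with \<open>y i \<noteq> 0\<close> have S: "S > 0" by (auto intro: less_le_trans[of 0 "(cmod (y i))\<^sup>2"])
  define q where "q = Re (quad_form n A y)"
  have q: "0 \<le> q" unfolding q_def by (rule psdD(3)[OF A])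
  have y: "(\<Sum>j<n. A $$ (i, j) * x j) = y i" for i by (simp add: y_def)
  have 1: "(\<Sum>i<n. cnj (y i) * (\<Sum>j<n. A $$ (i, j) * x j)) = of_real S"
    unfolding y S_def of_real_sum by (intro sum.cong) (simp_all only: complex_norm_square mult.commute)
  have 2: "(\<Sum>i<n. cnj (x i) * (\<Sum>j<n. A $$ (i, j) * y j)) = of_real S"
  proof -
    have "(\<Sum>i<n. cnj (x i) * (\<Sum>j<n. A $$ (i, j) * y j)) = (\<Sum>j<n. \<Sum>i<n. y j * (cnj (x i) * A $$ (i, j)))"
      unfolding sum_distrib_left by (subst sum.swap) (simp add: mult_ac)
    also have "\<dots> = (\<Sum>j<n. y j * cnj (y j))"
    proof (rule sum.cong[OF refl])
      fix j assume "j \<in> {..<n}"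
      then have "cnj (y j) = (\<Sum>i<n. cnj (x i) * A $$ (i, j))"
        unfolding y_def cnj_sum using psdD(2)[OF A, of _ j]
        by (intro sum.cong) (auto simp: mult.commute)
      then show "(\<Sum>i<n. y j * (cnj (x i) * A $$ (i, j))) = y j * cnj (y j)"
        by (simp add: sum_distrib_left)
    qed
    also have "\<dots> = of_real S" by (simp add: S_def complex_norm_square[symmetric])
    finally show ?thesis .
  qed
  have "0 \<le> - 2 * t * S + t\<^sup>2 * q" for t :: real
  proof -
    have "quad_form n A (\<lambda>k. x k - of_real t * y k)
        = quad_form n A x - of_real t * (\<Sum>i<n. cnj (x i) * (\<Sum>j<n. A $$ (i, j) * y j))
          - of_real t * (\<Sum>i<n. cnj (y i) * (\<Sum>j<n. A $$ (i, j) * x j)) + of_real (t\<^sup>2) * quad_form n A y"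
      unfolding quad_form_def
      by (simp add: right_diff_distrib left_diff_distrib sum_subtractf sum_distrib_left power2_eq_square mult_ac)
    then have "Re (quad_form n A (\<lambda>k. x k - of_real t * y k)) = - 2 * t * S + t\<^sup>2 * q"
      unfolding 0 1 2 by (simp add: q_def flip: of_real_mult)
    then show ?thesis using psdD(3)[OF A] by metis
  qed
  \<comment> \<open>The denominator is q + 1 because q may be 0.\<close>
  from this[of "S / (q + 1)"] have "0 \<le> - 2 * S * S / (q + 1) + S\<^sup>2 * q / (q + 1)\<^sup>2"
    by (simp add: power_divide)
  also have "\<dots> \<le> - 2 * S\<^sup>2 / (q + 1) + S\<^sup>2 / (q + 1)"
  proof -
    have "S\<^sup>2 * q / (q + 1)\<^sup>2 \<le> S\<^sup>2 / (q + 1)"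
      using q S by (simp add: divide_simps power2_eq_square)
    then show ?thesis by (simp add: power2_eq_square)
  qed
  also have "\<dots> = - (S\<^sup>2 / (q + 1))" by simp
  also have "\<dots> < 0" using S q by simp
  finally show False by simp
qed

text \<open>Let D = B - C. Then B D + D C = B^2 - C^2 = 0, so the traces of D B D and D C D add up
  to 0. They are sums of non-negative forms at the columns of D, so each form vanishes, and
  \<open>psd_form_0_imp\<close> gives B D = C D = 0. Hence D^2 = 0, and D = 0 because D is
  Hermitian.\<close>

lemma psd_sqrt_unique:
  assumes B: "psd n B" and C: "psd n C" and eq: "B * B = C * C"
  shows "B = C"
proof -
  note Bc = psdD(1)[OF B] and Cc = psdD(1)[OF C]
  define D where "D = (\<lambda>i j. B $$ (i, j) - C $$ (i, j))"
  have herm: "cnj (D j i) = D i j" if "i < n" "j < n" for i j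
    unfolding D_def using psdD(2)[OF B that] psdD(2)[OF C that] by simp
  have form: "quad_form n A (\<lambda>i. D i k) = (\<Sum>i<n. \<Sum>j<n. D k i * A $$ (i, j) * D j k)" if "k < n" for A k
    unfolding quad_form_def using that herm by (simp add: sum_distrib_left mult.assoc)
  have BD: "(\<Sum>j<n. B $$ (i, j) * D j k) + (\<Sum>j<n. D i j * C $$ (j, k)) = 0" if "i < n" "k < n" for i k
  proof -
    have "(\<Sum>j<n. B $$ (i, j) * D j k) + (\<Sum>j<n. D i j * C $$ (j, k)) = (B * B) $$ (i, k) - (C * C) $$ (i, k)"
      unfolding index_mult_mat_sum[OF Bc Bc that] index_mult_mat_sum[OF Cc Cc that]
      by (simp add: D_def algebra_simps sum_subtractf)
    then show ?thesis by (simp add: eq)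
  qed
  have "(\<Sum>k<n. quad_form n B (\<lambda>i. D i k)) + (\<Sum>k<n. quad_form n C (\<lambda>i. D i k)) = 0"
  proof -
    have "(\<Sum>k<n. quad_form n B (\<lambda>i. D i k)) = (\<Sum>k<n. \<Sum>i<n. D k i * (\<Sum>j<n. B $$ (i, j) * D j k))"
      using form by (simp add: sum_distrib_left mult.assoc)
    moreover have "(\<Sum>k<n. quad_form n C (\<lambda>i. D i k)) = (\<Sum>j<n. \<Sum>k<n. D j k * (\<Sum>i<n. D k i * C $$ (i, j)))"
    proof -
      have "(\<Sum>k<n. quad_form n C (\<lambda>i. D i k)) = (\<Sum>k<n. \<Sum>j<n. D j k * (\<Sum>i<n. D k i * C $$ (i, j)))"
      proof (rule sum.cong[OF refl])
        fix k assume "k \<in> {..<n}"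
        then show "quad_form n C (\<lambda>i. D i k) = (\<Sum>j<n. D j k * (\<Sum>i<n. D k i * C $$ (i, j)))"
          by (subst form, simp, subst sum.swap) (simp add: sum_distrib_left mult_ac)
      qed
      then show ?thesis by (subst sum.swap)
    qed
    ultimately have "(\<Sum>k<n. quad_form n B (\<lambda>i. D i k)) + (\<Sum>k<n. quad_form n C (\<lambda>i. D i k))
      = (\<Sum>k<n. \<Sum>i<n. D k i * ((\<Sum>j<n. B $$ (i, j) * D j k) + (\<Sum>j<n. D i j * C $$ (j, k))))"
      by (simp add: distrib_left sum.distrib)
    also have "\<dots> = 0" using BD by simp
    finally show ?thesis .
  qed
  then have "Re ((\<Sum>k<n. quad_form n B (\<lambda>i. D i k)) + (\<Sum>k<n. quad_form n C (\<lambda>i. D i k))) = 0"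
    by (simp only: zero_complex.sel)
  then have "(\<Sum>k<n. Re (quad_form n B (\<lambda>i. D i k))) + (\<Sum>k<n. Re (quad_form n C (\<lambda>i. D i k))) = 0"
    by (simp only: plus_complex.sel Re_sum)
  moreover have "0 \<le> (\<Sum>k<n. Re (quad_form n B (\<lambda>i. D i k)))" "0 \<le> (\<Sum>k<n. Re (quad_form n C (\<lambda>i. D i k)))"
    using psdD(3)[OF B] psdD(3)[OF C] by (auto intro: sum_nonneg)
  ultimately have "(\<Sum>k<n. Re (quad_form n B (\<lambda>i. D i k))) = 0" "(\<Sum>k<n. Re (quad_form n C (\<lambda>i. D i k))) = 0"
    by linarith+
  then have Re0: "Re (quad_form n B (\<lambda>i. D i k)) = 0" "Re (quad_form n C (\<lambda>i. D i k)) = 0" if "k < n" for k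
    using that psdD(3)[OF B] psdD(3)[OF C] by (auto simp: sum_nonneg_eq_0_iff)
  have Im0: "Im (quad_form n A x) = 0" if "psd n A" for A x
  proof -
    have "cnj (quad_form n A x) = (\<Sum>i<n. \<Sum>j<n. cnj (x j) * (A $$ (j, i) * x i))"
      unfolding quad_form_def cnj_sum complex_cnj_mult sum_distrib_left complex_cnj_cnj
    proof (intro sum.cong refl)
      fix i j assume "i \<in> {..<n}" "j \<in> {..<n}"
      then have "cnj (A $$ (i, j)) = A $$ (j, i)" using psdD(2)[OF that, of j i] by auto
      then show "x i * (cnj (A $$ (i, j)) * cnj (x j)) = cnj (x j) * (A $$ (j, i) * x i)"
        by (simp only: mult_ac)
    qed
    also have "\<dots> = quad_form n A x"
      unfolding quad_form_def sum_distrib_left by (rule sum.swap)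
    finally show ?thesis by (simp add: complex_eq_iff)
  qed
  have "quad_form n B (\<lambda>i. D i k) = 0" "quad_form n C (\<lambda>i. D i k) = 0" if "k < n" for k
    using Re0[OF that] Im0[OF B] Im0[OF C] by (auto simp: complex_eq_iff)
  then have "(\<Sum>j<n. B $$ (i, j) * D j k) = 0" "(\<Sum>j<n. C $$ (i, j) * D j k) = 0" if "i < n" "k < n" for i k
    using that psd_form_0_imp[OF B] psd_form_0_imp[OF C] by blast+
  then have DD: "(\<Sum>j<n. D i j * D j k) = 0" if "i < n" "k < n" for i k
  proof -
    have "D i j * z = B $$ (i, j) * z - C $$ (i, j) * z" for i j z
      by (simp add: D_def left_diff_distrib)
    then show ?thesis using that \<open>\<And>i k. i < n \<Longrightarrow> k < n \<Longrightarrow> (\<Sum>j<n. B $$ (i, j) * D j k) = 0\<close>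
        \<open>\<And>i k. i < n \<Longrightarrow> k < n \<Longrightarrow> (\<Sum>j<n. C $$ (i, j) * D j k) = 0\<close>
      by (simp only: sum_subtractf) simp
  qed
  have "D j k = 0" if "j < n" "k < n" for j k
  proof -
    have "(\<Sum>j<n. D k j * D j k) = of_real (\<Sum>j<n. (cmod (D j k))\<^sup>2)"
      unfolding of_real_sum complex_norm_square
      using that herm by (intro sum.cong) (auto simp: mult.commute)
    then have "(\<Sum>j<n. (cmod (D j k))\<^sup>2) = 0" using DD[OF that(2,2)] by (metis of_real_eq_0_iff)
    then show ?thesis using that by (simp add: sum_nonneg_eq_0_iff)
  qed
  then show ?thesis using Bc Cc by (intro eq_matI) (auto simp: D_def)
qed

text \<open>Existence and uniqueness of the root give the \<open>THE\<close> in the definition its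
  meaning.\<close>

theorem mat_sqrt:
  assumes "nonneg_definite A" "A \<in> carrier_mat n n"
  shows "mat_sqrt A \<in> carrier_mat n n" "mat_sqrt A * mat_sqrt A = A"
proof -
  have "\<exists>!B. B \<in> carrier_mat (dim_row A) (dim_row A) \<and> nonneg_definite B \<and> B * B = A"
  proof -
    have "psd n A" using assms by (simp add: nonneg_definite_iff_psd)
    then obtain B where B: "psd n B" "B * B = A" using psd_sqrt_exists by blast
    show ?thesis
    proof (rule ex1I[of _ B])
      show "B \<in> carrier_mat (dim_row A) (dim_row A) \<and> nonneg_definite B \<and> B * B = A"
        using B psdD(1)[OF B(1)] assms(2) nonneg_definite_iff_psd[OF psdD(1)[OF B(1)]] by simp
    next
      fix C assume "C \<in> carrier_mat (dim_row A) (dim_row A) \<and> nonneg_definite C \<and> C * C = A"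
      then show "C = B"
        using assms(2) nonneg_definite_iff_psd[of C n] B psd_sqrt_unique[of n C B] by auto
    qed
  qed
  from theI'[OF this] show "mat_sqrt A \<in> carrier_mat n n" "mat_sqrt A * mat_sqrt A = A"
    using assms(2) unfolding mat_sqrt_def by auto
qed

section \<open>Moments of the semicircle law\<close>

definition semicircle_moment :: "real \<Rightarrow> real \<Rightarrow> nat \<Rightarrow> real" where
  "semicircle_moment \<alpha> \<beta> k = (\<integral>t. t ^ k \<partial>semicircle_law \<alpha> \<beta>)"

text \<open>Turns the moment into a gauge integral over the support, to which the fundamental
  theorem of calculus applies.\<close>

lemma semicircle_moment_eq:
  assumes \<beta>: "0 < \<beta>"
  shows "semicircle_moment \<alpha> \<beta> k = 1 / (2 * pi * \<beta>\<^sup>2) *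
    integral {\<alpha> - 2 * \<beta>..\<alpha> + 2 * \<beta>} (\<lambda>x. x ^ k * sqrt (4 * \<beta>\<^sup>2 - (x - \<alpha>)\<^sup>2))"
proof -
  let ?S = "{\<alpha> - 2 * \<beta>..\<alpha> + 2 * \<beta>}" and ?f = "\<lambda>x. x ^ k * sqrt (4 * \<beta>\<^sup>2 - (x - \<alpha>)\<^sup>2)"
  have nonneg: "0 \<le> semicircle_density \<alpha> \<beta> x" for x
  proof -
    have "(x - \<alpha>)\<^sup>2 \<le> (2 * \<beta>)\<^sup>2" if "\<alpha> - 2 * \<beta> \<le> x" "x \<le> \<alpha> + 2 * \<beta>"
      using that by (intro abs_le_square_iff[THEN iffD1]) auto
    then show ?thesis by (auto simp: semicircle_density_def power_mult_distrib)
  qed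
  have meas: "semicircle_density \<alpha> \<beta> \<in> borel_measurable borel"
    unfolding semicircle_density_def by measurable
  have "semicircle_moment \<alpha> \<beta> k = (\<integral>x. semicircle_density \<alpha> \<beta> x * x ^ k \<partial>lborel)"
    unfolding semicircle_moment_def semicircle_law_def
    using nonneg meas by (subst integral_density) auto
  also have "\<dots> = (\<integral>x. 1 / (2 * pi * \<beta>\<^sup>2) * (indicator ?S x * ?f x) \<partial>lborel)"
    by (intro Bochner_Integration.integral_cong) (auto simp: semicircle_density_def indicator_def)
  also have "\<dots> = 1 / (2 * pi * \<beta>\<^sup>2) * (LINT x:?S|lborel. ?f x)"
    by (subst integral_mult_right_zero) (simp add: set_lebesgue_integral_def)
  also have "(LINT x:?S|lborel. ?f x) = integral ?S ?f"
    by (intro set_borel_integral_eq_integral borel_integrable_atLeastAtMost' continuous_intros)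
  finally show ?thesis .
qed

text \<open>The integrand is the derivative of x^j q^(3/2) with q = 4 \<beta>^2 - (x - \<alpha>)^2,
  which vanishes at both ends. The exponent 3/2 makes the derivative a polynomial times sqrt q, that
  is, times the density up to a constant.\<close>

lemma semicircle_integral_deriv:
  fixes \<alpha> \<beta> :: real
  assumes \<beta>: "0 < \<beta>"
  shows "((\<lambda>x. (real j * x ^ (j - 1) * (4 * \<beta>\<^sup>2 - (x - \<alpha>)\<^sup>2) - 3 * (x - \<alpha>) * x ^ j)
      * sqrt (4 * \<beta>\<^sup>2 - (x - \<alpha>)\<^sup>2)) has_integral 0) {\<alpha> - 2 * \<beta>..\<alpha> + 2 * \<beta>}"
proof -
  define q where "q = (\<lambda>x. 4 * \<beta>\<^sup>2 - (x - \<alpha>)\<^sup>2)"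
  define F where "F = (\<lambda>x. x ^ j * (q x * sqrt (q x)))"
  define F' where "F' = (\<lambda>x. (real j * x ^ (j - 1) * q x - 3 * (x - \<alpha>) * x ^ j) * sqrt (q x))"
  have "(F' has_integral (F (\<alpha> + 2 * \<beta>) - F (\<alpha> - 2 * \<beta>))) {\<alpha> - 2 * \<beta>..\<alpha> + 2 * \<beta>}"
  \<comment> \<open>The square root of q is not differentiable at the end points; continuity
    suffices there.\<close>
  proof (rule fundamental_theorem_of_calculus_interior)
    show "continuous_on {\<alpha> - 2 * \<beta>..\<alpha> + 2 * \<beta>} F"
      unfolding F_def q_def by (intro continuous_intros)
    fix x assume "x \<in> {\<alpha> - 2 * \<beta><..<\<alpha> + 2 * \<beta>}"
    then have "\<bar>x - \<alpha>\<bar> < 2 * \<beta>" by auto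
    then have "(x - \<alpha>)\<^sup>2 < (2 * \<beta>)\<^sup>2" using power_strict_mono[of "\<bar>x - \<alpha>\<bar>" "2 * \<beta>" 2] by simp
    then have q: "0 < q x" by (simp add: q_def power_mult_distrib)
    have dq: "(q has_real_derivative - 2 * (x - \<alpha>)) (at x)"
      unfolding q_def by (auto intro!: derivative_eq_intros)
    have ds: "((\<lambda>x. sqrt (q x)) has_real_derivative - (x - \<alpha>) / sqrt (q x)) (at x)"
    proof -
      have "((\<lambda>x. sqrt (q x)) has_real_derivative inverse (sqrt (q x)) / 2 * (- 2 * (x - \<alpha>))) (at x)"
        by (rule DERIV_chain2[OF DERIV_real_sqrt[OF q] dq])
      moreover have "inverse (sqrt (q x)) / 2 * (- 2 * (x - \<alpha>)) = - (x - \<alpha>) / sqrt (q x)"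
      proof -
        have "inverse s / 2 * (- 2 * y) = - y / s" for s y :: real
          by (cases "s = 0") (simp_all add: field_simps)
        then show ?thesis .
      qed
      ultimately show ?thesis by (simp only:)
    qed
    have "((\<lambda>x. q x * sqrt (q x)) has_real_derivative - 3 * (x - \<alpha>) * sqrt (q x)) (at x)"
    proof (rule DERIV_cong[OF DERIV_mult[OF dq ds]])
      have "- (x - \<alpha>) / sqrt (q x) * q x = - (x - \<alpha>) * (q x / sqrt (q x))" by simp
      also have "q x / sqrt (q x) = sqrt (q x)" using q by (simp add: real_div_sqrt)
      finally show "- 2 * (x - \<alpha>) * sqrt (q x) + - (x - \<alpha>) / sqrt (q x) * q x = - 3 * (x - \<alpha>) * sqrt (q x)"
        by (simp add: algebra_simps)
    qed
    from DERIV_mult[OF DERIV_pow[of j x UNIV] this] have "(F has_real_derivative F' x) (at x)"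
      unfolding F_def F'_def by (simp add: algebra_simps)
    then show "(F has_vector_derivative F' x) (at x)"
      by (simp add: has_real_derivative_iff_has_vector_derivative)
  qed (use \<beta> in simp)
  moreover have "F (\<alpha> + 2 * \<beta>) = 0" "F (\<alpha> - 2 * \<beta>) = 0"
    by (simp_all add: F_def q_def power2_eq_square)
  ultimately show ?thesis by (simp add: F'_def q_def)
qed

text \<open>The cases j = 0 and j = k + 1 of \<open>semicircle_integral_deriv\<close>, expanded in
  powers of x.\<close>

lemma semicircle_moment_recursion:
  assumes \<beta>: "0 < \<beta>"
  shows "semicircle_moment \<alpha> \<beta> 1 = \<alpha> * semicircle_moment \<alpha> \<beta> 0"
    and "real (k + 4) * semicircle_moment \<alpha> \<beta> (k + 2) = real (2 * k + 5) * \<alpha> * semicircle_moment \<alpha> \<beta> (k + 1)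
       + real (k + 1) * (4 * \<beta>\<^sup>2 - \<alpha>\<^sup>2) * semicircle_moment \<alpha> \<beta> k"
proof -
  let ?S = "{\<alpha> - 2 * \<beta>..\<alpha> + 2 * \<beta>}"
  define g where "g = (\<lambda>k x. x ^ k * sqrt (4 * \<beta>\<^sup>2 - (x - \<alpha>)\<^sup>2))"
  define J where "J = (\<lambda>k. integral ?S (g k))"
  define K where "K = 1 / (2 * pi * \<beta>\<^sup>2)"
  have g: "(g k has_integral J k) ?S" for k
    unfolding J_def g_def
    by (intro integrable_integral integrable_continuous_interval continuous_intros)
  have m: "semicircle_moment \<alpha> \<beta> k = K * J k" for k
    by (simp add: semicircle_moment_eq[OF \<beta>] K_def J_def g_def)
  have "((\<lambda>x. 3 * \<alpha> * g 0 x - 3 * g 1 x) has_integral (3 * \<alpha> * J 0 - 3 * J 1)) ?S"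
    by (intro has_integral_diff has_integral_mult_right g)
  moreover have "((\<lambda>x. 3 * \<alpha> * g 0 x - 3 * g 1 x) has_integral 0) ?S"
    using semicircle_integral_deriv[OF \<beta>, of 0 \<alpha>]
    by (rule has_integral_eq[rotated]) (simp add: g_def algebra_simps)
  ultimately have "3 * \<alpha> * J 0 - 3 * J 1 = 0" by (rule has_integral_unique)
  then show "semicircle_moment \<alpha> \<beta> 1 = \<alpha> * semicircle_moment \<alpha> \<beta> 0" by (simp add: m)
  have "((\<lambda>x. real (k + 1) * (4 * \<beta>\<^sup>2 - \<alpha>\<^sup>2) * g k x + real (2 * k + 5) * \<alpha> * g (k + 1) x - real (k + 4) * g (k + 2) x)
     has_integral (real (k + 1) * (4 * \<beta>\<^sup>2 - \<alpha>\<^sup>2) * J k + real (2 * k + 5) * \<alpha> * J (k + 1) - real (k + 4) * J (k + 2))) ?S"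
    by (intro has_integral_diff has_integral_add has_integral_mult_right g)
  moreover have "((\<lambda>x. real (k + 1) * (4 * \<beta>\<^sup>2 - \<alpha>\<^sup>2) * g k x + real (2 * k + 5) * \<alpha> * g (k + 1) x - real (k + 4) * g (k + 2) x)
     has_integral 0) ?S"
    using semicircle_integral_deriv[OF \<beta>, of "k + 1" \<alpha>]
    by (rule has_integral_eq[rotated]) (simp add: g_def algebra_simps power2_eq_square)
  ultimately have "real (k + 1) * (4 * \<beta>\<^sup>2 - \<alpha>\<^sup>2) * J k + real (2 * k + 5) * \<alpha> * J (k + 1) - real (k + 4) * J (k + 2) = 0"
    by (rule has_integral_unique)
  then have "K * (real (k + 1) * (4 * \<beta>\<^sup>2 - \<alpha>\<^sup>2) * J k + real (2 * k + 5) * \<alpha> * J (k + 1) - real (k + 4) * J (k + 2)) = 0"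
    by simp
  then show "real (k + 4) * semicircle_moment \<alpha> \<beta> (k + 2) = real (2 * k + 5) * \<alpha> * semicircle_moment \<alpha> \<beta> (k + 1)
       + real (k + 1) * (4 * \<beta>\<^sup>2 - \<alpha>\<^sup>2) * semicircle_moment \<alpha> \<beta> k"
    unfolding m by (simp add: algebra_simps)
qed

text \<open>
  The recursion for the moments says that \<open>D = 1 - \<alpha> X - 2 \<beta>\<^sup>2 X\<^sup>2 M\<close> solves \<open>2 E D' = E' D\<close> with
  \<open>E = (1 - \<alpha> X)\<^sup>2 - 4 \<beta>\<^sup>2 X\<^sup>2\<close>, so that \<open>D\<^sup>2 = E\<close>.
\<close>
theorem semicircle_moment_series:
  fixes \<alpha> \<beta> :: real
  assumes \<beta>: "0 < \<beta>" and one: "semicircle_moment \<alpha> \<beta> 0 = 1"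
  defines "M \<equiv> Abs_fps (\<lambda>n. complex_of_real (semicircle_moment \<alpha> \<beta> n))"
  shows "fps_const (of_real (\<beta>\<^sup>2)) * (fps_X * M)\<^sup>2 + fps_const (of_real \<alpha>) * (fps_X * M) = M - 1"
proof -
  define X :: "complex fps" where "X = fps_X"
  define A where "A = fps_const (complex_of_real \<alpha>)"
  define B where "B = fps_const (complex_of_real (\<beta>\<^sup>2))"
  define k where "k = 4 * B - A\<^sup>2"
  have kc: "k = fps_const (of_real (4 * \<beta>\<^sup>2 - \<alpha>\<^sup>2))"
    by (simp add: k_def A_def B_def fps_const_power numeral_fps_const)
  define E where "E = 1 - 2 * A * X - k * X\<^sup>2"
  define D where "D = 1 - A * X - 2 * B * X\<^sup>2 * M"
  have dX: "fps_deriv X = 1" and dA: "fps_deriv A = 0" and dB: "fps_deriv B = 0" and dk: "fps_deriv k = 0"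
    by (simp_all add: X_def A_def B_def kc)
  \<comment> \<open>X M' multiplies the n-th coefficient by n, so the linear factors of the
    recursion become a first-order operator. The summand -2 and the degrees 0 and 1 account for the
    two initial moments.\<close>
  have ode: "X * fps_deriv M + 2 * M - 2 = A * X * (2 * (X * fps_deriv M) + 3 * M) + k * X\<^sup>2 * (X * fps_deriv M + M)"
  proof (rule fps_ext)
    fix n :: nat
    have nth: "fps_nth (X * fps_deriv M) j = of_nat j * fps_nth M j" for j
      by (cases j) (simp_all add: X_def)
    note rec = semicircle_moment_recursion[OF \<beta>, where \<alpha> = \<alpha>]
    consider "n = 0" | "n = 1" | j where "n = j + 2"
      by (metis One_nat_def add_2_eq_Suc' not0_implies_Suc)
    then show "fps_nth (X * fps_deriv M + 2 * M - 2) n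
      = fps_nth (A * X * (2 * (X * fps_deriv M) + 3 * M) + k * X\<^sup>2 * (X * fps_deriv M + M)) n"
    proof cases
      case 1
      then show ?thesis
        by (simp add: nth A_def X_def kc mult.assoc power2_eq_square M_def one fps_mult_nth_0 fps_numeral_nth)
    next
      case 2
      then show ?thesis using rec(1)
        by (simp add: nth A_def kc mult.assoc power2_eq_square fps_numeral_nth)
          (simp add: X_def M_def one fps_mult_nth_0 mult.assoc fps_numeral_nth)
    next
      case 3
      have l: "fps_nth (X * fps_deriv M + 2 * M - 2) n = complex_of_real (real (j + 4) * semicircle_moment \<alpha> \<beta> (j + 2))"
        unfolding 3 by (simp add: nth fps_numeral_nth) (simp add: M_def algebra_simps)
      have x1: "fps_nth (A * X * F) n = of_real \<alpha> * fps_nth F (j + 1)" for F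
        unfolding 3 by (simp add: A_def X_def mult.assoc)
      have x2: "fps_nth (k * X\<^sup>2 * F) n = of_real (4 * \<beta>\<^sup>2 - \<alpha>\<^sup>2) * fps_nth F j" for F
        unfolding 3 by (simp add: kc X_def mult.assoc power2_eq_square)
      have "fps_nth (A * X * (2 * (X * fps_deriv M) + 3 * M) + k * X\<^sup>2 * (X * fps_deriv M + M)) n
        = complex_of_real (real (2 * j + 5) * \<alpha> * semicircle_moment \<alpha> \<beta> (j + 1)
           + real (j + 1) * (4 * \<beta>\<^sup>2 - \<alpha>\<^sup>2) * semicircle_moment \<alpha> \<beta> j)"
        by (simp add: x1 x2 nth fps_numeral_nth) (simp add: M_def algebra_simps)
      then show ?thesis unfolding l rec(2)[of j] by simp
    qed
  qed
  have dE: "fps_deriv E = - 2 * A - 2 * k * X"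
    by (simp add: E_def dX dA dk power2_eq_square algebra_simps)
  have dD: "fps_deriv D = - A - 4 * B * X * M - 2 * B * X\<^sup>2 * fps_deriv M"
    by (simp add: D_def dX dA dB power2_eq_square algebra_simps)
  have "X * (2 * E * fps_deriv D - fps_deriv E * D)
     = - 4 * B * X\<^sup>2 * ((X * fps_deriv M + 2 * M - 2)
        - (A * X * (2 * (X * fps_deriv M) + 3 * M) + k * X\<^sup>2 * (X * fps_deriv M + M)))"
    unfolding dE dD unfolding E_def D_def k_def by (simp add: algebra_simps power2_eq_square)
  also have "\<dots> = 0" unfolding ode by simp
  finally have "2 * E * fps_deriv D = fps_deriv E * D" by (simp add: X_def)
  then have "fps_deriv (D\<^sup>2) * E = D\<^sup>2 * fps_deriv E"
    by (simp add: power2_eq_square algebra_simps)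
  moreover have E0: "fps_nth E 0 = 1" by (simp add: E_def X_def fps_mult_nth_0 power2_eq_square)
  \<comment> \<open>The differential equation says that D^2 / E has derivative 0; both series start
    with 1, hence D^2 = E.\<close>
  moreover have "fps_deriv (D\<^sup>2 * inverse E) = (fps_deriv (D\<^sup>2) * E - D\<^sup>2 * fps_deriv E) * (inverse E)\<^sup>2"
  proof -
    have 1: "fps_deriv (inverse E) = - fps_deriv E * (inverse E)\<^sup>2"
      using E0 by (simp add: fps_inverse_deriv)
    have "E * inverse E = 1" using E0 inverse_mult_eq_1'[of E] by simp
    then have 2: "F * inverse E = F * E * (inverse E)\<^sup>2" for F
      by (simp add: power2_eq_square mult.assoc)
    have "fps_deriv (D\<^sup>2 * inverse E) = D\<^sup>2 * fps_deriv (inverse E) + fps_deriv (D\<^sup>2) * inverse E"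
      by (simp only: fps_deriv_mult)
    also have "\<dots> = D\<^sup>2 * (- fps_deriv E * (inverse E)\<^sup>2) + fps_deriv (D\<^sup>2) * E * (inverse E)\<^sup>2"
      by (simp only: 1 2[of "fps_deriv (D\<^sup>2)"])
    also have "\<dots> = (fps_deriv (D\<^sup>2) * E - D\<^sup>2 * fps_deriv E) * (inverse E)\<^sup>2"
      by (simp only: left_diff_distrib) (simp add: mult.assoc)
    finally show ?thesis .
  qed
  ultimately have "fps_deriv (D\<^sup>2 * inverse E) = 0" by simp
  then have "D\<^sup>2 * inverse E = fps_const (fps_nth (D\<^sup>2 * inverse E) 0)"
    by (simp only: fps_deriv_eq_0_iff)
  also have "fps_nth (D\<^sup>2 * inverse E) 0 = 1"
    using E0 by (simp add: D_def X_def fps_mult_nth_0 power2_eq_square)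
  finally have "D\<^sup>2 = E"
    using E0 inverse_mult_eq_1[of E] by (metis fps_const_1_eq_1 mult.assoc mult.right_neutral mult_1 zero_neq_one)
  then have "4 * B * X\<^sup>2 * (B * (X * M)\<^sup>2 + A * (X * M) - (M - 1)) = 0"
    unfolding D_def E_def k_def by (simp add: algebra_simps power2_eq_square)
  moreover have "4 * B * X\<^sup>2 \<noteq> 0"
    using \<beta> by (simp add: B_def X_def numeral_fps_const)
  ultimately have "B * (X * M)\<^sup>2 + A * (X * M) - (M - 1) = 0" by (metis mult_eq_0_iff)
  then show ?thesis by (simp add: A_def B_def X_def)
qed

section \<open>The Cauchy transform\<close>

lemma upper_half_plane_dist:
  assumes "0 < Im z"
  shows "z - complex_of_real t \<noteq> 0" "cmod (1 / (z - of_real t)) \<le> 1 / Im z"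
proof -
  have "Im z \<le> cmod (z - of_real t)" using abs_Im_le_cmod[of "z - of_real t"] by simp
  then show "z - complex_of_real t \<noteq> 0" "cmod (1 / (z - of_real t)) \<le> 1 / Im z"
    using assms by (auto simp: norm_divide intro!: frac_le)
qed

text \<open>The difference quotient at w and z is the integral of -1 / ((w - t) (z - t)), which
  converges by dominated convergence along every sequence w -> z.\<close>

lemma cauchy_transform_holomorphic:
  assumes M: "prob_space \<mu>" and s: "sets \<mu> = sets borel"
  shows "cauchy_transform \<mu> holomorphic_on {z. 0 < Im z}"
  unfolding holomorphic_on_def
proof
  interpret prob_space \<mu> by fact
  note [measurable_cong] = s
  fix z assume "z \<in> {z. 0 < Im z}"
  then have z: "0 < Im z" by simp
  have int: "integrable \<mu> (\<lambda>t. 1 / (w - complex_of_real t))" if "0 < Im w" for w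
    by (rule integrable_const_bound[of _ "1 / Im w"])
      (use upper_half_plane_dist[OF that] in \<open>auto intro!: AE_I2\<close>)
  define D where "D = (\<integral>t. - (1 / (z - complex_of_real t)) * (1 / (z - complex_of_real t)) \<partial>\<mu>)"
  have "((\<lambda>w. (cauchy_transform \<mu> w - cauchy_transform \<mu> z) / (w - z)) \<longlongrightarrow> D) (at z)"
  proof (subst tendsto_at_iff_sequentially, intro allI impI)
    fix X assume X: "\<forall>i. X i \<in> UNIV - {z}" "X \<longlonglongrightarrow> z"
    have "\<forall>\<^sub>F i in sequentially. Im z / 2 < Im (X i)"
      using tendsto_Im[OF X(2)] z by (intro order_tendstoD(1)) auto
    then obtain N where N: "\<And>i. N \<le> i \<Longrightarrow> Im z / 2 < Im (X i)"
      unfolding eventually_sequentially by blast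
    \<comment> \<open>Dropping finitely many terms keeps the imaginary parts above Im z / 2, so one
      dominating constant serves all indices.\<close>
    define Y where "Y = (\<lambda>i. X (i + N))"
    have Y: "Im z / 2 < Im (Y i)" "0 < Im (Y i)" "Y i \<noteq> z" for i
      using N[of "i + N"] z X(1) by (auto simp: Y_def)
    have Yl: "Y \<longlonglongrightarrow> z" unfolding Y_def using X(2) by (rule LIMSEQ_ignore_initial_segment)
    have "(\<lambda>i. \<integral>t. - (1 / (Y i - complex_of_real t)) * (1 / (z - complex_of_real t)) \<partial>\<mu>) \<longlonglongrightarrow> D"
      unfolding D_def
    proof (rule integral_dominated_convergence[where w = "\<lambda>t. 2 / Im z * (1 / Im z)"])
      show "AE t in \<mu>. (\<lambda>i. - (1 / (Y i - complex_of_real t)) * (1 / (z - complex_of_real t)))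
          \<longlonglongrightarrow> - (1 / (z - complex_of_real t)) * (1 / (z - complex_of_real t))"
        using upper_half_plane_dist(1)[OF z] by (intro AE_I2 tendsto_intros Yl) auto
      show "AE t in \<mu>. norm (- (1 / (Y i - complex_of_real t)) * (1 / (z - complex_of_real t)))
          \<le> 2 / Im z * (1 / Im z)" for i
      proof (rule AE_I2)
        fix t
        have "1 / Im (Y i) \<le> 2 / Im z" using Y(1)[of i] z by (simp add: field_simps)
        then have "cmod (1 / (Y i - complex_of_real t)) \<le> 2 / Im z"
          using upper_half_plane_dist(2)[OF Y(2)[of i], of t] by linarith
        then show "norm (- (1 / (Y i - complex_of_real t)) * (1 / (z - complex_of_real t)))
          \<le> 2 / Im z * (1 / Im z)"
          unfolding norm_mult norm_minus_cancel
          using upper_half_plane_dist(2)[OF z, of t] z by (intro mult_mono) auto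
      qed
    qed (auto simp: s)
    moreover have "(\<integral>t. - (1 / (Y i - complex_of_real t)) * (1 / (z - complex_of_real t)) \<partial>\<mu>)
        = (cauchy_transform \<mu> (Y i) - cauchy_transform \<mu> z) / (Y i - z)" for i
    proof -
      have "cauchy_transform \<mu> (Y i) - cauchy_transform \<mu> z
          = (\<integral>t. 1 / (Y i - complex_of_real t) - 1 / (z - complex_of_real t) \<partial>\<mu>)"
        unfolding cauchy_transform_def using int[OF Y(2)] int[OF z] by simp
      also have "\<dots> = (\<integral>t. (Y i - z) * (- (1 / (Y i - complex_of_real t)) * (1 / (z - complex_of_real t))) \<partial>\<mu>)"
      proof (rule Bochner_Integration.integral_cong[OF refl])
        fix t
        have "1 / a - 1 / b = (a - b) * (- (1 / a) * (1 / b))" if "a \<noteq> 0" "b \<noteq> 0" for a b :: complex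
          using that by (simp add: field_simps)
        from this[OF upper_half_plane_dist(1)[OF Y(2)[of i], of t] upper_half_plane_dist(1)[OF z, of t]]
        show "1 / (Y i - complex_of_real t) - 1 / (z - complex_of_real t)
          = (Y i - z) * (- (1 / (Y i - complex_of_real t)) * (1 / (z - complex_of_real t)))" by simp
      qed
      also have "\<dots> = (Y i - z) * (\<integral>t. - (1 / (Y i - complex_of_real t)) * (1 / (z - complex_of_real t)) \<partial>\<mu>)"
        by (rule integral_mult_right_zero)
      finally show ?thesis using Y(3)[of i] by (metis nonzero_mult_div_cancel_left right_minus_eq)
    qed
    ultimately have "(\<lambda>i. (cauchy_transform \<mu> (Y i) - cauchy_transform \<mu> z) / (Y i - z)) \<longlonglongrightarrow> D" by simp
    then show "((\<lambda>w. (cauchy_transform \<mu> w - cauchy_transform \<mu> z) / (w - z)) \<circ> X) \<longlonglongrightarrow> D"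
      unfolding Y_def o_def by (rule LIMSEQ_offset)
  qed
  then show "cauchy_transform \<mu> field_differentiable at z within {z. 0 < Im z}"
    unfolding field_differentiable_def
    by (metis DERIV_def field_differentiable_at_within field_differentiable_def has_field_derivative_iff)
qed

text \<open>The geometric expansion of z / (z - t) is integrated term by term; |t / z| is at most q
  = R / |z| < 1 almost everywhere.\<close>

lemma cauchy_transform_series:
  assumes M: "prob_space \<mu>" and s: "sets \<mu> = sets borel" and R: "AE t in \<mu>. \<bar>t\<bar> \<le> R" and R0: "0 < R"
    and z: "R < cmod z"
  shows "(\<lambda>n. complex_of_real (\<integral>t. t ^ n \<partial>\<mu>) * (1 / z) ^ n) sums (z * cauchy_transform \<mu> z)"
proof -
  interpret prob_space \<mu> by fact
  note [measurable_cong] = s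
  have z0: "z \<noteq> 0" using z R0 by auto
  define q where "q = R / cmod z"
  have q: "0 \<le> q" "q < 1" using z R0 by (auto simp: q_def divide_less_eq_1)
  have bound: "AE t in \<mu>. norm ((complex_of_real t / z) ^ n) \<le> q ^ n" for n
    using R
  proof eventually_elim
    case (elim t)
    then show ?case
      unfolding norm_power using R0 z by (intro power_mono) (auto simp: q_def norm_divide divide_right_mono)
  qed
  have int: "integrable \<mu> (\<lambda>t. (complex_of_real t / z) ^ n)" for n
    by (rule integrable_const_bound[OF bound]) measurable
  have moment: "(\<integral>t. (complex_of_real t / z) ^ n \<partial>\<mu>) = complex_of_real (\<integral>t. t ^ n \<partial>\<mu>) * (1 / z) ^ n" for n
    by (simp add: power_divide integral_divide_zero flip: of_real_power)
  have "(\<lambda>n. \<integral>t. (complex_of_real t / z) ^ n \<partial>\<mu>) sums (\<integral>t. (\<Sum>n. (complex_of_real t / z) ^ n) \<partial>\<mu>)"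
  proof (rule sums_integral)
    show "AE t in \<mu>. summable (\<lambda>n. norm ((complex_of_real t / z) ^ n))"
      using R
    proof eventually_elim
      case (elim t)
      then show ?case
        using z R0 by (simp add: norm_power norm_divide summable_geometric divide_less_eq_1)
    qed
    have "(\<integral>t. norm ((complex_of_real t / z) ^ n) \<partial>\<mu>) \<le> q ^ n" for n
    proof -
      have "(\<integral>t. norm ((complex_of_real t / z) ^ n) \<partial>\<mu>) \<le> (\<integral>t. q ^ n \<partial>\<mu>)"
        using bound[of n] int[of n] by (intro integral_mono_AE) auto
      then show ?thesis by (simp add: prob_space)
    qed
    then show "summable (\<lambda>n. \<integral>t. norm ((complex_of_real t / z) ^ n) \<partial>\<mu>)"
      using q by (intro summable_comparison_test[OF _ summable_geometric[of q]]) auto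
  qed (rule int)
  also have "(\<integral>t. (\<Sum>n. (complex_of_real t / z) ^ n) \<partial>\<mu>) = (\<integral>t. z * (1 / (z - complex_of_real t)) \<partial>\<mu>)"
  proof (rule integral_cong_AE)
    show "AE t in \<mu>. (\<Sum>n. (complex_of_real t / z) ^ n) = z * (1 / (z - complex_of_real t))"
      using R
    proof eventually_elim
      case (elim t)
      then have "norm (complex_of_real t / z) < 1" using z R0 by (simp add: norm_divide divide_less_eq_1)
      then have "(\<Sum>n. (complex_of_real t / z) ^ n) = 1 / (1 - complex_of_real t / z)"
        by (rule suminf_geometric)
      then show ?case using z0 by (simp add: divide_simps)
    qed
  qed (auto intro!: borel_measurable_suminf)
  also have "\<dots> = z * cauchy_transform \<mu> z"
    by (simp only: integral_mult_right_zero cauchy_transform_def)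
  finally show ?thesis by (simp only: moment)
qed

lemma cauchy_transform_polynomial:
  assumes \<mu>: "compactly_supported_law \<mu>"
    and hol: "\<And>i. i \<le> n \<Longrightarrow> (\<lambda>z. p z i) holomorphic_on UNIV"
    and large: "\<And>z. R0 < cmod z \<Longrightarrow> 0 < Im z \<Longrightarrow> (\<Sum>i\<le>n. p z i * cauchy_transform \<mu> z ^ i) = 0"
    and z: "0 < Im z"
  shows "(\<Sum>i\<le>n. p z i * cauchy_transform \<mu> z ^ i) = 0"
proof -
  let ?H = "{z. 0 < Im z}" and ?f = "\<lambda>z. \<Sum>i\<le>n. p z i * cauchy_transform \<mu> z ^ i"
  have f: "?f holomorphic_on ?H"
    using \<mu> by (intro holomorphic_intros cauchy_transform_holomorphic)
      (auto simp: compactly_supported_law_def intro: holomorphic_on_subset[OF hol])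
  \<comment> \<open>A witness that the part of the half-plane outside the disc is nonempty; the
    absolute value allows for a negative radius.\<close>
  define \<xi> where "\<xi> = complex_of_real (\<bar>R0\<bar> + 1) * \<i>"
  let ?U = "?H \<inter> {z. R0 < cmod z}"
  have U: "open ?U" "?U \<subseteq> ?H" "\<xi> \<in> ?U"
    by (auto simp: \<xi>_def norm_mult intro!: open_Int open_halfspace_Im_gt open_Collect_less continuous_intros)
  show ?thesis
    by (rule analytic_continuation_open[of ?U ?H ?f "\<lambda>_. 0"])
      (use U f large z in \<open>auto intro!: open_halfspace_Im_gt convex_connected convex_halfspace_Im_gt\<close>)
qed

section \<open>Elimination\<close>

text \<open>The left-hand side of the conclusion is the resultant in \<open>y\<close> of the two quadratic polynomials.\<close>
lemma resultant_eq_0: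
  fixes y :: "'a::comm_ring_1"
  assumes 1: "y\<^sup>2 + P * y + Q = 0" and 2: "b * y\<^sup>2 + a * y = t"
  shows "(t + b * Q)\<^sup>2 + (a - b * P) * (a * Q + P * t) = 0"
proof -
  \<comment> \<open>Eliminating y^2 leaves an equation linear in y. Solving it for t avoids dividing
    by a - b P, so any commutative ring will do.\<close>
  have "(a - b * P) * y - b * Q - t = (b * y\<^sup>2 + a * y - t) - b * (y\<^sup>2 + P * y + Q)"
    by (simp add: algebra_simps)
  then have t: "t = (a - b * P) * y - b * Q" unfolding 1 2 by (simp add: algebra_simps)
  have "(t + b * Q)\<^sup>2 + (a - b * P) * (a * Q + P * t) = (a - b * P)\<^sup>2 * (y\<^sup>2 + P * y + Q)"
    unfolding t by (simp add: algebra_simps power2_eq_square)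
  then show ?thesis by (simp add: 1)
qed

text \<open>With G the Cauchy transform at z, t = z G - 1 is the value of the moment series of C at
  1/z, and P, Q are the coefficients of the quadratic for y. The factor c^4 clears the
  denominators.\<close>

lemma sum_p_coeffs:
  fixes c \<alpha> \<beta> \<gamma> z G :: complex
  assumes c: "c \<noteq> 0"
  defines "t \<equiv> z * G - 1"
  defines "P \<equiv> - 2 * \<gamma> * c * t * G" and "Q \<equiv> (c\<^sup>2 * t\<^sup>2 - 1) * G\<^sup>2"
  shows "(\<Sum>i\<le>8. p_coeffs c \<alpha> \<beta> \<gamma> z ! i * G ^ i) * c ^ 4
    = (t + \<beta>\<^sup>2 * Q)\<^sup>2 + (\<alpha> - \<beta>\<^sup>2 * P) * (\<alpha> * Q + P * t)"
proof -
  have sum9: "(\<Sum>i\<le>8. f i) = f 0 + f 1 + f 2 + f 3 + f 4 + f 5 + f 6 + f 7 + f 8" for f :: "nat \<Rightarrow> complex"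
  proof -
    have "{..8::nat} = {0,1,2,3,4,5,6,7,8}" by auto
    then show ?thesis by (simp add: ac_simps)
  qed
  have "(\<Sum>i\<le>8. p_coeffs c \<alpha> \<beta> \<gamma> z ! i * G ^ i) * c^4 =
      1 + (- (2 * \<alpha> * \<gamma> * c) - 2 * z) * G
    + (- (\<alpha>^2) + 2 * \<beta>^2 + \<alpha>^2 * c^2 - 2 * \<beta>^2 * c^2 + 4 * \<beta>^2 * \<gamma>^2 * c^2
        + 4 * \<alpha> * \<gamma> * z * c + z^2) * G^2
    + (2 * \<alpha> * \<beta>^2 * \<gamma> * c - 2 * \<alpha> * \<beta>^2 * \<gamma> * c^3 - 2 * \<beta>^2 * z - 2 * \<alpha>^2 * z * c^2
        + 6 * \<beta>^2 * z * c^2 - 12 * \<beta>^2 * \<gamma>^2 * z * c^2 - 2 * \<alpha> * \<gamma> * z^2 * c) * G^3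
    + (\<beta>^4 * c^4 + \<beta>^4 - 2 * \<beta>^4 * c^2 - 2 * \<alpha> * \<beta>^2 * \<gamma> * z * c + 6 * \<alpha> * \<beta>^2 * \<gamma> * z * c^3
        + \<alpha>^2 * z^2 * c^2 - 6 * \<beta>^2 * z^2 * c^2 + 12 * \<beta>^2 * \<gamma>^2 * z^2 * c^2) * G^4
    + (- (4 * \<beta>^4 * z * c^4) + 4 * \<beta>^4 * z * c^2 - 6 * \<alpha> * \<beta>^2 * \<gamma> * z^2 * c^3
        + 2 * \<beta>^2 * z^3 * c^2 - 4 * \<beta>^2 * \<gamma>^2 * z^3 * c^2) * G^5
    + (6 * \<beta>^4 * z^2 * c^4 - 2 * \<beta>^4 * z^2 * c^2 + 2 * \<alpha> * \<beta>^2 * \<gamma> * z^3 * c^3) * G^6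
    + (- (4 * \<beta>^4 * z^3 * c^4)) * G^7 + \<beta>^4 * z^4 * c^4 * G^8"
  proof -
    have q: "x / c * c^4 = x * c^3" "x / c^2 * c^4 = x * c^2" "x / c^3 * c^4 = x * c" "x / c^4 * c^4 = x" for x
      using c by (simp_all add: power2_eq_square eval_nat_numeral)
    have q': "x * c^4 * g / c = x * c^3 * g" "x * c^4 * g / c^2 = x * c^2 * g"
        "x * c^4 * g / c^3 = x * c * g" for x g
      using c by (simp_all add: power2_eq_square eval_nat_numeral)
    have sw: "(p * g) * c^4 = (p * c^4) * g" for p g by (simp add: mult_ac)
    show ?thesis
      unfolding sum9 p_coeffs_def distrib_right sw
      by (simp add: distrib_right left_diff_distrib q q' c)
  qed
  also have "\<dots> = (t + \<beta>^2 * Q)^2 + (\<alpha> - \<beta>^2 * P) * (\<alpha> * Q + P * t)"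
    unfolding P_def Q_def t_def
    by (simp add: algebra_simps eval_nat_numeral)
  finally show ?thesis .
qed

section \<open>Inverting the moment series\<close>

lemma fps_compositional_inverse:
  fixes F :: "complex fps"
  assumes "fps_nth F 0 = 0" "fps_nth F 1 \<noteq> 0"
  obtains u where "fps_nth u 0 = 0" "F oo u = fps_X" "u oo F = fps_X"
proof -
  have "fps_nth (fps_inv F) 0 = 0" by (simp add: fps_inv_def)
  then show ?thesis
    using that[of "fps_inv F"] fps_inv_right[OF assms] fps_inv[OF assms] by simp
qed

lemma fps_compose_square: "fps_nth c 0 = 0 \<Longrightarrow> F\<^sup>2 oo c = (F oo c)\<^sup>2" for F c :: "complex fps"
  by (simp add: power2_eq_square fps_compose_mult_distrib)

lemmas fps_compose_distribs =
  fps_compose_mult_distrib fps_compose_add_distrib fps_compose_sub_distrib fps_compose_square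
  fps_const_compose fps_X_fps_compose_startby0 fps_compose_1

text \<open>Inverting the Marchenko-Pastur equation gives X = u (c + X) (1 + X), so the product rule
  x = u v (1 + X) / X collapses to x = v / (c + X).\<close>

lemma wishart_covariance_inverse:
  fixes \<psi>X \<psi>t :: "complex fps" and c g :: complex
  assumes c: "c \<noteq> 0"
    and X0: "fps_nth \<psi>X 0 = 0" and X: "\<psi>X = fps_X * (fps_const c + \<psi>X) * (1 + \<psi>X)"
    and t0: "fps_nth \<psi>t 0 = 0" and t: "\<psi>t\<^sup>2 * (1 - fps_const g * fps_X + fps_X\<^sup>2) = fps_X\<^sup>2"
  obtains u v x where "fps_nth u 0 = 0" "fps_nth v 0 = 0" "fps_nth x 0 = 0"
    "\<psi>X oo u = fps_X" "\<psi>t oo v = fps_X" "fps_X * x = u * v * (1 + fps_X)"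
    "x * (fps_const c + fps_X) = v" "fps_X\<^sup>2 * (1 - fps_const g * v + v\<^sup>2) = v\<^sup>2"
proof -
  have X1: "fps_nth \<psi>X 1 \<noteq> 0"
    using c arg_cong[OF X, of "\<lambda>F. fps_nth F 1"] by (simp add: mult.assoc fps_mult_nth_0 X0)
  \<comment> \<open>Otherwise the square of \<psi>t would have order above 2, against the right-hand
    side X^2.\<close>
  have t1: "fps_nth \<psi>t 1 \<noteq> 0"
  proof
    assume "fps_nth \<psi>t 1 = 0"
    then have "fps_nth (\<psi>t\<^sup>2) 0 = 0" "fps_nth (\<psi>t\<^sup>2) 1 = 0" "fps_nth (\<psi>t\<^sup>2) 2 = 0"
      using t0 by (simp_all add: power2_eq_square fps_mult_nth numeral_2_eq_2)
    then have "fps_nth (\<psi>t\<^sup>2 * (1 - fps_const g * fps_X + fps_X\<^sup>2)) 2 = 0"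
      unfolding fps_mult_nth[of "\<psi>t\<^sup>2"] by (simp add: numeral_2_eq_2)
    then show False unfolding t by simp
  qed
  obtain u where u: "fps_nth u 0 = 0" "\<psi>X oo u = fps_X"
    using fps_compositional_inverse[OF X0 X1] by blast
  obtain v where v: "fps_nth v 0 = 0" "\<psi>t oo v = fps_X"
    using fps_compositional_inverse[OF t0 t1] by blast
  have uX: "fps_X = u * (fps_const c + fps_X) * (1 + fps_X)"
    using arg_cong[OF X, of "\<lambda>F. F oo u"] u by (simp add: fps_compose_distribs)
  have vt: "fps_X\<^sup>2 * (1 - fps_const g * v + v\<^sup>2) = v\<^sup>2"
    using arg_cong[OF t, of "\<lambda>F. F oo v"] v by (simp add: fps_compose_distribs)
  define x where "x = fps_shift 1 (u * v * (1 + fps_X))"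
  have x: "fps_X * x = u * v * (1 + fps_X)"
    unfolding x_def using u v by (intro fps_ext) (simp add: fps_mult_nth_0)
  have "fps_X * (x * (fps_const c + fps_X)) = fps_X * v"
  proof -
    have "fps_X * (x * (fps_const c + fps_X)) = v * (u * (fps_const c + fps_X) * (1 + fps_X))"
      using x by (simp add: mult_ac mult.assoc[symmetric, of fps_X x])
    also have "\<dots> = v * fps_X" by (simp only: uX[symmetric])
    finally show ?thesis by (simp only: mult.commute)
  qed
  then have xv: "x * (fps_const c + fps_X) = v" by simp
  have "fps_nth x 0 = 0" using arg_cong[OF xv, of "\<lambda>F. fps_nth F 0"] v c by (simp add: fps_mult_nth_0)
  then show ?thesis using that u v x xv vt by blast
qed

text \<open>Passing from the T x T to the N x N trace divides the moment series by c, so X is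
  replaced by c X in its inverse, and c + X becomes c (1 + X).\<close>

lemma rescale_inverse:
  fixes \<psi> x v :: "complex fps" and c g :: complex
  assumes c: "c \<noteq> 0" and x0: "fps_nth x 0 = 0" and x: "\<psi> oo x = fps_X"
    and xv: "x * (fps_const c + fps_X) = v" and v0: "fps_nth v 0 = 0"
    and v: "fps_X\<^sup>2 * (1 - fps_const g * v + v\<^sup>2) = v\<^sup>2"
  obtains u w where "fps_nth u 0 = 0" "(fps_const (1 / c) * \<psi>) oo u = fps_X"
    "u * fps_const c * (1 + fps_X) = w"
    "(fps_const c * fps_X)\<^sup>2 * (1 - fps_const g * w + w\<^sup>2) = w\<^sup>2"
proof -
  define l where "l = fps_const c * fps_X"
  have l0: "fps_nth l 0 = 0" by (simp add: l_def)
  define u w where "u = x oo l" and "w = v oo l"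
  have "\<psi> oo u = l" unfolding u_def using x l0 x0 by (simp add: fps_compose_assoc)
  then have "(fps_const (1 / c) * \<psi>) oo u = fps_const (1 / c) * l"
    using x0 l0 by (simp add: fps_compose_distribs u_def)
  also have "\<dots> = fps_X" using c by (simp add: l_def mult.assoc[symmetric])
  finally have 1: "(fps_const (1 / c) * \<psi>) oo u = fps_X" .
  have 2: "u * (fps_const c + l) = w"
    using arg_cong[OF xv, of "\<lambda>F. F oo l"] l0 by (simp add: fps_compose_distribs u_def w_def)
  have 3: "l\<^sup>2 * (1 - fps_const g * w + w\<^sup>2) = w\<^sup>2"
    using arg_cong[OF v, of "\<lambda>F. F oo l"] l0 by (simp add: fps_compose_distribs w_def)
  show ?thesis
  proof (rule that[of u w])
    show "fps_nth u 0 = 0" using x0 l0 by (simp add: u_def)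
    show "u * fps_const c * (1 + fps_X) = w" using 2 by (simp add: l_def algebra_simps)
  qed (use 1 3 in \<open>simp_all add: l_def\<close>)
qed

text \<open>Put y = us (1 + X), the value of X (1 + \<psi>s) at us, and h = x (1 + X). The product
  rule reads w y = c X h, so multiplying the quadratic for w by y^2 and cancelling (c X)^2 gives a
  quadratic for y with coefficients in h. Its resultant with b y^2 + a y = X is then composed with
  \<psi>C, which replaces X by \<psi>C and h by G.\<close>

lemma moment_series_equation:
  fixes \<psi>s \<psi>C u us w x :: "complex fps" and a b c g :: complex
  assumes c: "c \<noteq> 0"
    and s: "fps_const b * (fps_X * (1 + \<psi>s))\<^sup>2 + fps_const a * (fps_X * (1 + \<psi>s)) = \<psi>s"
    and us: "fps_nth us 0 = 0" "\<psi>s oo us = fps_X"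
    and uw: "u * fps_const c * (1 + fps_X) = w"
    and w: "(fps_const c * fps_X)\<^sup>2 * (1 - fps_const (2 * g) * w + w\<^sup>2) = w\<^sup>2"
    and x: "fps_X * x = u * us * (1 + fps_X)" and C: "x oo \<psi>C = fps_X" "fps_nth \<psi>C 0 = 0"
  defines "G \<equiv> fps_X * (1 + \<psi>C)"
  defines "P \<equiv> - 2 * fps_const g * fps_const c * \<psi>C * G" and "Q \<equiv> ((fps_const c)\<^sup>2 * \<psi>C\<^sup>2 - 1) * G\<^sup>2"
  shows "(\<psi>C + fps_const b * Q)\<^sup>2 + (fps_const a - fps_const b * P) * (fps_const a * Q + P * \<psi>C) = 0"
proof -
  define y where "y = us * (1 + fps_X)"
  define h where "h = x * (1 + fps_X)"
  let ?c = "fps_const c" and ?g = "fps_const g"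
  have y: "fps_const b * y\<^sup>2 + fps_const a * y = fps_X"
    using arg_cong[OF s, of "\<lambda>F. F oo us"] us by (simp add: fps_compose_distribs y_def)
  have wy: "w * y = ?c * fps_X * h"
  proof -
    have "w * y = ?c * (1 + fps_X) * (u * us * (1 + fps_X))" by (simp add: uw[symmetric] y_def mult_ac)
    also have "\<dots> = ?c * (1 + fps_X) * (fps_X * x)" by (simp only: x)
    finally show ?thesis by (simp add: h_def mult_ac)
  qed
  have g2: "fps_const (2 * g) = 2 * ?g" by (simp add: numeral_fps_const)
  have "(?c * fps_X)\<^sup>2 * (y\<^sup>2 + (- 2 * ?g * ?c * fps_X * h) * y + (?c\<^sup>2 * fps_X\<^sup>2 - 1) * h\<^sup>2)
      = (?c * fps_X)\<^sup>2 * (y\<^sup>2 - fps_const (2 * g) * (w * y) * y + (w * y)\<^sup>2) - (w * y)\<^sup>2"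
    unfolding wy g2 by (simp add: algebra_simps power2_eq_square del: fps_const_mult)
  also have "\<dots> = ((?c * fps_X)\<^sup>2 * (1 - fps_const (2 * g) * w + w\<^sup>2) - w\<^sup>2) * y\<^sup>2"
    by (simp add: algebra_simps power2_eq_square)
  also have "\<dots> = 0" unfolding w by simp
  finally have q: "y\<^sup>2 + (- 2 * ?g * ?c * fps_X * h) * y + (?c\<^sup>2 * fps_X\<^sup>2 - 1) * h\<^sup>2 = 0"
    using c by simp
  have "h oo \<psi>C = G" using C by (simp add: h_def G_def fps_compose_distribs)
  have n2: "(- 2 :: complex fps) oo \<psi>C = - 2"
    by (simp add: numeral_fps_const fps_compose_uminus)
  from arg_cong[OF resultant_eq_0[OF q y], of "\<lambda>F. F oo \<psi>C"] C(2)
  show ?thesis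
    by (simp add: fps_compose_distribs n2 \<open>h oo \<psi>C = G\<close> P_def Q_def fps_compose_uminus numeral_fps_const)
qed

section \<open>Traces of words\<close>

lemma pow_mat_commute:
  assumes "A \<in> carrier_mat n n"
  shows "A ^\<^sub>m k * A = A * A ^\<^sub>m k"
  using assms by (induction k) (auto simp: assoc_mult_mat[of _ n n _ n _ n])

lemma mat_word_Cons: "mat_word A B ((k, l) # w) = A ^\<^sub>m k * B ^\<^sub>m l * mat_word A B w"
  by (simp add: mat_word_def)

lemma mat_word_replicate:
  assumes A: "A \<in> carrier_mat n n" and B: "B \<in> carrier_mat n n"
  shows "mat_word A B (replicate k (1, 1)) = (A * B) ^\<^sub>m k"
proof (induction k)
  case (Suc k)
  have "mat_word A B (replicate (Suc k) (1, 1)) = A * B * (A * B) ^\<^sub>m k"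
    unfolding replicate_Suc mat_word_Cons Suc using A B by simp
  then show ?case using pow_mat_commute[OF mult_carrier_mat[OF A B], of k] by simp
qed (use A B in \<open>simp add: mat_word_def\<close>)

lemma mat_word_single:
  assumes A: "A \<in> carrier_mat n n" and B: "B \<in> carrier_mat n n"
  shows "mat_word A B [(k, 0)] = A ^\<^sub>m k" "mat_word A B [(0, k)] = B ^\<^sub>m k"
  using A B pow_carrier_mat[OF A, of k] pow_carrier_mat[OF B, of k] by (simp_all add: mat_word_def)

lemma norm_trace_mult_commute:
  assumes P: "P \<in> carrier_mat n t" and Q: "Q \<in> carrier_mat t n"
  shows "of_nat n * norm_trace (P * Q) = of_nat t * norm_trace (Q * P)"
proof -
  have tr: "of_nat k * norm_trace A = (\<Sum>i<k. A $$ (i, i))" if "A \<in> carrier_mat k k" for A k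
    using that by (auto simp: norm_trace_def)
  have "of_nat n * norm_trace (P * Q) = (\<Sum>i<n. \<Sum>j<t. P $$ (i, j) * Q $$ (j, i))"
    by (simp add: tr[OF mult_carrier_mat[OF P Q]] index_mult_mat_sum[OF P Q] del: index_mult_mat(1))
  also have "\<dots> = (\<Sum>j<t. \<Sum>i<n. Q $$ (j, i) * P $$ (i, j))"
    by (subst sum.swap) (simp add: mult.commute)
  also have "\<dots> = of_nat t * norm_trace (Q * P)"
    by (simp add: tr[OF mult_carrier_mat[OF Q P]] index_mult_mat_sum[OF Q P] del: index_mult_mat(1))
  finally show ?thesis .
qed

text \<open>(P Q)^(k+1) = P (Q P)^k Q, and the trace lets P move to the other end. Exponent 0 is
  left out, as there the sides are n and t.\<close>

lemma norm_trace_pow_mult_commute: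
  assumes P: "P \<in> carrier_mat n t" and Q: "Q \<in> carrier_mat t n"
  shows "of_nat n * norm_trace ((P * Q) ^\<^sub>m Suc k) = of_nat t * norm_trace ((Q * P) ^\<^sub>m Suc k)"
proof -
  have QPk: "(Q * P) ^\<^sub>m k \<in> carrier_mat t t" for k using P Q by (intro pow_carrier_mat) auto
  have pow: "(P * Q) ^\<^sub>m Suc k = P * ((Q * P) ^\<^sub>m k * Q)" for k
  proof (induction k)
    case 0
    show ?case using P Q by simp
  next
    case (Suc k)
    have "(P * Q) ^\<^sub>m Suc (Suc k) = (P * ((Q * P) ^\<^sub>m k * Q)) * (P * Q)" using Suc by simp
    also have "\<dots> = P * ((Q * P) ^\<^sub>m k * (Q * P) * Q)"
      using P Q QPk[of k]
      by (simp add: assoc_mult_mat[of P n t _ n] assoc_mult_mat[of _ t t _ n] assoc_mult_mat[of _ t t _ t]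
          assoc_mult_mat[of Q t n _ t] assoc_mult_mat[of P n t _ t] assoc_mult_mat[of "(Q * P) ^\<^sub>m k" t t Q n "P * Q" n]
          assoc_mult_mat[of Q t n P t Q n] assoc_mult_mat[of P n t _ n "P * Q" n] mult_carrier_mat[of _ t t _ n]
          mult_carrier_mat[of _ t n _ t] mult_carrier_mat[of _ n t _ n])
    finally show ?case by simp
  qed
  have "of_nat n * norm_trace ((P * Q) ^\<^sub>m Suc k) = of_nat t * norm_trace ((Q * P) ^\<^sub>m k * Q * P)"
    unfolding pow using P Q QPk[of k] by (intro norm_trace_mult_commute) auto
  also have "(Q * P) ^\<^sub>m k * Q * P = (Q * P) ^\<^sub>m Suc k"
    using P Q QPk[of k] by (simp add: assoc_mult_mat[of _ t t Q n P t])
  finally show ?thesis .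
qed

lemma pow_mat_smult:
  fixes A :: "'a::comm_ring_1 mat"
  assumes "A \<in> carrier_mat n n"
  shows "(c \<cdot>\<^sub>m A) ^\<^sub>m k = c ^ k \<cdot>\<^sub>m A ^\<^sub>m k"
proof (induction k)
  case (Suc k)
  have "A ^\<^sub>m k \<in> carrier_mat n n" by (rule pow_carrier_mat[OF assms])
  then show ?case using assms
    by (auto simp: Suc mult_smult_assoc_mat[of _ n n _ n] mult_smult_distrib[of _ n n _ n] intro!: eq_matI)
qed (use assms in \<open>auto intro!: eq_matI\<close>)

lemma norm_trace_smult: "A \<in> carrier_mat n n \<Longrightarrow> norm_trace (c \<cdot>\<^sub>m A) = c * norm_trace A"
  by (auto simp: norm_trace_def sum_distrib_left[symmetric])

text \<open>Ties the matrices of the theorem to the polynomials of the Gaussian calculus.\<close>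

lemma norm_trace_gram:
  fixes W :: "real mat"
  assumes W: "W \<in> carrier_mat n t" and t: "0 < t"
  defines "Wc \<equiv> map_mat complex_of_real W"
  shows "norm_trace ((complex_of_real (1 / real t) \<cdot>\<^sub>m (transpose_mat Wc * Wc)) ^\<^sub>m k)
    = complex_of_real (gram_trace n t k (\<lambda>i. W $$ i) / real t ^ Suc k)"
proof -
  let ?Y = "transpose_mat Wc * Wc"
  have Wc: "Wc \<in> carrier_mat n t" "transpose_mat Wc \<in> carrier_mat t n" using W by (auto simp: Wc_def)
  then have Y: "?Y \<in> carrier_mat t t" by auto
  have Yi: "?Y $$ (l, j) = complex_of_real (gram n (\<lambda>i. W $$ i) l j)" if "l < t" "j < t" for l j
    unfolding index_mult_mat_sum[OF Wc(2,1) that] using that W by (simp add: gram_def Wc_def)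
  have pow: "(?Y ^\<^sub>m k) $$ (l, j) = complex_of_real (gram_power n t k (\<lambda>i. W $$ i) l j)"
    if "l < t" "j < t" for l j k
    using that
  proof (induction k arbitrary: l j)
    case 0
    then show ?case using Y by auto
  next
    case (Suc k)
    have "(?Y ^\<^sub>m Suc k) $$ (l, j) = (\<Sum>m<t. (?Y ^\<^sub>m k) $$ (l, m) * ?Y $$ (m, j))"
      using index_mult_mat_sum[OF pow_carrier_mat[OF Y] Y Suc.prems] by simp
    also have "\<dots> = (\<Sum>m<t. complex_of_real (gram_power n t k (\<lambda>i. W $$ i) l m * gram n (\<lambda>i. W $$ i) m j))"
      using Suc by (intro sum.cong) (auto simp: Yi simp del: index_mult_mat(1))
    finally show ?case unfolding gram_power_Suc_right[OF Suc.prems] by simp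
  qed
  have "norm_trace (?Y ^\<^sub>m k) = complex_of_real (gram_trace n t k (\<lambda>i. W $$ i)) / of_nat t"
    using pow pow_carrier_mat[OF Y, of k] by (auto simp: norm_trace_def gram_trace_def)
  then have "norm_trace ((complex_of_real (1 / real t) \<cdot>\<^sub>m ?Y) ^\<^sub>m k)
    = complex_of_real (1 / real t) ^ k * (complex_of_real (gram_trace n t k (\<lambda>i. W $$ i)) / of_nat t)"
    by (simp only: pow_mat_smult[OF Y] norm_trace_smult[OF pow_carrier_mat[OF Y]])
  then show ?thesis by (simp add: power_divide)
qed

lemma psd_norm_trace:
  assumes "psd n A"
  shows "0 \<le> Re (norm_trace A)"
proof -
  have "0 \<le> Re (A $$ (k, k))" if "k < n" for k
  proof -
    have "quad_form n A (\<lambda>i. if i = k then 1 else 0) = A $$ (k, k)"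
      using that unfolding quad_form_def by (simp add: if_distrib[of "\<lambda>z. _ * z"]
          if_distrib[of "\<lambda>z. z * _"] if_distrib[of cnj] cong: if_cong)
    then show ?thesis using psdD(3)[OF assms] by metis
  qed
  then show ?thesis
    using psdD(1)[OF assms] by (auto simp: norm_trace_def Re_divide_of_nat intro!: divide_nonneg_nonneg sum_nonneg)
qed

text \<open>With B = A - 1 the matrix B A B is again non-negative definite, and its trace is the
  expression in question. Used to exclude \<alpha> = 0.\<close>

lemma psd_moment_inequality:
  assumes A: "psd n A"
  shows "0 \<le> Re (norm_trace (A ^\<^sub>m 3) - 2 * norm_trace (A ^\<^sub>m 2) + norm_trace (A ^\<^sub>m 1))"
proof -
  note Ac = psdD(1)[OF A]
  define B where "B = A + (- 1) \<cdot>\<^sub>m 1\<^sub>m n"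
  have B: "B \<in> carrier_mat n n" using Ac by (simp add: B_def)
  have "mat_adjoint B = B"
  proof (rule eq_matI)
    fix i j assume "i < dim_row B" "j < dim_col B"
    then have ij: "i < n" "j < n" using B by auto
    have "cnj (A $$ (j, i)) = A $$ (i, j)" using psdD(2)[OF A ij] by simp
    then show "mat_adjoint B $$ (i, j) = B $$ (i, j)"
      unfolding mat_adjoint_index[OF B ij] unfolding B_def using ij Ac by simp
  qed (use mat_adjoint_carrier[OF B] B in auto)
  then have "psd n (B * A * B)" using psd_congruence[OF A B] by simp
  moreover have "norm_trace (B * A * B) = norm_trace (A ^\<^sub>m 3) - 2 * norm_trace (A ^\<^sub>m 2) + norm_trace (A ^\<^sub>m 1)"
  proof -
    have A2: "A * A \<in> carrier_mat n n" and A3: "A * A * A \<in> carrier_mat n n" using Ac by auto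
    have "B * A = A * A + (- 1) \<cdot>\<^sub>m A"
      unfolding B_def using Ac by (simp add: add_mult_distrib_mat[of _ n n] mult_smult_assoc_mat[of _ n n _ n])
    then have "B * A * B = (A * A + (- 1) \<cdot>\<^sub>m A) * A + (A * A + (- 1) \<cdot>\<^sub>m A) * ((- 1) \<cdot>\<^sub>m 1\<^sub>m n)"
      unfolding B_def using Ac by (simp add: mult_add_distrib_mat[of _ n n _ n])
    also have "(A * A + (- 1) \<cdot>\<^sub>m A) * A = A * A * A + (- 1) \<cdot>\<^sub>m (A * A)"
      using Ac by (simp add: add_mult_distrib_mat[of _ n n] mult_smult_assoc_mat[of _ n n _ n])
    also have "(A * A + (- 1) \<cdot>\<^sub>m A) * ((- 1) \<cdot>\<^sub>m 1\<^sub>m n) = (- 1) \<cdot>\<^sub>m (A * A) + A"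
      using Ac by (subst mult_smult_distrib[of _ n n _ n]) (auto intro!: eq_matI)
    finally have "B * A * B = A * A * A + (- 1) \<cdot>\<^sub>m (A * A) + ((- 1) \<cdot>\<^sub>m (A * A) + A)" .
    also have "\<dots> = 1 \<cdot>\<^sub>m (A * A * A) + (- 2) \<cdot>\<^sub>m (A * A) + A"
      using Ac by (intro eq_matI) (auto simp del: index_mult_mat(1))
    finally show ?thesis
      using norm_trace_linear[OF A3 A2 Ac, of 1 "- 2"] Ac by (simp add: eval_nat_numeral)
  qed
  ultimately show ?thesis using psd_norm_trace by metis
qed

section \<open>From moments to the Cauchy transform\<close>

lemma mp_moment_series:
  fixes c :: real
  defines "\<psi> \<equiv> Abs_fps (\<lambda>n. if n = 0 then 0 else complex_of_real (mp_moment c n))"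
  shows "\<psi> = fps_X * (fps_const (complex_of_real c) + \<psi>) * (1 + \<psi>)"
proof (rule fps_ext)
  have P: "fps_nth (1 + \<psi>) n = complex_of_real (mp_moment c n)" for n
    by (simp add: \<psi>_def)
  fix n
  show "fps_nth \<psi> n = fps_nth (fps_X * (fps_const (complex_of_real c) + \<psi>) * (1 + \<psi>)) n"
  proof (cases n)
    case (Suc k)
    have "fps_nth (\<psi> * (1 + \<psi>)) k = (\<Sum>i\<in>{0..k}. fps_nth \<psi> i * complex_of_real (mp_moment c (k - i)))"
      by (simp only: fps_mult_nth P)
    \<comment> \<open>Index 0 contributes nothing, since \<psi> has no constant term; the others are
      shifted by one.\<close>
    also have "{0..k} = insert 0 (Suc ` {..<k})"
      by (auto simp: image_Suc_lessThan)
    also have "(\<Sum>i\<in>insert 0 (Suc ` {..<k}). fps_nth \<psi> i * complex_of_real (mp_moment c (k - i)))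
        = (\<Sum>a<k. complex_of_real (mp_moment c (Suc a) * mp_moment c (k - 1 - a)))"
      by (simp add: sum.reindex \<psi>_def)
    finally have "fps_nth (fps_X * (fps_const (complex_of_real c) + \<psi>) * (1 + \<psi>)) n
        = complex_of_real c * fps_nth (1 + \<psi>) k + (\<Sum>a<k. complex_of_real (mp_moment c (Suc a) * mp_moment c (k - 1 - a)))"
      unfolding Suc by (simp add: mult.assoc distrib_right del: fps_add_nth) (simp add: distrib_left)
    also have "\<dots> = complex_of_real (mp_moment c (Suc k))"
      unfolding P by (subst mp_moment.simps(2)) simp
    finally show ?thesis by (simp add: Suc \<psi>_def)
  qed (simp add: \<psi>_def)
qed

lemma cauchy_transform_algebraic:
  fixes \<mu> :: "real measure" and a b c g :: complex
  assumes \<mu>: "compactly_supported_law \<mu>" and c: "c \<noteq> 0" and z: "0 < Im z"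
  defines "\<psi> \<equiv> Abs_fps (\<lambda>n. if n = 0 then 0 else complex_of_real (\<integral>t. t ^ n \<partial>\<mu>))"
  defines "G \<equiv> fps_X * (1 + \<psi>)"
  defines "P \<equiv> - 2 * fps_const g * fps_const c * \<psi> * G" and "Q \<equiv> ((fps_const c)\<^sup>2 * \<psi>\<^sup>2 - 1) * G\<^sup>2"
  assumes eq: "(\<psi> + fps_const (b\<^sup>2) * Q)\<^sup>2
    + (fps_const a - fps_const (b\<^sup>2) * P) * (fps_const a * Q + P * \<psi>) = 0"
  shows "(\<Sum>i\<le>8. p_coeffs c a b g z ! i * cauchy_transform \<mu> z ^ i) = 0"
proof -
  from \<mu> have M: "prob_space \<mu>" and s: "sets \<mu> = sets borel"
    and K: "\<exists>K. compact K \<and> (AE t in \<mu>. t \<in> K)" by (auto simp: compactly_supported_law_def)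
  interpret prob_space \<mu> by fact
  from K obtain K where K: "compact K" "AE t in \<mu>. t \<in> K" by blast
  from compact_imp_bounded[OF K(1)] obtain R where R: "0 < R" "\<And>t. t \<in> K \<Longrightarrow> norm t \<le> R"
    unfolding bounded_pos by blast
  have AER: "AE t in \<mu>. \<bar>t\<bar> \<le> R" using K(2) by eventually_elim (use R in auto)
  have series: "(\<lambda>n. fps_nth \<psi> n * (1 / z) ^ n) sums (z * cauchy_transform \<mu> z - 1)"
    if "R < cmod z" for z
  proof -
    define f where "f = (\<lambda>n. complex_of_real (\<integral>t. t ^ n \<partial>\<mu>) * (1 / z) ^ n)"
    have "f sums (z * cauchy_transform \<mu> z)"
      unfolding f_def by (rule cauchy_transform_series[OF M s AER R(1) that])
    moreover have "f 0 = 1" by (simp add: f_def prob_space)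
    ultimately have "(\<lambda>n. f (Suc n)) sums (z * cauchy_transform \<mu> z - 1)"
      by (simp add: sums_Suc_iff)
    then have "(\<lambda>n. fps_nth \<psi> (Suc n) * (1 / z) ^ Suc n) sums (z * cauchy_transform \<mu> z - 1)"
      by (simp add: f_def \<psi>_def)
    then show ?thesis by (subst (asm) sums_Suc_iff) (simp add: \<psi>_def)
  qed
  have "ereal (norm (1 / complex_of_real (R + 1))) \<le> fps_conv_radius \<psi>"
    unfolding fps_conv_radius_def
    by (rule conv_radius_geI, rule sums_summable[OF series]) (use R in simp)
  moreover have "0 < norm (1 / complex_of_real (R + 1))" using R by (simp del: of_real_add)
  ultimately have rad: "0 < fps_conv_radius \<psi>"
    by (metis ereal_less(2) less_le_trans)
  \<comment> \<open>The identity \<open>eq\<close> as a function of the values of \<psi> and G, so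
    that its expansion at w = 1/z = 0 is the formal left-hand side.\<close>
  define h where "h = (\<lambda>t g'. (t + b\<^sup>2 * ((c\<^sup>2 * t\<^sup>2 - 1) * g'\<^sup>2))\<^sup>2
    + (a - b\<^sup>2 * (- 2 * g * c * t * g')) * (a * ((c\<^sup>2 * t\<^sup>2 - 1) * g'\<^sup>2) + (- 2 * g * c * t * g') * t))"
  have "eval_fps \<psi> has_fps_expansion \<psi>" by (rule eval_fps_has_fps_expansion[OF rad])
  then have "(\<lambda>w. h (eval_fps \<psi> w) (w * (1 + eval_fps \<psi> w))) has_fps_expansion
    (\<psi> + fps_const (b\<^sup>2) * (((fps_const (c\<^sup>2)) * \<psi>\<^sup>2 - 1) * (fps_X * (1 + \<psi>))\<^sup>2))\<^sup>2
    + (fps_const a - fps_const (b\<^sup>2) * (fps_const (- 2 * g * c) * \<psi> * (fps_X * (1 + \<psi>))))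
      * (fps_const a * ((fps_const (c\<^sup>2) * \<psi>\<^sup>2 - 1) * (fps_X * (1 + \<psi>))\<^sup>2)
        + (fps_const (- 2 * g * c) * \<psi> * (fps_X * (1 + \<psi>))) * \<psi>)"
    unfolding h_def by (intro fps_expansion_intros)
  also have "\<dots> = 0"
  proof -
    have "fps_const (- 2 * g * c) = - 2 * fps_const g * fps_const c" "fps_const (c\<^sup>2) = (fps_const c)\<^sup>2"
      by (simp_all add: numeral_fps_const fps_const_power)
    then show ?thesis using eq by (simp only: G_def P_def Q_def)
  qed
  finally have "\<forall>\<^sub>F w in nhds 0. h (eval_fps \<psi> w) (w * (1 + eval_fps \<psi> w)) = 0"
    by (auto simp: has_fps_expansion_def elim: eventually_mono)
  then obtain \<epsilon> where \<epsilon>: "0 < \<epsilon>" "\<And>w. norm w < \<epsilon> \<Longrightarrow> h (eval_fps \<psi> w) (w * (1 + eval_fps \<psi> w)) = 0"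
    unfolding eventually_nhds_metric by auto
  show ?thesis
  proof (rule cauchy_transform_polynomial[OF \<mu> _ _ z, where ?R0.0 = "max R (1 / \<epsilon>)"])
    fix i :: nat assume "i \<le> 8"
    then consider "i = 0" | "i = 1" | "i = 2" | "i = 3" | "i = 4" | "i = 5" | "i = 6" | "i = 7" | "i = 8"
      by linarith
    then show "(\<lambda>z. p_coeffs c a b g z ! i) holomorphic_on UNIV"
      using c by cases (simp_all add: p_coeffs_def, (intro holomorphic_intros; simp)+)
  next
    fix z assume z: "max R (1 / \<epsilon>) < cmod z" "0 < Im z"
    then have z0: "z \<noteq> 0" by auto
    have w: "norm (1 / z) < \<epsilon>" using z(1) \<epsilon>(1) z0 by (simp add: norm_divide field_simps)
    have "eval_fps \<psi> (1 / z) = z * cauchy_transform \<mu> z - 1"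
      using sums_unique[OF series[of z]] z(1) by (simp add: eval_fps_def)
    then have "h (z * cauchy_transform \<mu> z - 1) (cauchy_transform \<mu> z) = 0"
      using \<epsilon>(2)[OF w] z0 by simp
    then have "(\<Sum>i\<le>8. p_coeffs c a b g z ! i * cauchy_transform \<mu> z ^ i) * c ^ 4 = 0"
      unfolding sum_p_coeffs[OF c] h_def by simp
    then show "(\<Sum>i\<le>8. p_coeffs c a b g z ! i * cauchy_transform \<mu> z ^ i) = 0" using c by simp
  qed
qed

theorem mainTheorem1:
  fixes M :: "'w measure"
    and c r \<alpha> \<beta> \<gamma> :: real
    and T :: "nat \<Rightarrow> nat"
    and W :: "nat \<Rightarrow> 'w \<Rightarrow> real mat"
    and V :: "nat \<Rightarrow> 'w \<Rightarrow> complex mat"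
    and Wc \<Sigma>s C :: "nat \<Rightarrow> 'w \<Rightarrow> complex mat"
    and \<Sigma>t :: "nat \<Rightarrow> complex mat"
    and smul1 :: "complex \<Rightarrow> 'a::ring_1 \<Rightarrow> 'a" and \<phi>1 :: "'a \<Rightarrow> complex" and a1 b1 :: 'a
    and smul2 :: "complex \<Rightarrow> 'b::ring_1 \<Rightarrow> 'b" and \<phi>2 :: "'b \<Rightarrow> complex" and a2 b2 :: 'b
    and \<mu>t \<mu>C :: "real measure"
  assumes "prob_space M"
    and "0 < c" "c < 1" "0 < r" "r < 1" "0 \<le> \<alpha>" "0 < \<beta>"
    and "\<gamma> = (1 + r\<^sup>2) / (1 - r\<^sup>2)"
    and "filterlim T at_top sequentially"
    and "(\<lambda>N. real N / real (T N)) \<longlonglongrightarrow> c"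
    and "\<And>N. gaussian_matrix M N (T N) (W N)"
    and "\<And>N. wigner_matrix M N (V N)"
    and "\<And>N \<omega>. Wc N \<omega> = map_mat complex_of_real (W N \<omega>)"
    and "\<And>N \<omega>. \<Sigma>s N \<omega> = complex_of_real \<alpha> \<cdot>\<^sub>m 1\<^sub>m N + complex_of_real \<beta> \<cdot>\<^sub>m V N \<omega>"
    and "AE \<omega> in M. \<forall>\<^sub>F N in sequentially. nonneg_definite (\<Sigma>s N \<omega>)"
    and "\<And>N. \<Sigma>t N = exp_covariance r (T N)"
    and "\<And>N \<omega>. C N \<omega> = complex_of_real (1 / real (T N)) \<cdot>\<^sub>m
           (mat_sqrt (\<Sigma>s N \<omega>) * Wc N \<omega> * \<Sigma>t N * transpose_mat (Wc N \<omega>) * mat_sqrt (\<Sigma>s N \<omega>))"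
    and "asymptotically_free M
           (\<lambda>N \<omega>. complex_of_real (1 / real (T N)) \<cdot>\<^sub>m
              (Wc N \<omega> * \<Sigma>t N * transpose_mat (Wc N \<omega>)))
           \<Sigma>s smul1 \<phi>1 a1 b1"
    and "asymptotically_free M
           (\<lambda>N \<omega>. complex_of_real (1 / real (T N)) \<cdot>\<^sub>m (transpose_mat (Wc N \<omega>) * Wc N \<omega>))
           (\<lambda>N \<omega>. \<Sigma>t N) smul2 \<phi>2 a2 b2"
    and "converges_in_distribution M \<Sigma>s (semicircle_law \<alpha> \<beta>)"
    and "converges_in_distribution M (\<lambda>N \<omega>. \<Sigma>t N) \<mu>t"
    and "converges_in_distribution M C \<mu>C"
  shows "\<forall>z :: complex. Im z > 0 \<longrightarrow>
           (\<Sum>i\<le>8. p_coeffs (complex_of_real c) (complex_of_real \<alpha>) (complex_of_real \<beta>)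
                     (complex_of_real \<gamma>) z ! i * cauchy_transform \<mu>C z ^ i) = 0"
proof (intro allI impI)
  fix z :: complex assume z: "0 < Im z"
  note c = assms(2,3) and r = assms(4,5) and \<beta> = assms(7) and T = assms(9) and NT = assms(10)
    and gauss = assms(11) and wig = assms(12) and Wc = assms(13) and \<Sigma>s = assms(14) and pos = assms(15)
    and \<Sigma>t = assms(16) and C = assms(17) and free1 = assms(18) and free2 = assms(19)
    and conv_s = assms(20) and conv_C = assms(22)
  interpret prob_space M by fact
  interpret N1: nc_prob_space smul1 \<phi>1 using free1 by (simp add: asymptotically_free_def)
  interpret N2: nc_prob_space smul2 \<phi>2 using free2 by (simp add: asymptotically_free_def)
  define X where "X = (\<lambda>N \<omega>. complex_of_real (1 / real (T N)) \<cdot>\<^sub>m (transpose_mat (Wc N \<omega>) * Wc N \<omega>))"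
  define Y where "Y = (\<lambda>N \<omega>. complex_of_real (1 / real (T N)) \<cdot>\<^sub>m (Wc N \<omega> * \<Sigma>t N * transpose_mat (Wc N \<omega>)))"
  have AE1: "AE \<omega> in M. \<forall>kls. (\<lambda>N. norm_trace (mat_word (Y N \<omega>) (\<Sigma>s N \<omega>) kls))
      \<longlonglongrightarrow> \<phi>1 (prod_list (map (\<lambda>(k, l). a1 ^ k * b1 ^ l) kls))"
    using free1 by (simp add: asymptotically_free_def Y_def)
  have AE2: "AE \<omega> in M. \<forall>kls. (\<lambda>N. norm_trace (mat_word (X N \<omega>) (\<Sigma>t N) kls))
      \<longlonglongrightarrow> \<phi>2 (prod_list (map (\<lambda>(k, l). a2 ^ k * b2 ^ l) kls))"
    using free2 by (simp add: asymptotically_free_def X_def)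
  have W_car: "W N \<omega> \<in> carrier_mat N (T N)" if "\<omega> \<in> space M" for N \<omega>
    using gauss[of N] that by (simp add: gaussian_matrix_def)
  have Wc_car: "Wc N \<omega> \<in> carrier_mat N (T N)" if "\<omega> \<in> space M" for N \<omega>
    using W_car[OF that, of N] by (simp add: Wc)
  have \<Sigma>t_car: "\<Sigma>t N \<in> carrier_mat (T N) (T N)" for N by (simp add: \<Sigma>t)
  have X_car: "X N \<omega> \<in> carrier_mat (T N) (T N)" if "\<omega> \<in> space M" for N \<omega>
    using Wc_car[OF that, of N] by (simp add: X_def)
  have Y_car: "Y N \<omega> \<in> carrier_mat N N" if "\<omega> \<in> space M" for N \<omega>
    using Wc_car[OF that, of N] \<Sigma>t_car[of N] by (simp add: Y_def)
  have \<Sigma>s_car: "\<Sigma>s N \<omega> \<in> carrier_mat N N" if "\<omega> \<in> space M" for N \<omega>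
  proof -
    have "V N \<omega> \<in> carrier_mat N N" using wig[of N] that by (auto simp: wigner_matrix_def)
    then show ?thesis by (simp add: \<Sigma>s)
  qed
  have evT: "\<forall>\<^sub>F N in sequentially. 0 < T N"
    using filterlim_at_top[THEN iffD1, OF T, rule_format, of 1] by eventually_elim simp
  \<comment> \<open>The traces are real, which settles the imaginary part; the real part falls under
    \<open>wishart_trace_limit\<close>.\<close>
  have X_moment: "\<phi>2 (a2 ^ k) = complex_of_real (mp_moment c k)" for k
  proof -
    have lim: "AE \<omega> in M. (\<lambda>N. complex_of_real (gram_trace N (T N) k (\<lambda>i. W N \<omega> $$ i) / real (T N) ^ Suc k)) \<longlonglongrightarrow> \<phi>2 (a2 ^ k)"
      using AE2 AE_space
    proof eventually_elim
      case (elim \<omega>)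
      have "(\<lambda>N. norm_trace (X N \<omega> ^\<^sub>m k)) \<longlonglongrightarrow> \<phi>2 (a2 ^ k)"
        using elim(1)[rule_format, of "[(k, 0)]"] mat_word_single(1)[OF X_car[OF elim(2)] \<Sigma>t_car] by simp
      moreover have "\<forall>\<^sub>F N in sequentially. norm_trace (X N \<omega> ^\<^sub>m k)
          = complex_of_real (gram_trace N (T N) k (\<lambda>i. W N \<omega> $$ i) / real (T N) ^ Suc k)"
        using evT
      proof eventually_elim
        case (elim N)
        show ?case unfolding X_def Wc by (rule norm_trace_gram[OF W_car[OF \<open>\<omega> \<in> space M\<close>] elim])
      qed
      ultimately show ?case by (rule Lim_transform_eventually)
    qed
    have w: "wishart M N (T N) (\<lambda>i \<omega>. W N \<omega> $$ i)" if "0 < N" "0 < T N" for N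
    proof
      have "(\<lambda>(i, j) \<omega>. W N \<omega> $$ (i, j)) = (\<lambda>i \<omega>. W N \<omega> $$ i)" by auto
      then show "indep_vars (\<lambda>_. borel) (\<lambda>i \<omega>. W N \<omega> $$ i) ({..<N} \<times> {..<T N})"
        using gauss[of N] by (simp add: gaussian_matrix_def)
      show "distributed M lborel (\<lambda>\<omega>. W N \<omega> $$ i) std_normal_density" if "i \<in> {..<N} \<times> {..<T N}" for i
        using gauss[of N] that by (auto simp: gaussian_matrix_def)
    qed (use that in auto)
    have "AE \<omega> in M. (\<lambda>N. gram_trace N (T N) k (\<lambda>i. W N \<omega> $$ i) / real (T N) ^ Suc k) \<longlonglongrightarrow> Re (\<phi>2 (a2 ^ k))"
      using lim by eventually_elim (use tendsto_Re in fastforce)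
    then have "Re (\<phi>2 (a2 ^ k)) = mp_moment c k"
      by (rule wishart_trace_limit[where X = "\<lambda>N i \<omega>. W N \<omega> $$ i", OF T NT _ assms(1), rotated])
        (rule w)
    moreover have "AE \<omega> in M. Im (\<phi>2 (a2 ^ k)) = 0"
      using lim
    proof eventually_elim
      case (elim \<omega>)
      then show ?case using tendsto_Im[OF elim] by (simp add: LIMSEQ_const_iff)
    qed
    then have "Im (\<phi>2 (a2 ^ k)) = 0" by simp
    ultimately show ?thesis by (simp add: complex_eq_iff)
  qed
  have AE3: "AE \<omega> in M. \<forall>k\<ge>1. (\<lambda>N. norm_trace (\<Sigma>s N \<omega> ^\<^sub>m k)) \<longlonglongrightarrow> complex_of_real (semicircle_moment \<alpha> \<beta> k)"
    using conv_s by (simp add: converges_in_distribution_def semicircle_moment_def)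
  have AE4: "AE \<omega> in M. \<forall>k\<ge>1. (\<lambda>N. norm_trace (C N \<omega> ^\<^sub>m k)) \<longlonglongrightarrow> complex_of_real (\<integral>t. t ^ k \<partial>\<mu>C)"
    using conv_C by (simp add: converges_in_distribution_def)
  \<comment> \<open>All limits are deterministic, so one sample point at which every almost sure
    statement holds suffices from here on.\<close>
  have "\<exists>\<omega>\<in>space M.
      (\<forall>kls. (\<lambda>N. norm_trace (mat_word (Y N \<omega>) (\<Sigma>s N \<omega>) kls))
        \<longlonglongrightarrow> \<phi>1 (prod_list (map (\<lambda>(k, l). a1 ^ k * b1 ^ l) kls))) \<and>
      (\<forall>kls. (\<lambda>N. norm_trace (mat_word (X N \<omega>) (\<Sigma>t N) kls))
        \<longlonglongrightarrow> \<phi>2 (prod_list (map (\<lambda>(k, l). a2 ^ k * b2 ^ l) kls))) \<and>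
      (\<forall>k\<ge>1. (\<lambda>N. norm_trace (\<Sigma>s N \<omega> ^\<^sub>m k)) \<longlonglongrightarrow> complex_of_real (semicircle_moment \<alpha> \<beta> k)) \<and>
      (\<forall>k\<ge>1. (\<lambda>N. norm_trace (C N \<omega> ^\<^sub>m k)) \<longlonglongrightarrow> complex_of_real (\<integral>t. t ^ k \<partial>\<mu>C)) \<and>
      (\<forall>\<^sub>F N in sequentially. nonneg_definite (\<Sigma>s N \<omega>))" (is "\<exists>\<omega>\<in>space M. ?P \<omega>")
  proof (rule ccontr)
    assume none: "\<not> (\<exists>\<omega>\<in>space M. ?P \<omega>)"
    have "AE \<omega> in M. False"
      using AE1 AE2 AE3 AE4 pos AE_space by eventually_elim (use none in blast)
    then show False by simp
  qed
  then obtain \<omega> where \<omega>: "\<omega> \<in> space M"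
    and lim1: "\<And>kls. (\<lambda>N. norm_trace (mat_word (Y N \<omega>) (\<Sigma>s N \<omega>) kls))
        \<longlonglongrightarrow> \<phi>1 (prod_list (map (\<lambda>(k, l). a1 ^ k * b1 ^ l) kls))"
    and lim2: "\<And>kls. (\<lambda>N. norm_trace (mat_word (X N \<omega>) (\<Sigma>t N) kls))
        \<longlonglongrightarrow> \<phi>2 (prod_list (map (\<lambda>(k, l). a2 ^ k * b2 ^ l) kls))"
    and lims: "\<And>k. k \<ge> 1 \<Longrightarrow> (\<lambda>N. norm_trace (\<Sigma>s N \<omega> ^\<^sub>m k)) \<longlonglongrightarrow> complex_of_real (semicircle_moment \<alpha> \<beta> k)"
    and limC: "\<And>k. k \<ge> 1 \<Longrightarrow> (\<lambda>N. norm_trace (C N \<omega> ^\<^sub>m k)) \<longlonglongrightarrow> complex_of_real (\<integral>t. t ^ k \<partial>\<mu>C)"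
    and psd: "\<forall>\<^sub>F N in sequentially. nonneg_definite (\<Sigma>s N \<omega>)"
    by blast
  note car = Wc_car[OF \<omega>] \<Sigma>t_car X_car[OF \<omega>] Y_car[OF \<omega>] \<Sigma>s_car[OF \<omega>]
  have wordprod: "prod_list (map (\<lambda>(k, l). a ^ k * b ^ l) (replicate k (1, 1))) = (a * b) ^ k"
    for a b :: "'c::monoid_mult" and k
    by (induction k) simp_all
  have s_moment: "\<phi>1 (b1 ^ k) = complex_of_real (semicircle_moment \<alpha> \<beta> k)" if "k \<ge> 1" for k
    using lim1[of "[(0, k)]"] mat_word_single(2)[OF car(4,5)] lims[OF that] LIMSEQ_unique by fastforce
  have t_moment: "(\<lambda>N. norm_trace (exp_covariance r (T N) ^\<^sub>m Suc k)) \<longlonglongrightarrow> \<phi>2 (b2 ^ Suc k)" for k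
    using lim2[of "[(0, Suc k)]"] mat_word_single(2)[OF car(3,2)] unfolding \<Sigma>t by simp
  have Y_limit: "(\<lambda>N. norm_trace (Y N \<omega> ^\<^sub>m k)) \<longlonglongrightarrow> \<phi>1 (a1 ^ k)" for k
    using lim1[of "[(k, 0)]"] mat_word_single(1)[OF car(4,5)] by simp
  have XT_limit: "(\<lambda>N. norm_trace ((X N \<omega> * \<Sigma>t N) ^\<^sub>m k)) \<longlonglongrightarrow> \<phi>2 ((a2 * b2) ^ k)" for k
    using lim2[of "replicate k (1, 1)"] unfolding mat_word_replicate[OF car(3,2)] wordprod .
  have YS_limit: "(\<lambda>N. norm_trace ((Y N \<omega> * \<Sigma>s N \<omega>) ^\<^sub>m k)) \<longlonglongrightarrow> \<phi>1 ((a1 * b1) ^ k)" for k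
    using lim1[of "replicate k (1, 1)"] unfolding mat_word_replicate[OF car(4,5)] wordprod .
  \<comment> \<open>Y N and X N times the covariance are products P Q and Q P, of sizes N and T N;
    the ratio of the sizes tends to c.\<close>
  have Y_moment: "\<phi>2 ((a2 * b2) ^ Suc k) = complex_of_real c * \<phi>1 (a1 ^ Suc k)" for k
  proof -
    have "(\<lambda>N. complex_of_real (real N / real (T N)) * norm_trace (Y N \<omega> ^\<^sub>m Suc k))
        \<longlonglongrightarrow> complex_of_real c * \<phi>1 (a1 ^ Suc k)"
      by (intro tendsto_mult tendsto_of_real NT Y_limit)
    moreover have "\<forall>\<^sub>F N in sequentially. complex_of_real (real N / real (T N)) * norm_trace (Y N \<omega> ^\<^sub>m Suc k)
        = norm_trace ((X N \<omega> * \<Sigma>t N) ^\<^sub>m Suc k)"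
      using evT
    proof eventually_elim
      case (elim N)
      let ?W = "Wc N \<omega>" and ?n = N and ?t = "T N"
      define P Q where "P = ?W * \<Sigma>t N" and "Q = complex_of_real (1 / real ?t) \<cdot>\<^sub>m transpose_mat ?W"
      have PQ: "P \<in> carrier_mat ?n ?t" "Q \<in> carrier_mat ?t ?n"
        using car(1)[of N] car(2)[of N] by (auto simp: P_def Q_def)
      have "P * Q = Y N \<omega>"
        using car(1)[of N] car(2)[of N] unfolding P_def Q_def Y_def
        by (subst mult_smult_distrib[of _ ?n ?t _ ?n]) auto
      moreover have "Q * P = X N \<omega> * \<Sigma>t N"
        using car(1)[of N] car(2)[of N] unfolding P_def Q_def X_def
        by (simp add: mult_smult_assoc_mat[of _ ?t ?n _ ?t] mult_smult_assoc_mat[of _ ?t ?t _ ?t]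
            assoc_mult_mat[of _ ?t ?n _ ?t _ ?t])
      ultimately have "of_nat N * norm_trace (Y N \<omega> ^\<^sub>m Suc k) = of_nat (T N) * norm_trace ((X N \<omega> * \<Sigma>t N) ^\<^sub>m Suc k)"
        using norm_trace_pow_mult_commute[OF PQ] by simp
      then show ?case using elim by (simp add: field_simps del: pow_mat.simps)
    qed
    ultimately have "(\<lambda>N. norm_trace ((X N \<omega> * \<Sigma>t N) ^\<^sub>m Suc k)) \<longlonglongrightarrow> complex_of_real c * \<phi>1 (a1 ^ Suc k)"
      by (rule Lim_transform_eventually)
    then show ?thesis using XT_limit LIMSEQ_unique by blast
  qed
  \<comment> \<open>Cyclicity brings the two square roots together, where they multiply to the
    spatial matrix.\<close>
  have C_moment: "\<phi>1 ((a1 * b1) ^ Suc k) = complex_of_real (\<integral>t. t ^ Suc k \<partial>\<mu>C)" for k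
  proof -
    have "\<forall>\<^sub>F N in sequentially. norm_trace ((Y N \<omega> * \<Sigma>s N \<omega>) ^\<^sub>m Suc k) = norm_trace (C N \<omega> ^\<^sub>m Suc k)"
      using psd eventually_gt_at_top[of 0]
    proof eventually_elim
      case (elim N)
      define S where "S = mat_sqrt (\<Sigma>s N \<omega>)"
      have S: "S \<in> carrier_mat N N" "S * S = \<Sigma>s N \<omega>"
        using mat_sqrt[OF elim(1) car(5)] by (simp_all add: S_def)
      have "C N \<omega> = S * (Y N \<omega> * S)"
      proof -
        let ?W = "Wc N \<omega>" and ?s = "complex_of_real (1 / real (T N))"
        define Z where "Z = ?W * \<Sigma>t N * transpose_mat ?W"
        have Z: "Z \<in> carrier_mat N N" using car(1)[of N] car(2)[of N] by (simp add: Z_def)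
        have "S * ?W * \<Sigma>t N * transpose_mat ?W = S * Z"
          using S(1) car(1)[of N] car(2)[of N] unfolding Z_def
          by (simp add: assoc_mult_mat[of _ N N _ "T N" _ "T N"] assoc_mult_mat[of _ N N _ "T N" _ N])
        then have "C N \<omega> = ?s \<cdot>\<^sub>m (S * (Z * S))"
          unfolding C S_def[symmetric] using S(1) Z by (simp add: assoc_mult_mat[of _ N N _ N _ N])
        also have "\<dots> = S * (?s \<cdot>\<^sub>m (Z * S))"
          by (rule mult_smult_distrib[OF S(1) mult_carrier_mat[OF Z S(1)], symmetric])
        also have "?s \<cdot>\<^sub>m (Z * S) = Y N \<omega> * S"
          unfolding Y_def Z_def[symmetric] by (rule mult_smult_assoc_mat[OF Z S(1), symmetric])
        finally show ?thesis .
      qed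
      moreover have "Y N \<omega> * S * S = Y N \<omega> * \<Sigma>s N \<omega>"
        using S car(4)[of N] by (simp add: assoc_mult_mat[of _ N N _ N _ N])
      ultimately have "of_nat N * norm_trace (C N \<omega> ^\<^sub>m Suc k) = of_nat N * norm_trace ((Y N \<omega> * \<Sigma>s N \<omega>) ^\<^sub>m Suc k)"
        using norm_trace_pow_mult_commute[OF S(1) mult_carrier_mat[OF car(4) S(1)], of k] by simp
      then show ?case using elim(2) by (simp del: pow_mat.simps)
    qed
    from Lim_transform_eventually[OF YS_limit this] show ?thesis
      using limC[of "Suc k"] LIMSEQ_unique by auto
  qed
  \<comment> \<open>The total mass 1 is read off from the convergence hypothesis instead of being
    integrated.\<close>
  have "prob_space (semicircle_law \<alpha> \<beta>)"
    using conv_s by (simp add: converges_in_distribution_def compactly_supported_law_def)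
  then have s0: "semicircle_moment \<alpha> \<beta> 0 = 1"
    by (simp add: semicircle_moment_def prob_space.prob_space)
  have s1: "semicircle_moment \<alpha> \<beta> 1 = \<alpha>" using semicircle_moment_recursion(1)[OF \<beta>] s0 by simp
  \<comment> \<open>For \<alpha> = 0 the first three moments would be 0, \<beta>^2 and 0, against
    \<open>psd_moment_inequality\<close> in the limit.\<close>
  have \<alpha>: "\<alpha> \<noteq> 0"
  proof
    assume 0: "\<alpha> = 0"
    have m2: "semicircle_moment \<alpha> \<beta> 2 = \<beta>\<^sup>2"
      using semicircle_moment_recursion(2)[OF \<beta>, of 0 \<alpha>] s0 s1 0 by (simp add: numeral_2_eq_2)
    have m3: "semicircle_moment \<alpha> \<beta> 3 = 0"
      using semicircle_moment_recursion(2)[OF \<beta>, of 1 \<alpha>] s1 0 by (simp add: numeral_3_eq_3)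
    have "(\<lambda>N. Re (norm_trace (\<Sigma>s N \<omega> ^\<^sub>m 3) - 2 * norm_trace (\<Sigma>s N \<omega> ^\<^sub>m 2) + norm_trace (\<Sigma>s N \<omega> ^\<^sub>m 1)))
       \<longlonglongrightarrow> Re (complex_of_real (semicircle_moment \<alpha> \<beta> 3) - 2 * complex_of_real (semicircle_moment \<alpha> \<beta> 2)
            + complex_of_real (semicircle_moment \<alpha> \<beta> 1))"
      by (intro tendsto_intros lims) auto
    moreover have "\<forall>\<^sub>F N in sequentially. 0 \<le> Re (norm_trace (\<Sigma>s N \<omega> ^\<^sub>m 3) - 2 * norm_trace (\<Sigma>s N \<omega> ^\<^sub>m 2) + norm_trace (\<Sigma>s N \<omega> ^\<^sub>m 1))"
      using psd by eventually_elim (rule psd_moment_inequality, simp add: nonneg_definite_iff_psd[OF car(5)])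
    ultimately have "0 \<le> Re (complex_of_real (semicircle_moment \<alpha> \<beta> 3) - 2 * complex_of_real (semicircle_moment \<alpha> \<beta> 2)
            + complex_of_real (semicircle_moment \<alpha> \<beta> 1))"
      by (rule tendsto_lowerbound) simp
    then show False using m2 m3 s1 0 \<beta> by simp
  qed
  let ?c = "complex_of_real c" and ?g = "complex_of_real \<gamma>"
  have c0: "?c \<noteq> 0" using c by simp
  have ms0: "fps_nth (N1.moment_series x) 0 = 0" "fps_nth (N2.moment_series y) 0 = 0" for x y
    by (simp_all add: N1.moment_series_def N2.moment_series_def)
  have "N2.moment_series a2 = Abs_fps (\<lambda>n. if n = 0 then 0 else complex_of_real (mp_moment c n))"
    by (simp add: N2.moment_series_def X_moment cong: if_cong)
  then have X_eq: "N2.moment_series a2 = fps_X * (fps_const ?c + N2.moment_series a2) * (1 + N2.moment_series a2)"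
    using mp_moment_series[of c] by simp
  have t_eq: "(N2.moment_series b2)\<^sup>2 * (1 - fps_const (2 * ?g) * fps_X + fps_X\<^sup>2) = fps_X\<^sup>2"
    using exp_covariance_moment_series[OF r T, of "\<lambda>k. \<phi>2 (b2 ^ k)"] t_moment assms(8)
    by (simp add: N2.moment_series_def del: pow_mat.simps)
  obtain u v x where uvx: "fps_nth u 0 = 0" "fps_nth v 0 = 0" "fps_nth x 0 = 0"
    "N2.moment_series a2 oo u = fps_X" "N2.moment_series b2 oo v = fps_X" "fps_X * x = u * v * (1 + fps_X)"
    "x * (fps_const ?c + fps_X) = v" "fps_X\<^sup>2 * (1 - fps_const (2 * ?g) * v + v\<^sup>2) = v\<^sup>2"
    using wishart_covariance_inverse[OF c0 ms0(2) X_eq ms0(2) t_eq] by blast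
  have "N2.freely_independent a2 b2" using free2 by (simp add: asymptotically_free_def)
  then have "N2.moment_series (a2 * b2) oo x = fps_X"
    by (rule N2.moment_series_free_mult[OF _ uvx(1,2,4,5,6)])
  then obtain u1 w where u1: "fps_nth u1 0 = 0" "(fps_const (1 / ?c) * N2.moment_series (a2 * b2)) oo u1 = fps_X"
    "u1 * fps_const ?c * (1 + fps_X) = w"
    "(fps_const ?c * fps_X)\<^sup>2 * (1 - fps_const (2 * ?g) * w + w\<^sup>2) = w\<^sup>2"
    using rescale_inverse[OF c0 uvx(3) _ uvx(7,2,8)] by blast
  \<comment> \<open>Here the two probability spaces meet: a1 has the moments of a2 b2 divided by
    c.\<close>
  have "fps_const (1 / ?c) * N2.moment_series (a2 * b2) = N1.moment_series a1"
  proof (rule fps_ext)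
    fix n show "fps_nth (fps_const (1 / ?c) * N2.moment_series (a2 * b2)) n = fps_nth (N1.moment_series a1) n"
      using Y_moment[of "n - 1"] c0 by (cases n) (simp_all add: N1.moment_series_def N2.moment_series_def)
  qed
  then have u1': "N1.moment_series a1 oo u1 = fps_X" using u1(2) by simp
  define \<psi>s where "\<psi>s = N1.moment_series b1"
  have M: "1 + \<psi>s = Abs_fps (\<lambda>n. complex_of_real (semicircle_moment \<alpha> \<beta> n))"
    by (rule fps_ext) (auto simp: \<psi>s_def N1.moment_series_def s_moment s0)
  have s_eq: "fps_const ((complex_of_real \<beta>)\<^sup>2) * (fps_X * (1 + \<psi>s))\<^sup>2
      + fps_const (complex_of_real \<alpha>) * (fps_X * (1 + \<psi>s)) = \<psi>s"
    using semicircle_moment_series[OF \<beta> s0] unfolding M[symmetric] by simp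
  have "fps_nth \<psi>s 1 \<noteq> 0" using s_moment[of 1] s1 \<alpha> by (simp add: \<psi>s_def N1.moment_series_def)
  then obtain us where us: "fps_nth us 0 = 0" "\<psi>s oo us = fps_X"
    using fps_compositional_inverse[of \<psi>s] ms0(1) by (auto simp: \<psi>s_def)
  define x1 where "x1 = fps_shift 1 (u1 * us * (1 + fps_X))"
  have x1: "fps_X * x1 = u1 * us * (1 + fps_X)"
    unfolding x1_def using u1 us by (intro fps_ext) (simp add: fps_mult_nth_0)
  define \<psi>C where "\<psi>C = N1.moment_series (a1 * b1)"
  have "N1.freely_independent a1 b1" using free1 by (simp add: asymptotically_free_def)
  then have Cx: "\<psi>C oo x1 = fps_X"
    unfolding \<psi>C_def using us(2) unfolding \<psi>s_def
    by (rule N1.moment_series_free_mult[OF _ u1(1) us(1) u1' _ x1])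
  \<comment> \<open>A right inverse for composition forces a nonzero linear coefficient of \<psi>C,
    and then it is also a left inverse.\<close>
  have xC: "x1 oo \<psi>C = fps_X"
  proof -
    have x10: "fps_nth x1 0 = 0"
      using arg_cong[OF x1, of "\<lambda>F. fps_nth F 1"] u1(1) us(1) by (simp add: fps_mult_nth)
    have "fps_nth \<psi>C 1 \<noteq> 0"
    proof
      assume "fps_nth \<psi>C 1 = 0"
      then have "fps_nth (\<psi>C oo x1) 1 = 0"
        using ms0(1) by (simp add: fps_compose_nth \<psi>C_def)
      then show False unfolding Cx by simp
    qed
    then obtain y where y: "fps_nth y 0 = 0" "\<psi>C oo y = fps_X" "y oo \<psi>C = fps_X"
      using fps_compositional_inverse[of \<psi>C] ms0(1) by (auto simp: \<psi>C_def)
    have "x1 = (y oo \<psi>C) oo x1" using y(3) x10 by simp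
    also have "\<dots> = y oo (\<psi>C oo x1)"
      using x10 ms0(1) by (intro fps_compose_assoc[symmetric]) (simp_all add: \<psi>C_def)
    finally show ?thesis using y(3) Cx by simp
  qed
  have "\<psi>C = Abs_fps (\<lambda>n. if n = 0 then 0 else complex_of_real (\<integral>t. t ^ n \<partial>\<mu>C))"
  proof (rule fps_ext)
    fix n show "fps_nth \<psi>C n = fps_nth (Abs_fps (\<lambda>n. if n = 0 then 0 else complex_of_real (\<integral>t. t ^ n \<partial>\<mu>C))) n"
      using C_moment[of "n - 1"] by (cases n) (simp_all add: \<psi>C_def N1.moment_series_def)
  qed
  note \<psi>C_eq = this
  have \<psi>C0: "fps_nth \<psi>C 0 = 0" using ms0(1) by (simp add: \<psi>C_def)
  have "compactly_supported_law \<mu>C" using conv_C by (simp add: converges_in_distribution_def)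
  from cauchy_transform_algebraic[OF this c0 z, folded \<psi>C_eq,
      OF moment_series_equation[OF c0 s_eq us u1(3,4) x1 xC \<psi>C0]]
  show "(\<Sum>i\<le>8. p_coeffs ?c (complex_of_real \<alpha>) (complex_of_real \<beta>) ?g z ! i * cauchy_transform \<mu>C z ^ i) = 0" .
qed

end
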